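(* Let $p$ be an odd prime, let $a$ be an odd positive integer, and let $r$ be a positive integer such that $r\ge 3$. Let $n=ar$. Then there exists a finite $p$-group $G$ with properties (P1), (P2) and (P3) such that $|G/Z(G)|=p^{2n}$ and the Chermak-Delgado lattice $\mathcal{CD}(G)$ is a quasi-antichain of width $w=p^a+1$, in which the number of abelian atoms is $t=0$.
   Context: For a finite group $G$ and $H\le G$, the Chermak-Delgado measure of $H$ in $G$ is $m_G(H)=|H|\,|C_G(H)|$. Put $m^*(G)=\max\{m_G(H)\mid H\le G\}$ and $\mathcal{CD}(G)=\{H\le G\mid m_G(H)=m^*(G)\}$. It is known that $\mathcal{CD}(G)$, ordered by inclusion, is a lattice of subgroups of $G$, called the Chermak-Delgado lattice of $G$. A quasi-antichain is a lattice consisting of a maximum, a minimum, and the atoms of the lattice; its width $w$ is the number of atoms, and $w\ge 3$ is assumed. An abelian atom is an atom of $\mathcal{CD}(G)$ that is an abelian group. Let $M_1,\dots,M_w$ be all the atoms of $\mathcal{CD}(G)$. Properties (P1)-(P3) are: (P1) Both $G/Z(G)$ and $G'$ are elementary abelian. (P2) $M_i/Z(G)\cong M_j/Z(G)$ and $G/Z(G)=M_i/Z(G)\times M_j/Z(G)$ for $i\ne j$. (P3) Let $M_1=\langle x_1,\dots,x_n\rangle Z(G)$ and $M_2=\langle y_1,\dots,y_n\rangle Z(G)$, where $M_1/Z(G)$ and $M_2/Z(G)$ are elementary abelian of order $p^n$. Then for each $k\ge 3$ one has $M_k=\langle x_1y_1',\dots,x_ny_n'\rangle Z(G)$ for some $y_1',\dots,y_n'$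 with $M_2=\langle y_1',\dots,y_n'\rangle Z(G)$; moreover there is an invertible $n\times n$ matrix $(c^{(k)}_{ij})$ over $\mathbb{F}_p$ with $y_j'\equiv\prod_{i=1}^n y_i^{c^{(k)}_{ij}} \pmod{Z(G)}$ for $j=1,\dots,n$. *)

theory Defs
  imports "HOL-Algebra.Algebra" "HOL-Number_Theory.Number_Theory"
begin

definition centralizer :: "('a, 'b) monoid_scheme \<Rightarrow> 'a set \<Rightarrow> 'a set"
  where "centralizer G H =
    {g \<in> carrier G. \<forall>h\<in>H. g \<otimes>\<^bsub>G\<^esub> h = h \<otimes>\<^bsub>G\<^esub> g}"

definition center :: "('a, 'b) monoid_scheme \<Rightarrow> 'a set"
  where "center G = centralizer G (carrier G)"

definition elementary_abelian :: "nat \<Rightarrow> ('a, 'b) monoid_scheme \<Rightarrow> bool"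
  where "elementary_abelian p H \<longleftrightarrow>
    Factorial_Ring.prime p \<and> comm_group H \<and> finite (carrier H) \<and>
    (\<forall>x\<in>carrier H. x [^]\<^bsub>H\<^esub> p = \<one>\<^bsub>H\<^esub>)"

definition internal_direct_product :: "('a, 'b) monoid_scheme \<Rightarrow> 'a set \<Rightarrow> 'a set \<Rightarrow> bool"
  where "internal_direct_product G A B \<longleftrightarrow>
    A \<lhd> G \<and> B \<lhd> G \<and> A \<inter> B = {\<one>\<^bsub>G\<^esub>} \<and> A <#>\<^bsub>G\<^esub> B = carrier G"

definition finite_p_group :: "nat \<Rightarrow> ('a, 'b) monoid_scheme \<Rightarrow> bool"
  where "finite_p_group p G \<longleftrightarrow>
    group G \<and> finite (carrier G) \<and> (\<exists>k. Coset.order G = p ^ k)"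


definition cd_measure :: "('a, 'b) monoid_scheme \<Rightarrow> 'a set \<Rightarrow> nat"
  where "cd_measure G H = card H * card (centralizer G H)"

definition cd_max :: "('a, 'b) monoid_scheme \<Rightarrow> nat"
  where "cd_max G = Max {cd_measure G H | H. subgroup H G}"

definition cd_lattice :: "('a, 'b) monoid_scheme \<Rightarrow> 'a set gorder"
  where "cd_lattice G =
    \<lparr>carrier = {H. subgroup H G \<and> cd_measure G H = cd_max G}, eq = (=), le = (\<subseteq>)\<rparr>"

definition atoms :: "('a, 'b) gorder_scheme \<Rightarrow> 'a set"
  where "atoms L = {x \<in> carrier L. x \<noteq> \<bottom>\<^bsub>L\<^esub> \<and>
    (\<forall>y\<in>carrier L. y \<sqsubseteq>\<^bsub>L\<^esub> x \<longrightarrow> y = \<bottom>\<^bsub>L\<^esub> \<or> y = x)}"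

definition quasi_antichain :: "('a, 'b) gorder_scheme \<Rightarrow> nat \<Rightarrow> bool"
  where "quasi_antichain L w \<longleftrightarrow>
    bounded_lattice L \<and> carrier L = {\<bottom>\<^bsub>L\<^esub>, \<top>\<^bsub>L\<^esub>} \<union> atoms L \<and>
    card (atoms L) = w \<and> w \<ge> 3"

definition abelian_atoms :: "('a, 'b) monoid_scheme \<Rightarrow> 'a set set"
  where "abelian_atoms G =
    {M \<in> atoms (cd_lattice G). comm_group (G\<lparr>carrier := M\<rparr>)}"


text \<open>The quotient of a subgroup \<open>M\<close> containing the center. Its elements are the cosets of the
  center represented in \<open>M\<close>, so its carrier is a subset of that of \<open>G Mod center G\<close>. Every
  member of the Chermak-Delgado lattice contains the center.\<close>

abbreviation quot_center :: "('a, 'b) monoid_scheme \<Rightarrow> 'a set \<Rightarrow> 'a set monoid"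
  where "quot_center G M \<equiv> G\<lparr>carrier := M\<rparr> Mod center G"

definition P1 :: "nat \<Rightarrow> ('a, 'b) monoid_scheme \<Rightarrow> bool"
  where "P1 p G \<longleftrightarrow>
    elementary_abelian p (G Mod center G) \<and>
    elementary_abelian p (G\<lparr>carrier := derived G (carrier G)\<rparr>)"

definition P2 :: "('a, 'b) monoid_scheme \<Rightarrow> bool"
  where "P2 G \<longleftrightarrow>
    (\<forall>M\<in>atoms (cd_lattice G). \<forall>N\<in>atoms (cd_lattice G). M \<noteq> N \<longrightarrow>
      quot_center G M \<cong> quot_center G N \<and>
      internal_direct_product (G Mod center G)
        (carrier (quot_center G M)) (carrier (quot_center G N)))"

text \<open>\<open>x\<^sub>1, \<dots>, x\<^sub>n\<close> are elements of \<open>G\<close> with \<open>M = \<langle>x\<^sub>1, \<dots>, x\<^sub>n\<rangle> Z(G)\<close>.\<close>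

definition generates_mod_center ::
    "('a, 'b) monoid_scheme \<Rightarrow> nat \<Rightarrow> (nat \<Rightarrow> 'a) \<Rightarrow> 'a set \<Rightarrow> bool"
  where "generates_mod_center G n x M \<longleftrightarrow>
    x ` {1..n} \<subseteq> carrier G \<and> M = generate G (x ` {1..n}) <#>\<^bsub>G\<^esub> center G"

text \<open>The ordered product \<open>f 1 \<otimes> \<dots> \<otimes> f n\<close>; the group need not be commutative.\<close>

definition ordered_prod :: "('a, 'b) monoid_scheme \<Rightarrow> nat \<Rightarrow> (nat \<Rightarrow> 'a) \<Rightarrow> 'a"
  where "ordered_prod G n f = foldr (\<lambda>i z. f i \<otimes>\<^bsub>G\<^esub> z) [1..<Suc n] \<one>\<^bsub>G\<^esub>"

text \<open>Square matrices with index set \<open>{1..n}\<close> over a ring given by a carrier.\<close>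

definition square_matrix :: "('a, 'b) ring_scheme \<Rightarrow> nat \<Rightarrow> (nat \<Rightarrow> nat \<Rightarrow> 'a) \<Rightarrow> bool"
  where "square_matrix R n c \<longleftrightarrow> (\<forall>i\<in>{1..n}. \<forall>j\<in>{1..n}. c i j \<in> carrier R)"

definition inverse_matrices ::
    "('a, 'b) ring_scheme \<Rightarrow> nat \<Rightarrow> (nat \<Rightarrow> nat \<Rightarrow> 'a) \<Rightarrow> (nat \<Rightarrow> nat \<Rightarrow> 'a) \<Rightarrow> bool"
  where "inverse_matrices R n c d \<longleftrightarrow>
    (\<forall>i\<in>{1..n}. \<forall>j\<in>{1..n}.
      (\<Oplus>\<^bsub>R\<^esub>k\<in>{1..n}. c i k \<otimes>\<^bsub>R\<^esub> d k j) = (if i = j then \<one>\<^bsub>R\<^esub> else \<zero>\<^bsub>R\<^esub>) \<and>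
      (\<Oplus>\<^bsub>R\<^esub>k\<in>{1..n}. d i k \<otimes>\<^bsub>R\<^esub> c k j) = (if i = j then \<one>\<^bsub>R\<^esub> else \<zero>\<^bsub>R\<^esub>))"

definition invertible_matrix :: "('a, 'b) ring_scheme \<Rightarrow> nat \<Rightarrow> (nat \<Rightarrow> nat \<Rightarrow> 'a) \<Rightarrow> bool"
  where "invertible_matrix R n c \<longleftrightarrow> square_matrix R n c \<and>
    (\<exists>d. square_matrix R n d \<and> inverse_matrices R n c d)"

text \<open>The atoms \<open>M\<^sub>1, \<dots>, M\<^sub>w\<close> are listed in no particular order, so \<open>M\<^sub>1\<close>, \<open>M\<^sub>2\<close> and \<open>M\<^sub>k\<close> range over
  all triples of distinct atoms. The field with \<open>p\<close> elements is \<open>residue_ring (int p)\<close>, whose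
  elements are the integers \<open>0, \<dots>, p - 1\<close>; these serve directly as exponents.\<close>

definition P3 :: "nat \<Rightarrow> nat \<Rightarrow> ('a, 'b) monoid_scheme \<Rightarrow> bool"
  where "P3 p n G \<longleftrightarrow>
    (\<forall>M1\<in>atoms (cd_lattice G). \<forall>M2\<in>atoms (cd_lattice G). M1 \<noteq> M2 \<longrightarrow>
      elementary_abelian p (quot_center G M1) \<and> Coset.order (quot_center G M1) = p ^ n \<and>
      elementary_abelian p (quot_center G M2) \<and> Coset.order (quot_center G M2) = p ^ n \<and>
      (\<forall>x y. generates_mod_center G n x M1 \<and> generates_mod_center G n y M2 \<longrightarrow>
        (\<forall>Mk\<in>atoms (cd_lattice G) - {M1, M2}.
          \<exists>y'. generates_mod_center G n y' M2 \<and>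
            generates_mod_center G n (\<lambda>j. x j \<otimes>\<^bsub>G\<^esub> y' j) Mk \<and>
            (\<exists>c. invertible_matrix (residue_ring (int p)) n c \<and>
              (\<forall>j\<in>{1..n}.
                center G #>\<^bsub>G\<^esub> y' j =
                center G #>\<^bsub>G\<^esub> ordered_prod G n (\<lambda>i. y i [^]\<^bsub>G\<^esub> c i j))))))"

end

theory Submission
  imports Defs
begin

text \<open>Let \<open>F\<close> be a field with \<open>q = p\<^sup>a\<close> elements and \<open>\<nu>\<close> a nonsquare of \<open>F\<close>. On
  \<open>V = F\<^sup>r \<otimes> F\<^sup>2\<close>, whose elements are written as pairs \<open>(x, y)\<close> of vectors of \<open>F\<^sup>r\<close>, take the
  alternating map \<open>y \<and> y' - \<nu> (x \<and> x')\<close> to the exterior square of \<open>F\<^sup>r\<close>: the tensor product of the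
  wedge product with the anisotropic form \<open>t t' - \<nu> s s'\<close> on \<open>F\<^sup>2\<close>. Let \<open>G\<close> be a central extension
  of \<open>V\<close> whose commutator is this map. Centralizers in \<open>G\<close> are preimages of orthogonal complements,
  so the subgroups of maximal measure are the preimages of the \<open>U \<subseteq> V\<close> with
  \<open>|U| |U\<^sup>\<bottom>| = |V| = q\<^sup>2\<^sup>r\<close>.

  Each line \<open>\<ell>\<close> of \<open>F\<^sup>2\<close> gives the solution \<open>U = F\<^sup>r \<otimes> \<ell>\<close>, with \<open>U\<^sup>\<bottom> = F\<^sup>r \<otimes> \<ell>\<^sup>\<bottom>\<close>. Since \<open>\<ell> \<noteq> \<ell>\<^sup>\<bottom>\<close>,
  its preimage is not abelian. Besides these \<open>q + 1\<close> sets only \<open>0\<close> and \<open>V\<close> attain the maximum: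
  a tensor of rank two has a complement of at most \<open>q\<^sup>3\<close> elements, one of rank one a complement of at
  most \<open>q\<^sup>r\<^sup>+\<^sup>1\<close>, and a space of tensors of rank at most one lies in some \<open>F\<^sup>r \<otimes> \<ell>\<close> or \<open>u \<otimes> F\<^sup>2\<close>;
  as \<open>r \<ge> 3\<close>, this leaves no further possibility.\<close>

section \<open>Orthogonal complements for the form\<close>

text \<open>The sets U are arbitrary subsets of V: the images of subgroups of G are additive groups,
  but need not be F-subspaces. So nothing is decided by dimensions. Each complement is bounded by
  listing parameters for its elements, and U is replaced by its double complement, which can only
  enlarge the product. The tight case is r = 3: if both members of a pair of mutual complements
  contain tensors of rank two, the bounds give q^3 * q^3 = q^6 = q^(2 r), with no room left. The way
  out is that the double complement of a rank two tensor has at most q^2 elements, whereas a proper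
  subset of its complement has fewer than q^3. The oddness of p enters through \<nu>: squaring
  identifies 1 and -1, so some element is not a square. For (P3) all atoms are described by the same
  vectors u of F^r: the coordinates of three points of the projective line can be scaled so that the
  third is the sum of the first two, and u \<otimes> (s, t) + u \<otimes> (s', t') = u \<otimes> (s
  + s', t + t').\<close>

definition vec :: "('a, 'm) ring_scheme \<Rightarrow> 'i set \<Rightarrow> ('i \<Rightarrow> 'a) set"
  where "vec R I = {f. (\<forall>i. f i \<in> carrier R) \<and> (\<forall>i. i \<notin> I \<longrightarrow> f i = \<zero>\<^bsub>R\<^esub>)}"

lemma vecD: "f \<in> vec R I \<Longrightarrow> f i \<in> carrier R" "f \<in> vec R I \<Longrightarrow> i \<notin> I \<Longrightarrow> f i = \<zero>\<^bsub>R\<^esub>"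
  by (auto simp: vec_def)

lemma card_vec:
  assumes "finite I" and "\<zero>\<^bsub>R\<^esub> \<in> carrier R"
  shows "card (vec R I) = card (carrier R) ^ card I"
proof -
  have "bij_betw (\<lambda>f. restrict f I) (vec R I) (I \<rightarrow>\<^sub>E carrier R)"
  proof (rule bij_betwI[where g = "\<lambda>f i. if i \<in> I then f i else \<zero>\<^bsub>R\<^esub>"])
    fix f assume "f \<in> I \<rightarrow>\<^sub>E carrier R"
    then show "restrict (\<lambda>i. if i \<in> I then f i else \<zero>\<^bsub>R\<^esub>) I = f"
      by (auto simp: PiE_def extensional_def restrict_def fun_eq_iff)
  qed (use assms in \<open>auto simp: vec_def PiE_def Pi_def extensional_def fun_eq_iff\<close>)
  then show ?thesis
    using card_PiE[OF assms(1), of "\<lambda>_. carrier R"] bij_betw_same_card by fastforce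
qed

lemma finite_vec:
  assumes "finite I" and "finite (carrier R)"
  shows "finite (vec R I)"
proof -
  have "vec R I \<subseteq> {f. \<forall>i. (i \<in> I \<longrightarrow> f i \<in> carrier R) \<and> (i \<notin> I \<longrightarrow> f i = \<zero>\<^bsub>R\<^esub>)}"
    by (auto simp: vec_def)
  then show ?thesis
    using finite_set_of_finite_funs[OF assms] finite_subset by blast
qed

section \<open>Inverses and proportional vectors over a field\<close>

context field
begin

lemma inv_nonzero:
  assumes "a \<in> carrier R" "a \<noteq> \<zero>"
  shows "inv a \<in> carrier R" "inv a \<otimes> a = \<one>" "inv a \<noteq> \<zero>"
proof -
  have "a \<in> Units R" using assms field_Units by auto
  then show "inv a \<in> carrier R" "inv a \<otimes> a = \<one>" "inv a \<noteq> \<zero>"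
    using field_Units Units_inv_Units[of a] by auto
qed

lemma eq_inv_mult:
  assumes "a \<in> carrier R" "a \<noteq> \<zero>" "x \<in> carrier R" "a \<otimes> x = z"
  shows "x = inv a \<otimes> z"
  using inv_nonzero[OF assms(1,2)] assms by (metis l_one m_assoc)

text \<open>The equations express that all 2 x 2 minors of the matrix with rows \<open>u\<close> and
  \<open>b\<close> vanish; the nonzero entry \<open>u k\<close> supplies the denominator of the
  factor.\<close>

lemma parallelD:
  assumes "\<And>i. u i \<in> carrier R" "\<And>i. b i \<in> carrier R" "u k \<noteq> \<zero>"
    and eq: "\<And>i j. u i \<otimes> b j = u j \<otimes> b i"
  obtains \<kappa> where "\<kappa> \<in> carrier R" "b = (\<lambda>j. \<kappa> \<otimes> u j)"
proof
  note i = inv_nonzero[OF assms(1,3)]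
  show "inv (u k) \<otimes> b k \<in> carrier R" using i assms by auto
  show "b = (\<lambda>j. inv (u k) \<otimes> b k \<otimes> u j)"
  proof
    fix j
    have "b j = inv (u k) \<otimes> (u j \<otimes> b k)"
      by (rule eq_inv_mult[OF assms(1,3,2)]) (rule eq)
    then show "b j = inv (u k) \<otimes> b k \<otimes> u j" using i assms by (simp add: m_ac)
  qed
qed

lemma mult_minus_cancel:
  assumes "a \<in> carrier R" "b \<in> carrier R" "a \<noteq> b" "x \<in> carrier R"
    and "a \<otimes> x = b \<otimes> x"
  shows "x = \<zero>"
proof -
  have "(a \<ominus> b) \<otimes> x = a \<otimes> x \<ominus> b \<otimes> x" using assms(1,2,4) by algebra
  also have "\<dots> = \<zero>" using assms by (simp add: minus_eq r_neg)
  finally show ?thesis using assms(1-4) integral_iff[of "a \<ominus> b" x] by auto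
qed

end

text \<open>The condition \<open>nonsquare\<close> also excludes \<nu> = 0, because zero is a
  square; every cancellation of \<nu> below rests on this.\<close>

locale anisotropic_form = field R for R (structure) +
  fixes \<nu> :: 'a and r :: nat
  assumes finite_carrier: "finite (carrier R)"
    and nu_closed: "\<nu> \<in> carrier R"
    and nonsquare: "x \<in> carrier R \<Longrightarrow> x \<otimes> x \<noteq> \<nu>"
    and r_ge: "3 \<le> r"
begin

abbreviation "W \<equiv> vec R {..<r}"
abbreviation "V \<equiv> W \<times> W"
abbreviation "q \<equiv> card (carrier R)"

text \<open>\<open>y \<and> y' = \<nu> (x \<and> x')\<close>, stated as the symmetry of the matrix \<open>y\<^sub>i y'\<^sub>j - \<nu> x\<^sub>i x'\<^sub>j\<close>. Its indices
  need no bound because vectors vanish outside \<open>{..<r}\<close>.\<close>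

definition perp :: "(nat \<Rightarrow> 'a) \<times> (nat \<Rightarrow> 'a) \<Rightarrow> (nat \<Rightarrow> 'a) \<times> (nat \<Rightarrow> 'a) \<Rightarrow> bool"
  where "perp v w \<longleftrightarrow> (\<forall>i j.
    snd v i \<otimes> snd w j \<ominus> \<nu> \<otimes> (fst v i \<otimes> fst w j) = snd v j \<otimes> snd w i \<ominus> \<nu> \<otimes> (fst v j \<otimes> fst w i))"

definition orth :: "((nat \<Rightarrow> 'a) \<times> (nat \<Rightarrow> 'a)) set \<Rightarrow> ((nat \<Rightarrow> 'a) \<times> (nat \<Rightarrow> 'a)) set"
  where "orth S = {w \<in> V. \<forall>v\<in>S. perp v w}"

definition tensor :: "'a \<Rightarrow> 'a \<Rightarrow> (nat \<Rightarrow> 'a) \<Rightarrow> (nat \<Rightarrow> 'a) \<times> (nat \<Rightarrow> 'a)"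
  where "tensor s t u = (\<lambda>i. s \<otimes> u i, \<lambda>i. t \<otimes> u i)"

definition line :: "'a \<Rightarrow> 'a \<Rightarrow> ((nat \<Rightarrow> 'a) \<times> (nat \<Rightarrow> 'a)) set"
  where "line s t = tensor s t ` W"

text \<open>Homogeneous coordinates of a point of the projective line over F; proportional pairs
  define the same \<open>line\<close>.\<close>

definition point :: "'a \<Rightarrow> 'a \<Rightarrow> bool"
  where "point s t \<longleftrightarrow> s \<in> carrier R \<and> t \<in> carrier R \<and> (s, t) \<noteq> (\<zero>, \<zero>)"

definition zero_vec :: "nat \<Rightarrow> 'a" where "zero_vec = (\<lambda>i. \<zero>)"

text \<open>Rank at most one: the vanishing of the 2 x 2 minors of the two-column matrix
  \<open>v\<close> includes \<open>v\<close> = 0.\<close>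

definition rank1 :: "(nat \<Rightarrow> 'a) \<times> (nat \<Rightarrow> 'a) \<Rightarrow> bool"
  where "rank1 v \<longleftrightarrow> (\<forall>i j. fst v i \<otimes> snd v j = fst v j \<otimes> snd v i)"

lemma W_closed: "u \<in> W \<Longrightarrow> u i \<in> carrier R"
  by (rule vecD)

lemma zero_vec_W [simp]: "zero_vec \<in> W"
  by (simp add: zero_vec_def vec_def)

lemma scale_W [simp]: "u \<in> W \<Longrightarrow> s \<in> carrier R \<Longrightarrow> (\<lambda>i. s \<otimes> u i) \<in> W"
  by (auto simp: vec_def)

lemma add_W [simp]: "u \<in> W \<Longrightarrow> v \<in> W \<Longrightarrow> (\<lambda>i. u i \<oplus> v i) \<in> W"
  by (auto simp: vec_def)

lemma minus_W [simp]: "u \<in> W \<Longrightarrow> v \<in> W \<Longrightarrow> (\<lambda>i. u i \<ominus> v i) \<in> W"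
  by (auto simp: vec_def minus_eq)

lemma W_nonzeroE:
  assumes "u \<in> W" "u \<noteq> zero_vec"
  obtains i where "i < r" "u i \<noteq> \<zero>"
  using assms by (auto simp: vec_def zero_vec_def fun_eq_iff)

lemma finite_W [simp]: "finite W"
  by (simp add: finite_vec finite_carrier)

lemma card_W: "card W = q ^ r"
  by (simp add: card_vec)

lemma q_ge: "2 \<le> q"
proof -
  have "card {\<zero>, \<one>} \<le> q"
    by (intro card_mono finite_carrier) auto
  then show ?thesis by simp
qed

text \<open>This is the anisotropy of the form on F^2: a zero with s \<noteq> 0 would make t/s a
  square root of \<nu>, and s = 0 forces t = 0.\<close>

lemma point_norm:
  assumes "point s t"
  shows "t \<otimes> t \<ominus> \<nu> \<otimes> s \<otimes> s \<noteq> \<zero>"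
proof
  have st: "s \<in> carrier R" "t \<in> carrier R" using assms by (auto simp: point_def)
  assume "t \<otimes> t \<ominus> \<nu> \<otimes> s \<otimes> s = \<zero>"
  then have eq: "t \<otimes> t = \<nu> \<otimes> s \<otimes> s" using st nu_closed by simp
  show False
  proof (cases "s = \<zero>")
    case True
    then have "t \<otimes> t = \<zero>" using eq st nu_closed by simp
    then show False using st True assms integral by (auto simp: point_def)
  next
    case False
    obtain m where m: "m \<in> carrier R" "m \<otimes> s = \<one>"
      using inv_nonzero[OF st(1) False] by blast
    have "(m \<otimes> t) \<otimes> (m \<otimes> t) = m \<otimes> m \<otimes> (t \<otimes> t)"
      using st m(1) by algebra
    also have "\<dots> = \<nu> \<otimes> (m \<otimes> s) \<otimes> (m \<otimes> s)"
      unfolding eq using st m(1) nu_closed by algebra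
    also have "\<dots> = \<nu>" unfolding m(2) using nu_closed by simp
    finally show False using nonsquare[of "m \<otimes> t"] st m by simp
  qed
qed

text \<open>The pair (t, \<nu> s) spans the orthogonal complement of (s, t) for the form t t' -
  \<nu> s s', since t (\<nu> s) - \<nu> s t = 0.\<close>

lemma point_perp:
  assumes "point s t"
  shows "point t (\<nu> \<otimes> s)"
  using assms nu_closed nonsquare[of \<zero>] integral[of \<nu> s] by (auto simp: point_def)

lemma perp_sym:
  assumes "v \<in> V" "w \<in> V" "perp v w"
  shows "perp w v"
  unfolding perp_def
proof (intro allI)
  fix i j
  have *: "snd v j \<otimes> snd w i \<ominus> \<nu> \<otimes> (fst v j \<otimes> fst w i) = snd v i \<otimes> snd w j \<ominus> \<nu> \<otimes> (fst v i \<otimes> fst w j)"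
    using assms(3) by (simp add: perp_def)
  have W: "fst v \<in> W" "snd v \<in> W" "fst w \<in> W" "snd w \<in> W" using assms by auto
  note [simp] = W[THEN W_closed]
  show "snd w i \<otimes> snd v j \<ominus> \<nu> \<otimes> (fst w i \<otimes> fst v j) = snd w j \<otimes> snd v i \<ominus> \<nu> \<otimes> (fst w j \<otimes> fst v i)"
    using * nu_closed by (simp add: m_comm)
qed

text \<open>Pairing with u \<otimes> (s, t) contracts the other argument with (s, t), so
  orthogonality becomes u \<and> (t y - \<nu> s x) = 0, a proportionality of two vectors of
  F^r.\<close>

lemma perp_tensor_iff:
  assumes "s \<in> carrier R" "t \<in> carrier R" "u \<in> W" "x \<in> W" "y \<in> W"
  shows "perp (tensor s t u) (x, y) \<longleftrightarrow>
    (\<forall>i j. u i \<otimes> (t \<otimes> y j \<ominus> \<nu> \<otimes> s \<otimes> x j) = u j \<otimes> (t \<otimes> y i \<ominus> \<nu> \<otimes> s \<otimes> x i))"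
proof -
  have "t \<otimes> u i \<otimes> y j \<ominus> \<nu> \<otimes> (s \<otimes> u i \<otimes> x j) = u i \<otimes> (t \<otimes> y j \<ominus> \<nu> \<otimes> s \<otimes> x j)" for i j
  proof -
    have "u i \<in> carrier R" "x j \<in> carrier R" "y j \<in> carrier R" using assms W_closed by auto
    then show ?thesis using assms(1,2) nu_closed by algebra
  qed
  then show ?thesis by (simp add: perp_def tensor_def)
qed

lemma tensor_V [simp]: "s \<in> carrier R \<Longrightarrow> t \<in> carrier R \<Longrightarrow> u \<in> W \<Longrightarrow> tensor s t u \<in> V"
  by (simp add: tensor_def)

lemma rank1E:
  assumes "v \<in> V" "v \<noteq> (zero_vec, zero_vec)" "rank1 v"
  obtains s t u where "point s t" "u \<in> W" "u \<noteq> zero_vec" "v = tensor s t u"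
proof (cases "fst v = zero_vec")
  case True
  have "snd v \<in> W" "snd v \<noteq> zero_vec" using assms(1,2) True by (auto simp: prod_eq_iff)
  moreover have "v = tensor \<zero> \<one> (snd v)"
    using True W_closed[OF calculation(1)] by (auto simp: tensor_def prod_eq_iff zero_vec_def)
  ultimately show ?thesis using that[of \<zero> \<one> "snd v"] by (auto simp: point_def)
next
  case False
  have W: "fst v \<in> W" "snd v \<in> W" using assms(1) by auto
  note [simp] = W[THEN W_closed]
  obtain k where k: "fst v k \<noteq> \<zero>" using W_nonzeroE[OF W(1) False] by blast
  obtain \<kappa> where "\<kappa> \<in> carrier R" "snd v = (\<lambda>j. \<kappa> \<otimes> fst v j)"
    by (rule parallelD[of "fst v" "snd v" k]) (use W k assms(3) in \<open>auto simp: rank1_def\<close>)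
  moreover have "fst v = (\<lambda>j. \<one> \<otimes> fst v j)" using W by auto
  ultimately show ?thesis
    using that[of \<one> \<kappa> "fst v"] W False by (auto simp: point_def tensor_def prod_eq_iff)
qed

text \<open>By anisotropy (s, t) and (t, \<nu> s) form a basis of F^2, so (x, y) = b \<otimes> (s,
  t) + c \<otimes> (t, \<nu> s) for some b and c. Contraction with (s, t) kills the second summand
  and multiplies the first by N = t t - \<nu> s s; hence orthogonality says exactly that b is
  proportional to u, and c stays free.\<close>

lemma perp_tensorE:
  assumes st: "point s t" and u: "u \<in> W" "u \<noteq> zero_vec" and xy: "x \<in> W" "y \<in> W"
    and perp: "perp (tensor s t u) (x, y)"
  obtains \<kappa> c where "\<kappa> \<in> carrier R" "c \<in> W"
    "x = (\<lambda>i. s \<otimes> (\<kappa> \<otimes> u i) \<oplus> t \<otimes> c i)" "y = (\<lambda>i. t \<otimes> (\<kappa> \<otimes> u i) \<oplus> \<nu> \<otimes> s \<otimes> c i)"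
proof -
  have st' [simp]: "s \<in> carrier R" "t \<in> carrier R" using st by (auto simp: point_def)
  note [simp] = nu_closed W_closed[OF u(1)] W_closed[OF xy(1)] W_closed[OF xy(2)]
  define N where "N = t \<otimes> t \<ominus> \<nu> \<otimes> s \<otimes> s"
  have N: "N \<in> carrier R" "N \<noteq> \<zero>" using point_norm[OF st] by (auto simp: N_def)
  note i = inv_nonzero[OF N]
  define b where "b = (\<lambda>j. t \<otimes> y j \<ominus> \<nu> \<otimes> s \<otimes> x j)"
  have b: "b j \<in> carrier R" for j using xy by (simp add: b_def)
  obtain k where k: "u k \<noteq> \<zero>" using W_nonzeroE[OF u] by blast
  obtain \<kappa> where \<kappa>: "\<kappa> \<in> carrier R" "b = (\<lambda>j. \<kappa> \<otimes> u j)"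
    by (rule parallelD[of u b k])
      (use u k b perp xy perp_tensor_iff[of s t u x y] in \<open>auto simp: b_def\<close>)
  \<comment> \<open>Cramer's rule for this basis: t x - s y is N times the second component.\<close>
  define c where "c = (\<lambda>j. inv N \<otimes> (t \<otimes> x j \<ominus> s \<otimes> y j))"
  have c: "c \<in> W" unfolding c_def using i xy by (intro scale_W minus_W) auto
  have *: "t \<otimes> y j \<ominus> \<nu> \<otimes> s \<otimes> x j = \<kappa> \<otimes> u j" for j
    using \<kappa>(2) by (simp add: b_def fun_eq_iff)
  show thesis
  proof (rule that[of "inv N \<otimes> \<kappa>" c])
    show "inv N \<otimes> \<kappa> \<in> carrier R" using i \<kappa> by simp
    have "x j = s \<otimes> (inv N \<otimes> \<kappa> \<otimes> u j) \<oplus> t \<otimes> c j"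
      and "y j = t \<otimes> (inv N \<otimes> \<kappa> \<otimes> u j) \<oplus> \<nu> \<otimes> s \<otimes> c j" for j
    proof -
      have cl: "x j \<in> carrier R" "y j \<in> carrier R" "u j \<in> carrier R" using xy u by auto
      obtain m where m: "m = inv N" "m \<in> carrier R" using i by simp
      have *: "inv N \<otimes> \<kappa> \<otimes> u j = m \<otimes> (t \<otimes> y j \<ominus> \<nu> \<otimes> s \<otimes> x j)"
        using * cl m \<kappa> by (simp add: m_assoc)
      have cc: "c j = m \<otimes> (t \<otimes> x j \<ominus> s \<otimes> y j)" by (simp add: c_def m)
      have "s \<otimes> (m \<otimes> (t \<otimes> y j \<ominus> \<nu> \<otimes> s \<otimes> x j)) \<oplus> t \<otimes> (m \<otimes> (t \<otimes> x j \<ominus> s \<otimes> y j)) = m \<otimes> (N \<otimes> x j)"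
        unfolding N_def using cl m(2) st' nu_closed by algebra
      then show "x j = s \<otimes> (inv N \<otimes> \<kappa> \<otimes> u j) \<oplus> t \<otimes> c j"
        unfolding * cc using i N cl m by (simp flip: m_assoc)
      have "t \<otimes> (m \<otimes> (t \<otimes> y j \<ominus> \<nu> \<otimes> s \<otimes> x j)) \<oplus> \<nu> \<otimes> s \<otimes> (m \<otimes> (t \<otimes> x j \<ominus> s \<otimes> y j)) = m \<otimes> (N \<otimes> y j)"
        unfolding N_def using cl m(2) st' nu_closed by algebra
      then show "y j = t \<otimes> (inv N \<otimes> \<kappa> \<otimes> u j) \<oplus> \<nu> \<otimes> s \<otimes> c j"
        unfolding * cc using i N cl m by (simp flip: m_assoc)
    qed
    then show "x = (\<lambda>i. s \<otimes> (inv N \<otimes> \<kappa> \<otimes> u i) \<oplus> t \<otimes> c i)"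
      "y = (\<lambda>i. t \<otimes> (inv N \<otimes> \<kappa> \<otimes> u i) \<oplus> \<nu> \<otimes> s \<otimes> c i)" by auto
  qed (rule c)
qed

section \<open>Complements as a Galois connection\<close>

lemma orth_subset: "orth S \<subseteq> V"
  by (auto simp: orth_def)

lemma orth_antimono: "S \<subseteq> T \<Longrightarrow> orth T \<subseteq> orth S"
  by (auto simp: orth_def)

lemma subset_orth_orth: "S \<subseteq> V \<Longrightarrow> S \<subseteq> orth (orth S)"
  using perp_sym unfolding orth_def by blast

lemma orth_orth_orth: "S \<subseteq> V \<Longrightarrow> orth (orth (orth S)) = orth S"
  by (intro subset_antisym orth_antimono subset_orth_orth orth_subset)

lemma finite_V [simp]: "finite V"
  by simp

lemma finite_orth [simp]: "finite (orth S)"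
  using orth_subset finite_V finite_subset by blast

lemma zero_in_orth:
  assumes "S \<subseteq> V"
  shows "(zero_vec, zero_vec) \<in> orth S"
proof -
  have "perp v (zero_vec, zero_vec)" if "v \<in> S" for v
  proof -
    have "fst v \<in> W" "snd v \<in> W" using assms that by auto
    note [simp] = this[THEN W_closed]
    show ?thesis by (simp add: perp_def zero_vec_def nu_closed)
  qed
  then show ?thesis by (simp add: orth_def)
qed

lemma perp_add:
  assumes "v \<in> V" "w \<in> V" "w' \<in> V" "perp v w" "perp v w'"
  shows "perp v (\<lambda>i. fst w i \<oplus> fst w' i, \<lambda>i. snd w i \<oplus> snd w' i)"
  unfolding perp_def fst_conv snd_conv
proof (intro allI)
  fix i j
  have W: "fst v \<in> W" "snd v \<in> W" "fst w \<in> W" "snd w \<in> W" "fst w' \<in> W" "snd w' \<in> W"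
    using assms by auto
  note c = W[THEN W_closed] nu_closed
  have expand: "a \<otimes> (b \<oplus> b') \<ominus> \<nu> \<otimes> (d \<otimes> (e \<oplus> e')) = (a \<otimes> b \<ominus> \<nu> \<otimes> (d \<otimes> e)) \<oplus> (a \<otimes> b' \<ominus> \<nu> \<otimes> (d \<otimes> e'))"
    if "a \<in> carrier R" "b \<in> carrier R" "b' \<in> carrier R" "d \<in> carrier R" "e \<in> carrier R" "e' \<in> carrier R"
    for a b b' d e e'
    using that nu_closed by algebra
  show "snd v i \<otimes> (snd w j \<oplus> snd w' j) \<ominus> \<nu> \<otimes> (fst v i \<otimes> (fst w j \<oplus> fst w' j)) =
    snd v j \<otimes> (snd w i \<oplus> snd w' i) \<ominus> \<nu> \<otimes> (fst v j \<otimes> (fst w i \<oplus> fst w' i))"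
    unfolding expand[OF c(2) c(4) c(6) c(1) c(3) c(5)]
    using assms(4,5) unfolding perp_def by metis
qed

text \<open>Closure under addition is the only linear structure of complements that the
  classification in \<open>rank1_space_cases\<close> asks for.\<close>

lemma orth_add:
  assumes "S \<subseteq> V" "w \<in> orth S" "w' \<in> orth S"
  shows "(\<lambda>i. fst w i \<oplus> fst w' i, \<lambda>i. snd w i \<oplus> snd w' i) \<in> orth S"
proof -
  have "w \<in> V" "w' \<in> V" using assms orth_subset by blast+
  then have "(\<lambda>i. fst w i \<oplus> fst w' i, \<lambda>i. snd w i \<oplus> snd w' i) \<in> V" by auto
  moreover have "perp v (\<lambda>i. fst w i \<oplus> fst w' i, \<lambda>i. snd w i \<oplus> snd w' i)" if "v \<in> S" for v
    by (rule perp_add) (use assms that \<open>w \<in> V\<close> \<open>w' \<in> V\<close> in \<open>auto simp: orth_def\<close>)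
  ultimately show ?thesis by (simp add: orth_def)
qed

lemma card_orth_rank1:
  assumes "point s t" "u \<in> W" "u \<noteq> zero_vec"
  shows "card (orth {tensor s t u}) \<le> q ^ (r + 1)"
proof -
  let ?f = "\<lambda>(\<kappa>, c). (\<lambda>i. s \<otimes> (\<kappa> \<otimes> u i) \<oplus> t \<otimes> c i, \<lambda>i. t \<otimes> (\<kappa> \<otimes> u i) \<oplus> \<nu> \<otimes> s \<otimes> c i)"
  have "orth {tensor s t u} \<subseteq> ?f ` (carrier R \<times> W)"
  proof
    fix w assume w: "w \<in> orth {tensor s t u}"
    obtain x y where [simp]: "w = (x, y)" by force
    have *: "x \<in> W" "y \<in> W" "perp (tensor s t u) (x, y)" using w by (auto simp: orth_def)
    then obtain \<kappa> c where "\<kappa> \<in> carrier R" "c \<in> W"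
      "x = (\<lambda>i. s \<otimes> (\<kappa> \<otimes> u i) \<oplus> t \<otimes> c i)" "y = (\<lambda>i. t \<otimes> (\<kappa> \<otimes> u i) \<oplus> \<nu> \<otimes> s \<otimes> c i)"
      using perp_tensorE[OF assms] by blast
    then show "w \<in> ?f ` (carrier R \<times> W)"
      by (intro image_eqI[of _ _ "(\<kappa>, c)"]) simp_all
  qed
  then have "card (orth {tensor s t u}) \<le> card (carrier R \<times> W)"
    by (rule surj_card_le[rotated]) (simp add: finite_carrier)
  then show ?thesis by (simp add: card_cartesian_product card_W)
qed

text \<open>Orthogonality to both tensors gives u \<and> (t y - \<nu> s x) = 0 and the same with
  (s', t'). As the points are independent and \<nu> \<noteq> 0, the two contractions combine to u
  \<and> x = 0 and u \<and> y = 0.\<close>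

lemma orth_two_points:
  assumes st: "s \<in> carrier R" "t \<in> carrier R" "s' \<in> carrier R" "t' \<in> carrier R"
    and indep: "s \<otimes> t' \<noteq> s' \<otimes> t"
    and u: "u \<in> W" "u \<noteq> zero_vec"
    and w: "(x, y) \<in> V" "perp (tensor s t u) (x, y)" "perp (tensor s' t' u) (x, y)"
  obtains \<alpha> \<beta> where "\<alpha> \<in> carrier R" "\<beta> \<in> carrier R" "(x, y) = tensor \<alpha> \<beta> u"
proof -
  have xy: "x \<in> W" "y \<in> W" using w by auto
  note cl = W_closed[OF u(1)] W_closed[OF xy(1)] W_closed[OF xy(2)] nu_closed st
  have nu0: "\<nu> \<noteq> \<zero>" using nonsquare[of \<zero>] by auto
  have eq1: "u i \<otimes> (t \<otimes> y j \<ominus> \<nu> \<otimes> s \<otimes> x j) = u j \<otimes> (t \<otimes> y i \<ominus> \<nu> \<otimes> s \<otimes> x i)" for i j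
    using w(2) perp_tensor_iff[OF st(1,2) u(1) xy] by blast
  have eq2: "u i \<otimes> (t' \<otimes> y j \<ominus> \<nu> \<otimes> s' \<otimes> x j) = u j \<otimes> (t' \<otimes> y i \<ominus> \<nu> \<otimes> s' \<otimes> x i)" for i j
    using w(3) perp_tensor_iff[OF st(3,4) u(1) xy] by blast
  have uy: "u i \<otimes> y j = u j \<otimes> y i" and ux: "u i \<otimes> x j = u j \<otimes> x i" for i j
  proof -
    \<comment> \<open>Elimination of x and of y from the two contractions; the determinant of the
      two points appears as a factor.\<close>
    have comb: "s \<otimes> (a \<otimes> (t' \<otimes> e \<ominus> \<nu> \<otimes> s' \<otimes> d)) \<ominus> s' \<otimes> (a \<otimes> (t \<otimes> e \<ominus> \<nu> \<otimes> s \<otimes> d)) =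
        (s \<otimes> t' \<ominus> s' \<otimes> t) \<otimes> (a \<otimes> e)"
      "t \<otimes> (a \<otimes> (t' \<otimes> e \<ominus> \<nu> \<otimes> s' \<otimes> d)) \<ominus> t' \<otimes> (a \<otimes> (t \<otimes> e \<ominus> \<nu> \<otimes> s \<otimes> d)) =
        (s \<otimes> t' \<ominus> s' \<otimes> t) \<otimes> (\<nu> \<otimes> (a \<otimes> d))"
      if "a \<in> carrier R" "d \<in> carrier R" "e \<in> carrier R" for a d e
      using that st nu_closed by algebra+
    have \<Delta>: "s \<otimes> t' \<ominus> s' \<otimes> t \<noteq> \<zero>" "s \<otimes> t' \<ominus> s' \<otimes> t \<in> carrier R" using indep st by auto
    have "(s \<otimes> t' \<ominus> s' \<otimes> t) \<otimes> (u i \<otimes> y j) = (s \<otimes> t' \<ominus> s' \<otimes> t) \<otimes> (u j \<otimes> y i)"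
      unfolding comb(1)[OF cl(1,2,3), of i j j, symmetric] comb(1)[OF cl(1,2,3), of j i i, symmetric]
        eq1[of i j] eq2[of i j] ..
    then show "u i \<otimes> y j = u j \<otimes> y i" using \<Delta> cl by (simp add: m_lcancel)
    have "(s \<otimes> t' \<ominus> s' \<otimes> t) \<otimes> (\<nu> \<otimes> (u i \<otimes> x j)) = (s \<otimes> t' \<ominus> s' \<otimes> t) \<otimes> (\<nu> \<otimes> (u j \<otimes> x i))"
      unfolding comb(2)[OF cl(1,2,3), of i j j, symmetric] comb(2)[OF cl(1,2,3), of j i i, symmetric]
        eq1[of i j] eq2[of i j] ..
    then show "u i \<otimes> x j = u j \<otimes> x i" using \<Delta> cl nu0 by (simp add: m_lcancel)
  qed
  obtain k where k: "u k \<noteq> \<zero>" using W_nonzeroE[OF u] by blast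
  obtain \<alpha> where "\<alpha> \<in> carrier R" "x = (\<lambda>j. \<alpha> \<otimes> u j)"
    using parallelD[of u x k, OF cl(1,2) k ux] by blast
  moreover obtain \<beta> where "\<beta> \<in> carrier R" "y = (\<lambda>j. \<beta> \<otimes> u j)"
    using parallelD[of u y k, OF cl(1,3) k uy] by blast
  ultimately show ?thesis using that by (auto simp: tensor_def)
qed

text \<open>In the form given by \<open>perp_tensorE\<close> for \<open>u\<close>, contraction with
  (s, t) yields a multiple of \<kappa> u, which must also be proportional to \<open>u'\<close>.
  Independence of \<open>u\<close> and \<open>u'\<close> forces \<kappa> = 0, and only c \<otimes>
  (t, \<nu> s) is left.\<close>

lemma orth_two_vectors:
  assumes st: "point s t" and u: "u \<in> W" "u \<noteq> zero_vec" "u' \<in> W"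
    and indep: "u i0 \<otimes> u' j0 \<noteq> u j0 \<otimes> u' i0"
    and w: "(x, y) \<in> V" "perp (tensor s t u) (x, y)" "perp (tensor s t u') (x, y)"
  shows "(x, y) \<in> line t (\<nu> \<otimes> s)"
proof -
  have xy: "x \<in> W" "y \<in> W" using w by auto
  have st': "s \<in> carrier R" "t \<in> carrier R" using st by (auto simp: point_def)
  note cl = W_closed[OF u(1)] W_closed[OF u(3)] nu_closed st'
  obtain \<kappa> c where k: "\<kappa> \<in> carrier R" "c \<in> W"
    "x = (\<lambda>i. s \<otimes> (\<kappa> \<otimes> u i) \<oplus> t \<otimes> c i)" "y = (\<lambda>i. t \<otimes> (\<kappa> \<otimes> u i) \<oplus> \<nu> \<otimes> s \<otimes> c i)"
    using perp_tensorE[OF st u(1,2) xy w(2)] by blast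
  note c = W_closed[OF k(2)]
  define N where "N = t \<otimes> t \<ominus> \<nu> \<otimes> s \<otimes> s"
  have N: "N \<in> carrier R" "N \<noteq> \<zero>" using point_norm[OF st] cl by (auto simp: N_def)
  have "t \<otimes> (t \<otimes> (\<kappa> \<otimes> a) \<oplus> \<nu> \<otimes> s \<otimes> d) \<ominus> \<nu> \<otimes> s \<otimes> (s \<otimes> (\<kappa> \<otimes> a) \<oplus> t \<otimes> d) = N \<otimes> (\<kappa> \<otimes> a)"
    if "a \<in> carrier R" "d \<in> carrier R" for a d
    unfolding N_def using that k(1) cl(3-5) by algebra
  then have "t \<otimes> y j \<ominus> \<nu> \<otimes> s \<otimes> x j = N \<otimes> (\<kappa> \<otimes> u j)" for j
    unfolding k using cl c by auto
  then have "u' i0 \<otimes> (N \<otimes> (\<kappa> \<otimes> u j0)) = u' j0 \<otimes> (N \<otimes> (\<kappa> \<otimes> u i0))"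
    using w(3) perp_tensor_iff[OF st' u(3) xy] by metis
  then have "N \<otimes> ((u i0 \<otimes> u' j0) \<otimes> \<kappa>) = N \<otimes> ((u j0 \<otimes> u' i0) \<otimes> \<kappa>)"
    using N k(1) cl by (simp add: m_ac)
  then have "(u i0 \<otimes> u' j0) \<otimes> \<kappa> = (u j0 \<otimes> u' i0) \<otimes> \<kappa>"
    using N k(1) cl by (simp add: m_lcancel)
  then have "\<kappa> = \<zero>" using mult_minus_cancel[OF _ _ indep k(1)] cl by simp
  then have "(x, y) = tensor t (\<nu> \<otimes> s) c"
    using k c cl by (simp add: tensor_def)
  then show ?thesis using k(2) by (simp add: line_def)
qed

text \<open>Wedging y \<and> y' = \<nu> (x \<and> x') with y and with x puts x' and y' into the span
  of the independent vectors x and y. Comparing the coefficients of x \<and> y then ties the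
  x-coefficient of y' to the y-coefficient of x', so that three parameters remain.\<close>

lemma orth_rank2:
  assumes v: "(x, y) \<in> V" and indep: "x i0 \<otimes> y j0 \<noteq> x j0 \<otimes> y i0"
    and w: "(x', y') \<in> V" "perp (x, y) (x', y')"
  obtains \<alpha> \<beta> \<delta> where "\<alpha> \<in> carrier R" "\<beta> \<in> carrier R" "\<delta> \<in> carrier R"
    "x' = (\<lambda>k. \<alpha> \<otimes> x k \<oplus> \<beta> \<otimes> y k)" "y' = (\<lambda>k. \<delta> \<otimes> y k \<ominus> \<nu> \<otimes> \<beta> \<otimes> x k)"
proof -
  have W: "x \<in> W" "y \<in> W" "x' \<in> W" "y' \<in> W" using v w by auto
  note cl = W[THEN W_closed]
  note cl' = cl(1)[of i0] cl(1)[of j0] cl(2)[of i0] cl(2)[of j0] cl(3)[of i0] cl(3)[of j0]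
    cl(4)[of i0] cl(4)[of j0] nu_closed
  have nu0: "\<nu> \<noteq> \<zero>" using nonsquare[of \<zero>] by auto
  define P where "P i j = y i \<otimes> y' j \<ominus> y j \<otimes> y' i" for i j
  define Q where "Q i j = x i \<otimes> x' j \<ominus> x j \<otimes> x' i" for i j
  have PQcl: "P i j \<in> carrier R" "Q i j \<in> carrier R" for i j using cl by (auto simp: P_def Q_def)
  have PQ: "P i j = \<nu> \<otimes> Q i j" for i j
  proof -
    have eq: "y i \<otimes> y' j \<ominus> \<nu> \<otimes> (x i \<otimes> x' j) = y j \<otimes> y' i \<ominus> \<nu> \<otimes> (x j \<otimes> x' i)"
      using w(2) by (simp add: perp_def)
    have rearrange: "b \<ominus> d = \<nu> \<otimes> (a \<ominus> c)" if "b \<ominus> \<nu> \<otimes> a = d \<ominus> \<nu> \<otimes> c"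
      "a \<in> carrier R" "b \<in> carrier R" "c \<in> carrier R" "d \<in> carrier R" for a b c d
    proof -
      have "b \<ominus> d = (b \<ominus> \<nu> \<otimes> a) \<oplus> \<nu> \<otimes> a \<ominus> d" using that(2-) nu_closed by algebra
      also have "\<dots> = (d \<ominus> \<nu> \<otimes> c) \<oplus> \<nu> \<otimes> a \<ominus> d" unfolding that(1) ..
      also have "\<dots> = \<nu> \<otimes> (a \<ominus> c)" using that(2-) nu_closed by algebra
      finally show ?thesis .
    qed
    show ?thesis unfolding P_def Q_def
      by (rule rearrange[OF eq]) (intro m_closed cl)+
  qed
  define \<Delta> where "\<Delta> = x i0 \<otimes> y j0 \<ominus> x j0 \<otimes> y i0"
  have \<Delta>: "\<Delta> \<in> carrier R" "\<Delta> \<noteq> \<zero>" using indep cl by (auto simp: \<Delta>_def)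
  obtain m where m: "m \<in> carrier R" "m \<otimes> \<Delta> = \<one>" using inv_nonzero[OF \<Delta>] by blast
  \<comment> \<open>The coefficients come from Cramer's rule on the rows \<open>i0\<close> and
    \<open>j0\<close>, where the minor \<Delta> of x and y is nonzero.\<close>
  define \<alpha> where "\<alpha> = m \<otimes> (x' i0 \<otimes> y j0 \<ominus> x' j0 \<otimes> y i0)"
  define \<beta> where "\<beta> = m \<otimes> Q i0 j0"
  define \<delta> where "\<delta> = m \<otimes> (x i0 \<otimes> y' j0 \<ominus> x j0 \<otimes> y' i0)"
  have x': "x' k = \<alpha> \<otimes> x k \<oplus> \<beta> \<otimes> y k" and y': "y' k = \<delta> \<otimes> y k \<ominus> \<nu> \<otimes> \<beta> \<otimes> x k" for k
  proof -
    \<comment> \<open>A determinant with rows \<open>y\<close>, \<open>y\<close>, \<open>y'\<close> vanishes; since \<open>P = \<nu> Q\<close>, the same holds with \<open>Q\<close>, where it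
      can be solved for \<open>x' k\<close>.\<close>
    have "y k \<otimes> P i0 j0 \<oplus> y i0 \<otimes> P j0 k \<oplus> y j0 \<otimes> P k i0 = \<zero>"
      unfolding P_def using cl(2)[of k] cl(4)[of k] cl' by algebra
    then have "\<nu> \<otimes> (y k \<otimes> Q i0 j0 \<oplus> y i0 \<otimes> Q j0 k \<oplus> y j0 \<otimes> Q k i0) = \<zero>"
      unfolding PQ using cl(2)[of k] cl' PQcl by (simp add: r_distr m_ac)
    then have z: "y k \<otimes> Q i0 j0 \<oplus> y i0 \<otimes> Q j0 k \<oplus> y j0 \<otimes> Q k i0 = \<zero>"
      using integral_iff[of \<nu>] nu0 nu_closed cl PQcl by simp
    have z': "x k \<otimes> Q i0 j0 \<oplus> x i0 \<otimes> Q j0 k \<oplus> x j0 \<otimes> Q k i0 = \<zero>"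
      unfolding Q_def using cl(1)[of k] cl(3)[of k] cl' by algebra
    have "x' k = m \<otimes> \<Delta> \<otimes> x' k" using m cl by simp
    also have "\<dots> = (m \<otimes> (x' i0 \<otimes> y j0 \<ominus> x' j0 \<otimes> y i0)) \<otimes> x k \<oplus> (m \<otimes> (x i0 \<otimes> x' j0 \<ominus> x j0 \<otimes> x' i0)) \<otimes> y k
        \<ominus> m \<otimes> (y k \<otimes> Q i0 j0 \<oplus> y i0 \<otimes> Q j0 k \<oplus> y j0 \<otimes> Q k i0)"
      unfolding \<Delta>_def Q_def using cl(1)[of k] cl(2)[of k] cl(3)[of k] cl' m(1) by algebra
    also have "\<dots> = \<alpha> \<otimes> x k \<oplus> \<beta> \<otimes> y k"
      unfolding z unfolding \<alpha>_def \<beta>_def Q_def using cl m(1) by (simp add: minus_eq)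
    finally show "x' k = \<alpha> \<otimes> x k \<oplus> \<beta> \<otimes> y k" .
    \<comment> \<open>The transfer in the other direction: the vanishing determinant has rows x, x,
      x', and its version with \<open>P\<close> can be solved for \<open>y' k\<close>.\<close>
    have R: "x k \<otimes> P i0 j0 \<oplus> x i0 \<otimes> P j0 k \<oplus> x j0 \<otimes> P k i0 = \<zero>"
    proof -
      have "x k \<otimes> P i0 j0 \<oplus> x i0 \<otimes> P j0 k \<oplus> x j0 \<otimes> P k i0 =
          \<nu> \<otimes> (x k \<otimes> Q i0 j0 \<oplus> x i0 \<otimes> Q j0 k \<oplus> x j0 \<otimes> Q k i0)"
        unfolding PQ using cl(1)[of k] cl' PQcl nu_closed by (simp add: r_distr m_ac)
      then show ?thesis using z' nu_closed by simp
    qed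
    have "y' k = m \<otimes> \<Delta> \<otimes> y' k" using m cl by simp
    also have "\<dots> = (m \<otimes> (x i0 \<otimes> y' j0 \<ominus> x j0 \<otimes> y' i0)) \<otimes> y k \<ominus> (m \<otimes> P i0 j0) \<otimes> x k
        \<oplus> m \<otimes> (x k \<otimes> P i0 j0 \<oplus> x i0 \<otimes> P j0 k \<oplus> x j0 \<otimes> P k i0)"
      unfolding \<Delta>_def P_def using cl(1)[of k] cl(2)[of k] cl(4)[of k] cl' m(1) by algebra
    also have "\<dots> = \<delta> \<otimes> y k \<ominus> \<nu> \<otimes> \<beta> \<otimes> x k"
      unfolding R unfolding PQ \<delta>_def \<beta>_def using cl m(1) nu_closed PQcl by (simp add: minus_eq m_ac)
    finally show "y' k = \<delta> \<otimes> y k \<ominus> \<nu> \<otimes> \<beta> \<otimes> x k" .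
  qed
  have "\<alpha> \<in> carrier R" "\<beta> \<in> carrier R" "\<delta> \<in> carrier R"
    using cl m PQcl by (auto simp: \<alpha>_def \<beta>_def \<delta>_def)
  then show ?thesis using that x' y' by blast
qed

lemma rank1_tensor:
  assumes "s \<in> carrier R" "t \<in> carrier R" "u \<in> W"
  shows "rank1 (tensor s t u)"
  using assms(1,2) W_closed[OF assms(3)] by (simp add: rank1_def tensor_def m_ac)

lemma line_rank1: "point s t \<Longrightarrow> v \<in> line s t \<Longrightarrow> rank1 v"
  by (auto simp: line_def point_def rank1_tensor)

lemma card_line_le: "card (line s t) \<le> q ^ r"
  unfolding line_def card_W[symmetric] by (rule card_image_le) simp

lemma card_V: "card V = q ^ (2 * r)"
  by (simp add: card_cartesian_product card_W mult_2 power_add)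

lemma parallel_points:
  assumes "point s t" "s' \<in> carrier R" "t' \<in> carrier R" "s \<otimes> t' = s' \<otimes> t"
  obtains \<mu> where "\<mu> \<in> carrier R" "s' = \<mu> \<otimes> s" "t' = \<mu> \<otimes> t"
proof (cases "s = \<zero>")
  case False
  have s: "s \<in> carrier R" "t \<in> carrier R" using assms(1) by (auto simp: point_def)
  obtain m where m: "m \<in> carrier R" "m \<otimes> s = \<one>" using inv_nonzero[OF s(1) False] by blast
  have "s' = (m \<otimes> s) \<otimes> s'" using m assms by simp
  then have 1: "s' = m \<otimes> s' \<otimes> s" using m(1) s assms(2) by (simp add: m_ac)
  have "t' = m \<otimes> (s \<otimes> t')" using m s assms(3) by (simp flip: m_assoc)
  also have "\<dots> = m \<otimes> s' \<otimes> t" unfolding assms(4) using m s assms(2) by (simp add: m_assoc)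
  finally show ?thesis using that[of "m \<otimes> s'"] 1 m assms(2) by blast
next
  case True
  have s: "t \<in> carrier R" "t \<noteq> \<zero>" using assms(1) True by (auto simp: point_def)
  obtain m where m: "m \<in> carrier R" "m \<otimes> t = \<one>" using inv_nonzero[OF s] by blast
  have "s' \<otimes> t = \<zero>" using assms(3,4) s True by simp
  then have "s' = \<zero>" using integral s assms(2) by blast
  moreover have "t' = m \<otimes> t' \<otimes> t"
  proof -
    have "m \<otimes> t' \<otimes> t = (m \<otimes> t) \<otimes> t'" using m(1) s assms(3) by (simp add: m_ac)
    then show ?thesis using m assms(3) by simp
  qed
  ultimately show ?thesis using that[of "m \<otimes> t'"] m(1) assms(3) True by auto
qed

lemma tensor_scale:
  assumes "\<mu> \<in> carrier R" "s \<in> carrier R" "t \<in> carrier R" "u \<in> W"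
  shows "tensor (\<mu> \<otimes> s) (\<mu> \<otimes> t) u = tensor s t (\<lambda>i. \<mu> \<otimes> u i)"
  using assms(1-3) W_closed[OF assms(4)] by (simp add: tensor_def m_ac)

text \<open>If S is not contained in the multiples of w, take another element w' outside them. Since
  w + w' has rank at most one, w and w' share either their point or, up to scaling, their vector.
  Already these two elements confine the complement: a common point to a line, by
  \<open>orth_two_vectors\<close>, and a common vector u to the q^2 tensors of u \<otimes> F^2, by
  \<open>orth_two_points\<close>. The rest of S is never looked at.\<close>

lemma rank1_space_cases:
  assumes S: "S \<subseteq> V" "\<And>w. w \<in> S \<Longrightarrow> rank1 w"
    and add: "\<And>w w'. w \<in> S \<Longrightarrow> w' \<in> S \<Longrightarrow> (\<lambda>i. fst w i \<oplus> fst w' i, \<lambda>i. snd w i \<oplus> snd w' i) \<in> S"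
    and w: "w \<in> S" "w \<noteq> (zero_vec, zero_vec)"
  obtains "card S \<le> q"
  | "card (orth S) \<le> q\<^sup>2" "\<And>v. v \<in> orth S \<Longrightarrow> rank1 v"
  | s t where "point s t" "orth S \<subseteq> line s t"
proof -
  obtain s t u where st: "point s t" and u: "u \<in> W" "u \<noteq> zero_vec" and w_eq: "w = tensor s t u"
    using rank1E S w by blast
  have st': "s \<in> carrier R" "t \<in> carrier R" using st by (auto simp: point_def)
  note ucl = W_closed[OF u(1)]
  obtain k where k: "u k \<noteq> \<zero>" using W_nonzeroE[OF u] by blast
  show thesis
  proof (cases "S \<subseteq> (\<lambda>\<kappa>. tensor (\<kappa> \<otimes> s) (\<kappa> \<otimes> t) u) ` carrier R")
    case True
    then show ?thesis using that(1) surj_card_le[OF finite_carrier] by blast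
  next
    case False
    then obtain w' where w': "w' \<in> S" "\<And>\<kappa>. \<kappa> \<in> carrier R \<Longrightarrow> w' \<noteq> tensor (\<kappa> \<otimes> s) (\<kappa> \<otimes> t) u"
      by blast
    have "tensor (\<zero> \<otimes> s) (\<zero> \<otimes> t) u = (zero_vec, zero_vec)"
      using st' ucl by (simp add: tensor_def zero_vec_def)
    then have "w' \<noteq> (zero_vec, zero_vec)" using w'(2)[of \<zero>] by auto
    then obtain s' t' u' where st1: "point s' t'" and u': "u' \<in> W" "u' \<noteq> zero_vec" and w'_eq: "w' = tensor s' t' u'"
      using rank1E S w' by blast
    have st1': "s' \<in> carrier R" "t' \<in> carrier R" using st1 by (auto simp: point_def)
    note u'cl = W_closed[OF u'(1)]
    \<comment> \<open>A 2 x 2 minor of w + w' factors into the determinant of the two points and a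
      minor of the two vectors.\<close>
    have minor: "(s \<otimes> t' \<ominus> s' \<otimes> t) \<otimes> (u i \<otimes> u' j \<ominus> u j \<otimes> u' i) = \<zero>" for i j
    proof -
      have "rank1 (\<lambda>i. fst w i \<oplus> fst w' i, \<lambda>i. snd w i \<oplus> snd w' i)"
        using S(2) add w w' by blast
      then have eq: "(s \<otimes> u i \<oplus> s' \<otimes> u' i) \<otimes> (t \<otimes> u j \<oplus> t' \<otimes> u' j) =
          (s \<otimes> u j \<oplus> s' \<otimes> u' j) \<otimes> (t \<otimes> u i \<oplus> t' \<otimes> u' i)"
        by (simp add: rank1_def w_eq w'_eq tensor_def)
      have "(s \<otimes> t' \<ominus> s' \<otimes> t) \<otimes> (u i \<otimes> u' j \<ominus> u j \<otimes> u' i) =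
          (s \<otimes> u i \<oplus> s' \<otimes> u' i) \<otimes> (t \<otimes> u j \<oplus> t' \<otimes> u' j) \<ominus>
          (s \<otimes> u j \<oplus> s' \<otimes> u' j) \<otimes> (t \<otimes> u i \<oplus> t' \<otimes> u' i)"
        using st' st1' ucl[of i] ucl[of j] u'cl[of i] u'cl[of j] by algebra
      also have "\<dots> = \<zero>" unfolding eq using st' st1' ucl u'cl by (simp add: minus_eq r_neg)
      finally show ?thesis .
    qed
    show ?thesis
    proof (cases "s \<otimes> t' = s' \<otimes> t")
      case True
      obtain \<mu> where l: "\<mu> \<in> carrier R" "s' = \<mu> \<otimes> s" "t' = \<mu> \<otimes> t"
        using parallel_points[OF st st1' True] by blast
      define u2 where "u2 = (\<lambda>i. \<mu> \<otimes> u' i)"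
      have u2: "u2 \<in> W" using u' l by (simp add: u2_def)
      note u2cl = W_closed[OF u2]
      have w'2: "w' = tensor s t u2"
        unfolding w'_eq l u2_def by (rule tensor_scale[OF l(1) st' u'(1)])
      \<comment> \<open>With a common point, proportional vectors would make w' a multiple of w,
        against its choice.\<close>
      have "\<not> (\<forall>i j. u i \<otimes> u2 j = u j \<otimes> u2 i)"
      proof
        assume "\<forall>i j. u i \<otimes> u2 j = u j \<otimes> u2 i"
        then obtain \<kappa> where "\<kappa> \<in> carrier R" "u2 = (\<lambda>j. \<kappa> \<otimes> u j)"
          using parallelD[of u u2 k, OF ucl u2cl k] by blast
        then show False using w'(2)[of \<kappa>] tensor_scale[of \<kappa> s t u] st' u(1) w'2 by simp
      qed
      then obtain i0 j0 where ij: "u i0 \<otimes> u2 j0 \<noteq> u j0 \<otimes> u2 i0" by blast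
      have "orth S \<subseteq> line t (\<nu> \<otimes> s)"
      proof
        fix v assume v: "v \<in> orth S"
        obtain x y where xy: "v = (x, y)" by force
        show "v \<in> line t (\<nu> \<otimes> s)"
          unfolding xy by (rule orth_two_vectors[OF st u u2 ij])
            (use v w w' w_eq w'2 in \<open>auto simp: orth_def xy\<close>)
      qed
      then show ?thesis using that(3) point_perp[OF st] by blast
    next
      case False
      then have "s \<otimes> t' \<ominus> s' \<otimes> t \<noteq> \<zero>" using st' st1' by simp
      then have "u i \<otimes> u' j \<ominus> u j \<otimes> u' i = \<zero>" for i j
        using integral[OF minor[of i j]] st' st1' ucl u'cl by blast
      then have "u i \<otimes> u' j = u j \<otimes> u' i" for i j using ucl u'cl by (metis m_closed r_right_minus_eq)
      then obtain \<kappa> where kk: "\<kappa> \<in> carrier R" "u' = (\<lambda>j. \<kappa> \<otimes> u j)"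
        using parallelD[of u u' k, OF ucl u'cl k] by blast
      have k0: "\<kappa> \<noteq> \<zero>" using kk u'(2) ucl by (auto simp: zero_vec_def)
      have w'2: "w' = tensor (\<kappa> \<otimes> s') (\<kappa> \<otimes> t') u"
        unfolding w'_eq kk(2) by (rule tensor_scale[OF kk(1) st1' u(1), symmetric])
      have ind: "s \<otimes> (\<kappa> \<otimes> t') \<noteq> (\<kappa> \<otimes> s') \<otimes> t"
      proof
        assume "s \<otimes> (\<kappa> \<otimes> t') = (\<kappa> \<otimes> s') \<otimes> t"
        then have "\<kappa> \<otimes> (s \<otimes> t') = \<kappa> \<otimes> (s' \<otimes> t)" using kk st' st1' by (simp add: m_ac)
        then show False using False k0 kk st' st1' by (simp add: m_lcancel)
      qed
      have cl2: "\<kappa> \<otimes> s' \<in> carrier R" "\<kappa> \<otimes> t' \<in> carrier R" using kk st1' by auto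
      have sub: "orth S \<subseteq> (\<lambda>(\<alpha>, \<beta>). tensor \<alpha> \<beta> u) ` (carrier R \<times> carrier R)"
      proof
        fix v assume v: "v \<in> orth S"
        obtain x y where xy: "v = (x, y)" by force
        obtain \<alpha> \<beta> where "\<alpha> \<in> carrier R" "\<beta> \<in> carrier R" "(x, y) = tensor \<alpha> \<beta> u"
          by (rule orth_two_points[OF st' cl2 ind u, of x y])
            (use v w w' w_eq w'2 in \<open>auto simp: orth_def xy\<close>)
        then show "v \<in> (\<lambda>(\<alpha>, \<beta>). tensor \<alpha> \<beta> u) ` (carrier R \<times> carrier R)"
          by (intro image_eqI[of _ _ "(\<alpha>, \<beta>)"]) (simp_all add: xy)
      qed
      have "card (orth S) \<le> card (carrier R \<times> carrier R)"
        by (rule surj_card_le[OF _ sub]) (simp add: finite_carrier)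
      moreover have "rank1 v" if "v \<in> orth S" for v
        using that sub rank1_tensor u(1) by auto
      ultimately show ?thesis
        using that(2) by (simp add: card_cartesian_product power2_eq_square)
    qed
  qed
qed

lemma card_orth_rank2:
  assumes "v \<in> V" "\<not> rank1 v"
  shows "card (orth {v}) \<le> q ^ 3"
proof -
  obtain x y where xy: "v = (x, y)" by force
  obtain i0 j0 where ij: "x i0 \<otimes> y j0 \<noteq> x j0 \<otimes> y i0" using assms(2) by (auto simp: rank1_def xy)
  let ?f = "\<lambda>(\<alpha>, \<beta>, \<delta>). (\<lambda>k. \<alpha> \<otimes> x k \<oplus> \<beta> \<otimes> y k, \<lambda>k. \<delta> \<otimes> y k \<ominus> \<nu> \<otimes> \<beta> \<otimes> x k)"
  have sub: "orth {v} \<subseteq> ?f ` (carrier R \<times> carrier R \<times> carrier R)"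
  proof
    fix w assume w: "w \<in> orth {v}"
    obtain x' y' where xy': "w = (x', y')" by force
    obtain \<alpha> \<beta> \<delta> where "\<alpha> \<in> carrier R" "\<beta> \<in> carrier R" "\<delta> \<in> carrier R"
      "x' = (\<lambda>k. \<alpha> \<otimes> x k \<oplus> \<beta> \<otimes> y k)" "y' = (\<lambda>k. \<delta> \<otimes> y k \<ominus> \<nu> \<otimes> \<beta> \<otimes> x k)"
      by (rule orth_rank2[of x y i0 j0 x' y'])
        (use assms ij w in \<open>simp_all add: xy xy' orth_def\<close>)
    then show "w \<in> ?f ` (carrier R \<times> carrier R \<times> carrier R)"
      by (intro image_eqI[of _ _ "(\<alpha>, \<beta>, \<delta>)"]) (simp_all add: xy')
  qed
  have "card (orth {v}) \<le> card (carrier R \<times> carrier R \<times> carrier R)"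
    by (rule surj_card_le[OF _ sub]) (simp add: finite_carrier)
  then show ?thesis by (simp add: card_cartesian_product power3_eq_cube)
qed

text \<open>The complement of v = (x, y) contains (x, 0) and (0, y), because x \<and> x = 0 and y
  \<and> y = 0. An element of the double complement is orthogonal to both, which makes its
  components proportional to x and to y.\<close>

lemma card_orth_orth_rank2:
  assumes "v \<in> V" "\<not> rank1 v"
  shows "card (orth (orth {v})) \<le> q\<^sup>2"
proof -
  obtain x y where xy: "v = (x, y)" by force
  have W: "x \<in> W" "y \<in> W" using assms(1) xy by auto
  note cl = W[THEN W_closed]
  have [simp]: "\<zero> \<in> carrier R" "\<one> \<in> carrier R" by auto
  have x_t: "(x, zero_vec) = tensor \<one> \<zero> x" and y_t: "(zero_vec, y) = tensor \<zero> \<one> y"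
    using cl by (simp_all add: tensor_def zero_vec_def)
  have "x \<noteq> zero_vec" "y \<noteq> zero_vec" using assms(2) cl by (auto simp: rank1_def xy zero_vec_def)
  then obtain k l where k: "x k \<noteq> \<zero>" and l: "y l \<noteq> \<zero>" using W_nonzeroE W by meson
  have "(x, zero_vec) \<in> orth {v}" "(zero_vec, y) \<in> orth {v}"
    using W cl nu_closed zero_vec_W by (auto simp: orth_def xy perp_def m_comm) (simp_all add: zero_vec_def)
  have nu0: "\<nu> \<noteq> \<zero>" using nonsquare[of \<zero>] by auto
  have sub: "orth (orth {v}) \<subseteq> (\<lambda>(\<alpha>, \<beta>). (\<lambda>i. \<alpha> \<otimes> x i, \<lambda>i. \<beta> \<otimes> y i)) ` (carrier R \<times> carrier R)"
  proof
    fix w assume w: "w \<in> orth (orth {v})"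
    obtain x' y' where xy': "w = (x', y')" by force
    have W': "x' \<in> W" "y' \<in> W" using w xy' by (auto simp: orth_def)
    note cl' = W'[THEN W_closed]
    have 1: "perp (tensor \<one> \<zero> x) (x', y')" "perp (tensor \<zero> \<one> y) (x', y')"
      using w \<open>(x, zero_vec) \<in> orth {v}\<close> \<open>(zero_vec, y) \<in> orth {v}\<close> x_t y_t by (auto simp: orth_def xy')
    have y1: "y i \<otimes> y' j = y j \<otimes> y' i" for i j
      using 1(2) perp_tensor_iff[of \<zero> \<one> y x' y'] W W' cl' nu_closed by (simp add: minus_eq)
    have "x i \<otimes> (\<ominus> (\<nu> \<otimes> x' j)) = x j \<otimes> (\<ominus> (\<nu> \<otimes> x' i))" for i j
      using 1(1) perp_tensor_iff[of \<one> \<zero> x x' y'] W W' cl' nu_closed by (simp add: minus_eq)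
    then have "\<ominus> (\<nu> \<otimes> (x i \<otimes> x' j)) = \<ominus> (\<nu> \<otimes> (x j \<otimes> x' i))" for i j
      using cl cl' nu_closed by (simp add: r_minus m_lcomm)
    then have "\<nu> \<otimes> (x i \<otimes> x' j) = \<nu> \<otimes> (x j \<otimes> x' i)" for i j
      using cl cl' nu_closed by (metis m_closed minus_minus)
    then have x1: "x i \<otimes> x' j = x j \<otimes> x' i" for i j
      using cl cl' nu_closed nu0 by (metis m_closed m_lcancel)
    obtain \<alpha> where "\<alpha> \<in> carrier R" "x' = (\<lambda>j. \<alpha> \<otimes> x j)"
      using parallelD[of x x' k, OF cl(1) cl'(1) k x1] by blast
    moreover obtain \<beta> where "\<beta> \<in> carrier R" "y' = (\<lambda>j. \<beta> \<otimes> y j)"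
      using parallelD[of y y' l, OF cl(2) cl'(2) l y1] by blast
    ultimately show "w \<in> (\<lambda>(\<alpha>, \<beta>). (\<lambda>i. \<alpha> \<otimes> x i, \<lambda>i. \<beta> \<otimes> y i)) ` (carrier R \<times> carrier R)"
      by (intro image_eqI[of _ _ "(\<alpha>, \<beta>)"]) (simp_all add: xy')
  qed
  have "card (orth (orth {v})) \<le> card (carrier R \<times> carrier R)"
    by (rule surj_card_le[OF _ sub]) (simp add: finite_carrier)
  then show ?thesis by (simp add: card_cartesian_product power2_eq_square)
qed

section \<open>Counting for pairs of mutual complements\<close>

lemma power_less_q: "m < n \<Longrightarrow> x \<le> q ^ m \<Longrightarrow> x < q ^ n" for x :: nat
  using q_ge power_strict_increasing[of m n q] by linarith

lemma mult_less_q: "x \<le> q ^ a \<Longrightarrow> y \<le> q ^ b \<Longrightarrow> a + b < 2 * r \<Longrightarrow> x * y < q ^ (2 * r)" for x y :: nat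
  by (rule power_less_q[of "a + b"]) (auto simp: power_add intro: mult_mono)

text \<open>The sizes that can meet are q and q^(r+1), q^2 and q^2, q^2 and q^r, or q^3 and q^3. For
  r \<ge> 3 the exponents add up to less than 2 r, except that 3 + 3 = 2 r when r = 3; this last
  case gets its own argument. The pairs not covered are those in which both sets lie in
  lines.\<close>

lemma orth_pair_bound:
  assumes A: "orth D = A" and D: "orth A = D" and nz: "A \<noteq> {(zero_vec, zero_vec)}" "D \<noteq> {(zero_vec, zero_vec)}"
  shows "card A * card D < q ^ (2 * r) \<or>
    (\<exists>s t s' t'. point s t \<and> point s' t' \<and> A \<subseteq> line s t \<and> D \<subseteq> line s' t')"
proof -
  have sub: "A \<subseteq> V" "D \<subseteq> V" using A D orth_subset by blast+
  have fin: "finite A" "finite D" using A D finite_orth by metis+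
  have zero: "(zero_vec, zero_vec) \<in> A" "(zero_vec, zero_vec) \<in> D" using A D zero_in_orth sub by metis+
  have add: "(\<lambda>i. fst w i \<oplus> fst w' i, \<lambda>i. snd w i \<oplus> snd w' i) \<in> A" if "w \<in> A" "w' \<in> A" for w w'
    using orth_add[OF sub(2)] A that by blast
  have add': "(\<lambda>i. fst w i \<oplus> fst w' i, \<lambda>i. snd w i \<oplus> snd w' i) \<in> D" if "w \<in> D" "w' \<in> D" for w w'
    using orth_add[OF sub(1)] D that by blast
  obtain v w where v: "v \<in> D" "v \<noteq> (zero_vec, zero_vec)" and w: "w \<in> A" "w \<noteq> (zero_vec, zero_vec)"
    using nz zero by blast
  \<comment> \<open>A nonzero tensor of rank one in \<open>B\<close> bounds \<open>E\<close> by
    q^(r+1), and 1 + (r + 1) < 2 r because r \<ge> 3.\<close>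
  have small: "card B * card E < q ^ (2 * r)"
    if "card B \<le> q" "orth B = E" "x \<in> B" "x \<noteq> (zero_vec, zero_vec)" "rank1 x" "B \<subseteq> V" for B E x
  proof -
    have "x \<in> V" using that by blast
    then obtain s t u where "point s t" "u \<in> W" "u \<noteq> zero_vec" "x = tensor s t u"
      using rank1E[OF _ \<open>x \<noteq> (zero_vec, zero_vec)\<close> \<open>rank1 x\<close>] by blast
    then have "card (orth {x}) \<le> q ^ (r + 1)" using card_orth_rank1 by blast
    moreover have "card E \<le> card (orth {x})"
      unfolding that(2)[symmetric] by (intro card_mono finite_orth orth_antimono) (use that in auto)
    ultimately show ?thesis using mult_less_q[of "card B" 1 "card E" "r + 1"] that(1) r_ge by simp
  qed
  have rank2: "card B \<le> q ^ 3" if "orth E = B" "x \<in> E" "\<not> rank1 x" "E \<subseteq> V" for B E x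
  proof -
    have "card B \<le> card (orth {x})"
      unfolding that(1)[symmetric] by (intro card_mono finite_orth orth_antimono) (use that in auto)
    then show ?thesis using card_orth_rank2[of x] that by fastforce
  qed
  show ?thesis
  proof (cases "\<forall>x\<in>A. rank1 x")
    case rA: True
    show ?thesis
    proof (rule rank1_space_cases[of A w])
      assume "card A \<le> q"
      then show ?thesis using small[of A D w] rA w D sub by blast
    next
      assume dA: "card (orth A) \<le> q\<^sup>2" "\<And>v. v \<in> orth A \<Longrightarrow> rank1 v"
      then have rD: "\<And>v. v \<in> D \<Longrightarrow> rank1 v" using D by auto
      show ?thesis
      proof (rule rank1_space_cases[of D v])
        assume "card D \<le> q"
        then show ?thesis using small[of D A v] rD v A sub by (simp add: mult.commute)
      next
        assume "card (orth D) \<le> q\<^sup>2"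
        then show ?thesis using mult_less_q[of "card A" 2 "card D" 2] A D dA r_ge by simp
      next
        fix s t assume "orth D \<subseteq> line s t"
        then have "card A \<le> q ^ r"
          using card_mono[of "line s t" A] card_line_le[of s t] A by (simp add: line_def)
        then show ?thesis using mult_less_q[of "card A" r "card D" 2] A D dA r_ge by simp
      qed (use rD add' v sub in auto)
    next
      fix s t assume DL: "point s t" "orth A \<subseteq> line s t"
      then have rD: "\<And>v. v \<in> D \<Longrightarrow> rank1 v" using D line_rank1 by blast
      have cD: "card D \<le> q ^ r"
        using card_mono[of "line s t" D] card_line_le[of s t] D DL by (simp add: line_def)
      show ?thesis
      proof (rule rank1_space_cases[of D v])
        assume "card D \<le> q"
        then show ?thesis using small[of D A v] rD v A sub by (simp add: mult.commute)
      next
        assume "card (orth D) \<le> q\<^sup>2"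
        then show ?thesis using mult_less_q[of "card A" 2 "card D" r] A cD r_ge by simp
      next
        fix s' t' assume "point s' t'" "orth D \<subseteq> line s' t'"
        then show ?thesis using DL A D by blast
      qed (use rD add' v sub in auto)
    qed (use rA add w sub in auto)
  next
    case False
    then obtain x where x: "x \<in> A" "\<not> rank1 x" by blast
    have cD: "card D \<le> q ^ 3" by (rule rank2[OF D x sub(1)])
    show ?thesis
    proof (cases "\<forall>x\<in>D. rank1 x")
      case rD: True
      \<comment> \<open>The complement of \<open>D\<close> contains the tensor \<open>x\<close> of
        rank two, so two of the three cases of the classification are impossible and only a
        \<open>D\<close> of at most q elements is left.\<close>
      show ?thesis
      proof (rule rank1_space_cases[of D v])
        assume "card D \<le> q"
        then show ?thesis using small[of D A v] rD v A sub by (simp add: mult.commute)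
      next
        assume "\<And>v. v \<in> orth D \<Longrightarrow> rank1 v"
        then show ?thesis using x A by blast
      next
        fix s' t' assume "point s' t'" "orth D \<subseteq> line s' t'"
        then show ?thesis using x A line_rank1 by blast
      qed (use rD add' v sub in auto)
    next
      case False
      then obtain y where y: "y \<in> D" "\<not> rank1 y" by blast
      have cA: "card A \<le> q ^ 3" by (rule rank2[OF A y sub(2)])
      have yV: "y \<in> V" using y sub by blast
      \<comment> \<open>Two bounds q^3 do not suffice for r = 3. If \<open>A\<close> is the whole
        complement of \<open>y\<close>, then \<open>D\<close> is the double complement of a rank two
        tensor and has at most q^2 elements; otherwise \<open>A\<close> is a proper subset and has
        fewer than q^3.\<close>
      show ?thesis
      proof (cases "A = orth {y}")
        case True
        then have "card D \<le> q\<^sup>2" using card_orth_orth_rank2[OF yV y(2)] D by simp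
        then show ?thesis using mult_less_q[OF cA, of "card D" 2] r_ge by simp
      next
        case False
        have "A \<subset> orth {y}"
          using False A y orth_antimono[of "{y}" D] by blast
        then have "card A < card (orth {y})" by (intro psubset_card_mono finite_orth)
        then have "card A < q ^ 3" using card_orth_rank2[OF yV y(2)] by simp
        then have "card A * card D < q ^ 3 * q ^ 3"
          using cD q_ge by (intro mult_less_le_imp_less) (use y(1) fin in \<open>auto simp: card_gt_0_iff\<close>)
        also have "q ^ 3 * q ^ 3 \<le> q ^ (2 * r)"
          unfolding power_add[symmetric] using r_ge q_ge by (intro power_increasing) auto
        finally show ?thesis by blast
      qed
    qed
  qed
qed

text \<open>Passing from U to its double complement D keeps the complement A and yields a pair to
  which \<open>orth_pair_bound\<close> applies. Equality for U then has to be read back from the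
  bound for D, which is why the degenerate pairs are treated separately.\<close>

theorem orth_bound:
  assumes "U \<subseteq> V"
  shows "card U * card (orth U) \<le> q ^ (2 * r)"
    and "card U * card (orth U) = q ^ (2 * r) \<Longrightarrow>
      U = {(zero_vec, zero_vec)} \<or> U = V \<or> (\<exists>s t. point s t \<and> U = line s t)"
proof -
  define A where "A = orth U"
  define D where "D = orth A"
  have AD: "orth D = A" "orth A = D" using orth_orth_orth[OF assms] by (auto simp: A_def D_def)
  have UD: "U \<subseteq> D" using subset_orth_orth[OF assms] by (simp add: A_def D_def)
  have fin: "finite D" "finite A" by (simp_all add: A_def D_def)
  have sub: "A \<subseteq> V" "D \<subseteq> V" using AD orth_subset by blast+
  have pos: "0 < q ^ (2 * r)" using q_ge by simp
  have "card U * card A \<le> q ^ (2 * r) \<and> (card U * card A = q ^ (2 * r) \<longrightarrow>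
      U = {(zero_vec, zero_vec)} \<or> U = V \<or> (\<exists>s t. point s t \<and> U = line s t))"
  proof (cases "A = {(zero_vec, zero_vec)}")
    case True
    then show ?thesis
      using card_mono[OF finite_V assms] card_subset_eq[OF finite_V assms] card_V by auto
  next
    case nA: False
    show ?thesis
    proof (cases "D = {(zero_vec, zero_vec)}")
      case True
      \<comment> \<open>The empty set has product zero and cannot attain the positive bound.\<close>
      then have "U = {} \<or> U = {(zero_vec, zero_vec)}" using UD by blast
      moreover have "card A \<le> q ^ (2 * r)" using card_mono[OF finite_V sub(1)] card_V by simp
      ultimately show ?thesis using pos by auto
    next
      case nD: False
      have UD': "card U * card A \<le> card D * card A" using card_mono[OF fin(1) UD] by simp
      consider "card A * card D < q ^ (2 * r)"
        | s t s' t' where "point s t" "point s' t'" "A \<subseteq> line s t" "D \<subseteq> line s' t'"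
        using orth_pair_bound[OF AD nA nD] by blast
      then show ?thesis
      proof cases
        case 1
        then have "card U * card A < q ^ (2 * r)" using UD' by (simp only: mult.commute)
        then show ?thesis by simp
      next
        case 2
        have fl: "finite (line s t)" "finite (line s' t')" by (simp_all add: line_def)
        have cA: "card A \<le> q ^ r" using card_mono[OF fl(1) 2(3)] card_line_le[of s t] by simp
        have UL: "U \<subseteq> line s' t'" using UD 2 by blast
        have cU: "card U \<le> card (line s' t')" using card_mono[OF fl(2) UL] .
        have cU': "card U \<le> q ^ r" using cU card_line_le[of s' t'] by simp
        have qq: "q ^ (2 * r) = q ^ r * q ^ r" by (simp add: mult_2 power_add)
        have "card U * card A \<le> q ^ (2 * r)" unfolding qq using cA cU' by (simp add: mult_mono)
        moreover have "U = line s' t'" if "card U * card A = q ^ (2 * r)"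
        proof -
          \<comment> \<open>Since \<open>A\<close> has at most q^r elements, equality forces U to
            have q^r, so that it fills the line.\<close>
          have "q ^ r * q ^ r \<le> card U * q ^ r" using that cA qq by (metis mult_le_mono2)
          then have "q ^ r \<le> card U" using q_ge by simp
          then have "card U = card (line s' t')" using cU card_line_le[of s' t'] by simp
          then show ?thesis using card_subset_eq[OF fl(2) UL] by blast
        qed
        ultimately show ?thesis using 2 by blast
      qed
    qed
  qed
  then show "card U * card (orth U) \<le> q ^ (2 * r)"
    and "card U * card (orth U) = q ^ (2 * r) \<Longrightarrow>
      U = {(zero_vec, zero_vec)} \<or> U = V \<or> (\<exists>s t. point s t \<and> U = line s t)"
    by (auto simp: A_def)
qed

end

section \<open>Elementary abelian groups and change of basis\<close>

lemma (in comm_group) finprod_int_pow: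
  assumes "finite A" "f \<in> A \<rightarrow> carrier G"
  shows "finprod G f A [^] (k::int) = finprod G (\<lambda>i. f i [^] k) A"
  using assms
proof (induction A rule: finite_induct)
  case (insert a A)
  have cl: "f a \<in> carrier G" "finprod G f A \<in> carrier G" using insert by auto
  have cl': "(\<lambda>i. f i [^] k) \<in> A \<rightarrow> carrier G" using insert by auto
  have "finprod G f (insert a A) [^] k = f a [^] k \<otimes> finprod G f A [^] k"
    using insert cl by (simp add: finprod_insert int_pow_mult_distrib m_comm)
  then show ?case using insert cl cl' by (simp add: finprod_insert)
qed simp

context comm_group
begin

text \<open>The exponents are integers because the matrix entries in \<open>P3\<close> are; in a
  group of exponent p only their residues matter.\<close>

definition lincomb :: "nat \<Rightarrow> (nat \<Rightarrow> 'a) \<Rightarrow> (nat \<Rightarrow> int) \<Rightarrow> 'a"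
  where "lincomb n w c = finprod G (\<lambda>i. w i [^] c i) {1..n}"

lemma lincomb_closed:
  "w ` {1..n} \<subseteq> carrier G \<Longrightarrow> lincomb n w c \<in> carrier G"
  unfolding lincomb_def by (intro finprod_closed) auto

lemma lincomb_cong_mod:
  assumes "w ` {1..n} \<subseteq> carrier G" and exp: "\<And>x. x \<in> carrier G \<Longrightarrow> x [^] p = \<one>"
    and "\<And>i. i \<in> {1..n} \<Longrightarrow> [c i = d i] (mod int p)"
  shows "lincomb n w c = lincomb n w d"
  unfolding lincomb_def
proof (rule finprod_cong')
  fix i assume i: "i \<in> {1..n}"
  have w: "w i \<in> carrier G" using assms(1) i by auto
  obtain m where m: "c i = d i + int p * m"
    using assms(3)[OF i] by (metis cong_iff_lin cong_sym)
  have "w i [^] (int p * m) = (w i [^] int p) [^] m" using w by (simp add: int_pow_pow)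
  also have "w i [^] int p = \<one>" using exp[OF w] by (simp add: int_pow_int)
  finally show "w i [^] c i = w i [^] d i"
    unfolding m using w by (simp add: int_pow_mult)
qed (use assms(1) in auto)

lemma lincomb_mult:
  assumes "w ` {1..n} \<subseteq> carrier G"
  shows "lincomb n w c \<otimes> lincomb n w d = lincomb n w (\<lambda>i. c i + d i)"
proof -
  have "lincomb n w (\<lambda>i. c i + d i) = finprod G (\<lambda>i. w i [^] c i \<otimes> w i [^] d i) {1..n}"
    unfolding lincomb_def by (rule finprod_cong') (use assms in \<open>auto simp: int_pow_mult image_subset_iff\<close>)
  also have "\<dots> = lincomb n w c \<otimes> lincomb n w d"
    unfolding lincomb_def by (rule finprod_multf) (use assms in auto)
  finally show ?thesis ..
qed

lemma lincomb_pow: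
  assumes "w ` {1..n} \<subseteq> carrier G"
  shows "lincomb n w c [^] (k::int) = lincomb n w (\<lambda>i. c i * k)"
proof -
  have "lincomb n w c [^] k = finprod G (\<lambda>i. (w i [^] c i) [^] k) {1..n}"
    unfolding lincomb_def by (rule finprod_int_pow) (use assms in auto)
  also have "\<dots> = lincomb n w (\<lambda>i. c i * k)"
    unfolding lincomb_def by (rule finprod_cong') (use assms in \<open>auto simp: int_pow_pow image_subset_iff\<close>)
  finally show ?thesis .
qed

lemma lincomb_zero: "w ` {1..n} \<subseteq> carrier G \<Longrightarrow> lincomb n w (\<lambda>i. 0) = \<one>"
  unfolding lincomb_def by simp

lemma lincomb_unit:
  assumes "w ` {1..n} \<subseteq> carrier G" "j \<in> {1..n}"
  shows "lincomb n w (\<lambda>i. if i = j then 1 else 0) = w j"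
proof -
  have "lincomb n w (\<lambda>i. if i = j then 1 else 0) = finprod G (\<lambda>i. if j = i then w i else \<one>) {1..n}"
    unfolding lincomb_def
    by (rule finprod_cong') (use assms in \<open>auto simp: image_subset_iff int_pow_1\<close>)
  also have "\<dots> = w j" by (rule finprod_singleton) (use assms in auto)
  finally show ?thesis .
qed

lemma finprod_lincomb:
  assumes "w ` {1..n} \<subseteq> carrier G" "finite K"
  shows "finprod G (\<lambda>k. lincomb n w (c k)) K = lincomb n w (\<lambda>i. \<Sum>k\<in>K. c k i)"
  using assms(2)
proof (induction K rule: finite_induct)
  case (insert k K)
  then show ?case
    using assms(1) by (simp add: finprod_insert lincomb_closed lincomb_mult)
qed (simp add: lincomb_zero[OF assms(1)])

lemma lincomb_lincomb:
  assumes "w ` {1..n} \<subseteq> carrier G"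
    and u: "\<And>k. k \<in> {1..n} \<Longrightarrow> u k = lincomb n w (\<lambda>i. c i k)"
  shows "lincomb n u d = lincomb n w (\<lambda>i. \<Sum>k\<in>{1..n}. c i k * d k)"
proof -
  have "lincomb n u d = finprod G (\<lambda>k. lincomb n w (\<lambda>i. c i k * d k)) {1..n}"
    unfolding lincomb_def[of n u]
    by (rule finprod_cong') (use assms in \<open>auto simp: lincomb_pow lincomb_closed\<close>)
  then show ?thesis using finprod_lincomb[OF assms(1), of "{1..n}" "\<lambda>k i. c i k * d k"] by simp
qed

lemma generate_eq_lincomb:
  assumes w: "w ` {1..n} \<subseteq> carrier G" and x: "x \<in> generate G (w ` {1..n})"
  shows "\<exists>c. x = lincomb n w c"
  using x
proof (induction rule: generate.induct)
  case one
  then show ?case using lincomb_zero[OF w] by metis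
next
  case (incl h)
  then obtain j where "j \<in> {1..n}" "h = w j" by blast
  then show ?case using lincomb_unit[OF w] by metis
next
  case (inv h)
  then obtain j where j: "j \<in> {1..n}" "h = w j" by blast
  then have "inv h = lincomb n w (\<lambda>i. if i = j then 1 else 0) [^] (-1::int)"
    using lincomb_unit[OF w j(1)] w j by (auto simp: int_pow_neg int_pow_1 image_subset_iff)
  then show ?case unfolding lincomb_pow[OF w] by blast
next
  case (eng h1 h2)
  then show ?case using lincomb_mult[OF w] by metis
qed

text \<open>The combinations with exponents in \<open>{0..p - 1}\<close> map a set of \<open>p\<^sup>n\<close> elements onto the group, hence
  injectively.\<close>

lemma lincomb_generating_unique:
  assumes p: "0 < p" and exp: "\<And>x. x \<in> carrier G \<Longrightarrow> x [^] p = \<one>"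
    and card: "card (carrier G) = p ^ n"
    and w: "w ` {1..n} \<subseteq> carrier G" "generate G (w ` {1..n}) = carrier G"
    and eq: "lincomb n w c = lincomb n w d" and i: "i \<in> {1..n}"
  shows "[c i = d i] (mod int p)"
proof -
  define E where "E = {1..n} \<rightarrow>\<^sub>E {0..int p - 1}"
  define red where "red c = (\<lambda>i\<in>{1..n}. c i mod int p)" for c :: "nat \<Rightarrow> int"
  have red: "red c \<in> E" "lincomb n w (red c) = lincomb n w c" for c
  proof -
    show "red c \<in> E" using p by (auto simp: red_def E_def)
    show "lincomb n w (red c) = lincomb n w c"
      by (rule lincomb_cong_mod[OF w(1) exp]) (auto simp: red_def cong_def)
  qed
  have "finite E" unfolding E_def by (intro finite_PiE) auto
  have cE: "card E = p ^ n" using p by (simp add: E_def card_PiE)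
  have "carrier G \<subseteq> lincomb n w ` E"
  proof
    fix x assume "x \<in> carrier G"
    then obtain c where "x = lincomb n w c" using generate_eq_lincomb[OF w(1)] w(2) by blast
    then show "x \<in> lincomb n w ` E" using red by (metis image_eqI)
  qed
  then have "lincomb n w ` E = carrier G" using lincomb_closed[OF w(1)] by blast
  then have "inj_on (lincomb n w) E"
    using cE card \<open>finite E\<close> by (intro eq_card_imp_inj_on) auto
  then have "red c = red d" using red eq by (metis inj_onD)
  then have "red c i = red d i" by simp
  then show ?thesis using i by (simp add: red_def cong_def)
qed

text \<open>Each of the two generating systems is written in terms of the other. Substituting one
  expression into the other gives a combination equal to a single generator, and the uniqueness of
  exponents modulo p turns this into the statement that the two coordinate matrices are inverse to
  each other.\<close>

lemma base_change_matrix: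
  assumes p: "Factorial_Ring.prime p" and exp: "\<And>x. x \<in> carrier G \<Longrightarrow> x [^] p = \<one>"
    and card: "card (carrier G) = p ^ n"
    and w: "w ` {1..n} \<subseteq> carrier G" "generate G (w ` {1..n}) = carrier G"
    and u: "u ` {1..n} \<subseteq> carrier G" "generate G (u ` {1..n}) = carrier G"
  shows "\<exists>c. invertible_matrix (residue_ring (int p)) n c \<and>
    (\<forall>j\<in>{1..n}. u j = lincomb n w (\<lambda>i. c i j))"
proof -
  have p1: "1 < int p" and p0: "0 < p" using prime_gt_1_nat[OF p] by auto
  interpret res: residues "int p" "residue_ring (int p)"
    using p1 by unfold_locales auto
  have coords: "\<exists>c. \<forall>j\<in>{1..n}. y j = lincomb n x (\<lambda>i. c i j) \<and> (\<forall>i\<in>{1..n}. c i j \<in> {0..int p - 1})"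
    if x: "x ` {1..n} \<subseteq> carrier G" "generate G (x ` {1..n}) = carrier G"
      and y: "y ` {1..n} \<subseteq> carrier G" for x y
  proof -
    have "\<forall>j\<in>{1..n}. \<exists>c. y j = lincomb n x c" 
      using generate_eq_lincomb[OF x(1)] x(2) y by blast
    then obtain c where c: "\<And>j. j \<in> {1..n} \<Longrightarrow> y j = lincomb n x (c j)" by metis
    have "y j = lincomb n x (\<lambda>i. c j i mod int p)" if "j \<in> {1..n}" for j
      unfolding c[OF that] by (rule lincomb_cong_mod[OF x(1) exp]) (auto simp: cong_def)
    then show ?thesis using p1 by (intro exI[of _ "\<lambda>i j. c j i mod int p"]) auto
  qed
  obtain c where c: "\<And>j. j \<in> {1..n} \<Longrightarrow> u j = lincomb n w (\<lambda>i. c i j)"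
    "\<And>i j. i \<in> {1..n} \<Longrightarrow> j \<in> {1..n} \<Longrightarrow> c i j \<in> {0..int p - 1}"
    using coords[OF w u(1)] by blast
  obtain d where d: "\<And>j. j \<in> {1..n} \<Longrightarrow> w j = lincomb n u (\<lambda>i. d i j)"
    "\<And>i j. i \<in> {1..n} \<Longrightarrow> j \<in> {1..n} \<Longrightarrow> d i j \<in> {0..int p - 1}"
    using coords[OF u w(1)] by blast
  \<comment> \<open>Stated for an arbitrary pair of systems, so that both orders of the matrix
    product are instances.\<close>
  have product: "(\<Oplus>\<^bsub>residue_ring (int p)\<^esub>k\<in>{1..n}. f i k \<otimes>\<^bsub>residue_ring (int p)\<^esub> g k j) =
      (if i = j then \<one>\<^bsub>residue_ring (int p)\<^esub> else \<zero>\<^bsub>residue_ring (int p)\<^esub>)"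
    if x: "x ` {1..n} \<subseteq> carrier G" "generate G (x ` {1..n}) = carrier G"
      and y: "\<And>j. j \<in> {1..n} \<Longrightarrow> y j = lincomb n x (\<lambda>i. f i j)"
      and x': "\<And>j. j \<in> {1..n} \<Longrightarrow> x j = lincomb n y (\<lambda>i. g i j)"
      and ij: "i \<in> {1..n}" "j \<in> {1..n}" for x y f g i j
  proof -
    have "lincomb n x (\<lambda>i. if i = j then 1 else 0) = x j" by (rule lincomb_unit[OF x(1) ij(2)])
    also have "\<dots> = lincomb n x (\<lambda>i. \<Sum>k\<in>{1..n}. f i k * g k j)"
      unfolding x'[OF ij(2)] by (rule lincomb_lincomb[OF x(1) y])
    finally have "[(if i = j then 1 else 0) = (\<Sum>k\<in>{1..n}. f i k * g k j)] (mod int p)"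
      by (rule lincomb_generating_unique[OF p0 exp card x _ ij(1), rotated])
    then have "(\<Sum>k\<in>{1..n}. f i k * g k j) mod int p = (if i = j then 1 else 0)"
      using p1 by (auto simp: cong_def split: if_splits)
    moreover have "(\<Oplus>\<^bsub>residue_ring (int p)\<^esub>k\<in>{1..n}. f i k \<otimes>\<^bsub>residue_ring (int p)\<^esub> g k j) =
        (\<Sum>k\<in>{1..n}. f i k * g k j) mod int p"
      unfolding res.res_mult_eq by (rule res.sum_cong) simp
    ultimately show ?thesis by (simp add: res.res_one_eq res.res_zero_eq)
  qed
  have "inverse_matrices (residue_ring (int p)) n c d"
    unfolding inverse_matrices_def
    using product[OF w c(1) d(1)] product[OF u d(1) c(1)] by blast
  then have "invertible_matrix (residue_ring (int p)) n c"
    using c(2) d(2) unfolding invertible_matrix_def square_matrix_def res.res_carrier_eq by blast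
  then show ?thesis using c(1) by blast
qed

lemma ordered_prod_eq_lincomb:
  assumes "w ` {1..n} \<subseteq> carrier G"
  shows "ordered_prod G n (\<lambda>i. w i [^] (c i::int)) = lincomb n w c"
proof -
  have "foldr (\<lambda>i z. w i [^] c i \<otimes> z) xs \<one> = finprod G (\<lambda>i. w i [^] c i) (set xs)"
    if "distinct xs" "set xs \<subseteq> {1..n}" for xs
    using that
  proof (induction xs)
    case (Cons a xs)
    then have "(\<lambda>i. w i [^] c i) \<in> set xs \<rightarrow> carrier G" "w a \<in> carrier G" using assms by auto
    then show ?case using Cons by (simp add: finprod_insert)
  qed simp
  from this[of "[1..<Suc n]"] show ?thesis
    unfolding ordered_prod_def lincomb_def by (simp add: atLeastLessThanSuc_atLeastAtMost del: upt_Suc)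
qed

end

lemma (in group_hom) hom_ordered_prod:
  assumes "f ` {1..n} \<subseteq> carrier G"
  shows "h (ordered_prod G n f) = ordered_prod H n (\<lambda>i. h (f i))"
proof -
  have "foldr (\<lambda>i z. f i \<otimes>\<^bsub>G\<^esub> z) xs \<one>\<^bsub>G\<^esub> \<in> carrier G \<and>
      h (foldr (\<lambda>i z. f i \<otimes>\<^bsub>G\<^esub> z) xs \<one>\<^bsub>G\<^esub>) = foldr (\<lambda>i z. h (f i) \<otimes>\<^bsub>H\<^esub> z) xs \<one>\<^bsub>H\<^esub>"
    if "set xs \<subseteq> {1..n}" for xs
    using that
  proof (induction xs)
    case (Cons a xs)
    then have "f a \<in> carrier G" using assms by auto
    then show ?case using Cons by simp
  qed simp
  from this[of "[1..<Suc n]"] show ?thesis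
    unfolding ordered_prod_def by (simp add: atLeastLessThanSuc_atLeastAtMost del: upt_Suc)
qed

lemma (in group) ordered_prod_closed:
  assumes "f ` {1..n} \<subseteq> carrier G"
  shows "ordered_prod G n f \<in> carrier G"
proof -
  have "foldr (\<lambda>i z. f i \<otimes> z) xs \<one> \<in> carrier G" if "set xs \<subseteq> {1..n}" for xs
    using that
  proof (induction xs)
    case (Cons a xs)
    then have "f a \<in> carrier G" using assms by auto
    then show ?case using Cons by simp
  qed simp
  from this[of "[1..<Suc n]"] show ?thesis
    unfolding ordered_prod_def by (simp add: atLeastLessThanSuc_atLeastAtMost del: upt_Suc)
qed

section \<open>The subspaces belonging to lines\<close>

definition vec_group :: "('a, 'm) ring_scheme \<Rightarrow> 'i set \<Rightarrow> ('i \<Rightarrow> 'a) monoid"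
  where "vec_group R I =
    \<lparr>carrier = vec R I, monoid.mult = (\<lambda>f g i. f i \<oplus>\<^bsub>R\<^esub> g i), one = (\<lambda>i. \<zero>\<^bsub>R\<^esub>)\<rparr>"

lemma vec_group_simps [simp]:
  "carrier (vec_group R I) = vec R I"
  "f \<otimes>\<^bsub>vec_group R I\<^esub> g = (\<lambda>i. f i \<oplus>\<^bsub>R\<^esub> g i)"
  "\<one>\<^bsub>vec_group R I\<^esub> = (\<lambda>i. \<zero>\<^bsub>R\<^esub>)"
  by (simp_all add: vec_group_def)

lemma (in abelian_group) comm_group_vec_group: "comm_group (vec_group G I)"
proof (rule comm_groupI)
  fix f assume f: "f \<in> carrier (vec_group G I)"
  show "\<exists>g\<in>carrier (vec_group G I). g \<otimes>\<^bsub>vec_group G I\<^esub> f = \<one>\<^bsub>vec_group G I\<^esub>"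
    using f by (intro bexI[of _ "\<lambda>i. \<ominus> f i"]) (auto simp: vec_def l_neg)
qed (auto simp: vec_def a_ac)

lemma (in abelian_group) vec_group_pow:
  "f [^]\<^bsub>vec_group G I\<^esub> (m::nat) = (\<lambda>i. [m] \<cdot> f i)"
  by (induction m) (simp_all add: nat_pow_def add_pow_def)

lemma DirProd_pow: "x [^]\<^bsub>G \<times>\<times> H\<^esub> (m::nat) = (fst x [^]\<^bsub>G\<^esub> m, snd x [^]\<^bsub>H\<^esub> m)"
  by (induction m) (simp_all add: nat_pow_def DirProd_def split: prod.splits)

lemma comm_group_DirProd:
  assumes "comm_group G" "comm_group H"
  shows "comm_group (G \<times>\<times> H)"
proof -
  interpret G: comm_group G by fact
  interpret H: comm_group H by fact
  show ?thesis
    by (rule group.group_comm_groupI[OF DirProd_group])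
      (auto simp: G.is_group H.is_group G.m_comm H.m_comm)
qed

context anisotropic_form
begin

abbreviation "WG \<equiv> vec_group R {..<r}"
abbreviation "VG \<equiv> WG \<times>\<times> WG"

lemma comm_group_WG: "comm_group WG"
  by (rule comm_group_vec_group)

lemma comm_group_VG: "comm_group VG"
  by (intro comm_group_DirProd comm_group_WG)

lemma VG_mult: "v \<otimes>\<^bsub>VG\<^esub> w = (\<lambda>i. fst v i \<oplus> fst w i, \<lambda>i. snd v i \<oplus> snd w i)"
  by (simp add: DirProd_def split: prod.splits)

lemma VG_one: "\<one>\<^bsub>VG\<^esub> = (zero_vec, zero_vec)"
  by (simp add: DirProd_def zero_vec_def)

lemma carrier_VG: "carrier VG = V"
  by (simp add: DirProd_def)

lemma tensor_hom:
  assumes "s \<in> carrier R" "t \<in> carrier R"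
  shows "group_hom WG VG (tensor s t)"
proof -
  interpret WG: comm_group WG by (rule comm_group_WG)
  interpret VG: comm_group VG by (rule comm_group_VG)
  show ?thesis
  proof unfold_locales
    show "tensor s t \<in> hom WG VG"
    proof (rule homI)
      fix u v assume "u \<in> carrier WG" "v \<in> carrier WG"
      then have "u \<in> W" "v \<in> W" by auto
      then show "tensor s t (u \<otimes>\<^bsub>WG\<^esub> v) = tensor s t u \<otimes>\<^bsub>VG\<^esub> tensor s t v"
        using assms by (simp add: VG_mult tensor_def W_closed r_distr)
    qed (use assms in \<open>simp add: carrier_VG\<close>)
  qed
qed

lemma tensor_inj:
  assumes "point s t"
  shows "inj_on (tensor s t) W"
proof (rule inj_onI)
  fix u v assume uv: "u \<in> W" "v \<in> W" and eq: "tensor s t u = tensor s t v"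
  have st: "s \<in> carrier R" "t \<in> carrier R" using assms by (auto simp: point_def)
  have "u i = v i" for i
  proof -
    have cl: "u i \<in> carrier R" "v i \<in> carrier R" using uv W_closed by auto
    have "s \<otimes> u i = s \<otimes> v i" "t \<otimes> u i = t \<otimes> v i"
      using eq by (auto simp: tensor_def fun_eq_iff)
    then show ?thesis using st cl assms m_lcancel by (auto simp: point_def)
  qed
  then show "u = v" by auto
qed

lemma card_line: "point s t \<Longrightarrow> card (line s t) = q ^ r"
  by (simp add: line_def card_image tensor_inj card_W)

lemma line_subset_V: "point s t \<Longrightarrow> line s t \<subseteq> V"
  unfolding line_def by (intro image_subsetI tensor_V) (auto simp: point_def)

lemma line_subgroup:
  assumes "point s t"
  shows "subgroup (line s t) VG"
proof -
  interpret group_hom WG VG "tensor s t" using assms tensor_hom by (simp add: point_def)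
  show ?thesis using img_is_subgroup by (simp add: line_def)
qed

lemma zero_in_line: "point s t \<Longrightarrow> (zero_vec, zero_vec) \<in> line s t"
  using subgroup.one_closed[OF line_subgroup] VG_one by metis

lemma line_parallel:
  assumes "point s t" "point s' t'" "s \<otimes> t' = s' \<otimes> t"
  shows "line s t = line s' t'"
proof -
  have st: "s \<in> carrier R" "t \<in> carrier R" "s' \<in> carrier R" "t' \<in> carrier R"
    using assms by (auto simp: point_def)
  obtain m where m: "m \<in> carrier R" "s' = m \<otimes> s" "t' = m \<otimes> t"
    using parallel_points[OF assms(1) st(3,4) assms(3)] by blast
  have "line s' t' \<subseteq> line s t"
  proof
    fix v assume "v \<in> line s' t'"
    then obtain u where "u \<in> W" "v = tensor s' t' u" by (auto simp: line_def)
    then have "v = tensor s t (\<lambda>i. m \<otimes> u i)" "(\<lambda>i. m \<otimes> u i) \<in> W"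
      using tensor_scale[of m s t u] m st by auto
    then show "v \<in> line s t" by (auto simp: line_def)
  qed
  moreover have "finite (line s t)" by (simp add: line_def)
  ultimately show ?thesis using card_subset_eq card_line assms by metis
qed

lemma line_inter:
  assumes "point s t" "point s' t'" "s \<otimes> t' \<noteq> s' \<otimes> t"
  shows "line s t \<inter> line s' t' = {(zero_vec, zero_vec)}"
proof -
  have st: "s \<in> carrier R" "t \<in> carrier R" "s' \<in> carrier R" "t' \<in> carrier R"
    using assms by (auto simp: point_def)
  have zero: "(zero_vec, zero_vec) = tensor x y zero_vec" if "x \<in> carrier R" "y \<in> carrier R" for x y
    using that by (simp add: tensor_def zero_vec_def)
  have "v = (zero_vec, zero_vec)" if v: "v \<in> line s t" "v \<in> line s' t'" for v
  proof -
    obtain u u' where u: "u \<in> W" "u' \<in> W" "v = tensor s t u" "v = tensor s' t' u'"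
      using v unfolding line_def by blast
    have "u i = \<zero>" for i
    proof (rule mult_minus_cancel[OF _ _ assms(3)])
      have cl: "u i \<in> carrier R" "u' i \<in> carrier R" using u W_closed by auto
      have eq: "s \<otimes> u i = s' \<otimes> u' i" "t \<otimes> u i = t' \<otimes> u' i"
        using u(3,4) by (auto simp: tensor_def fun_eq_iff)
      have "s \<otimes> t' \<otimes> u i = t' \<otimes> (s \<otimes> u i)" using cl st by (simp add: m_ac)
      also have "\<dots> = s' \<otimes> (t' \<otimes> u' i)" unfolding eq(1) using cl st by (simp add: m_ac)
      also have "\<dots> = s' \<otimes> t \<otimes> u i" unfolding eq(2)[symmetric] using cl st by (simp add: m_ac)
      finally show "s \<otimes> t' \<otimes> u i = s' \<otimes> t \<otimes> u i" .
    qed (use st u W_closed in auto)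
    then have "u = zero_vec" by (auto simp: zero_vec_def)
    then show ?thesis using u(3) zero[OF st(1,2)] by simp
  qed
  moreover have "(zero_vec, zero_vec) \<in> line s t" "(zero_vec, zero_vec) \<in> line s' t'"
    using zero_in_line assms by auto
  ultimately show ?thesis by blast
qed

lemma line_sum:
  assumes "point s t" "point s' t'" "s \<otimes> t' \<noteq> s' \<otimes> t" "v \<in> V"
  obtains l l' where "l \<in> line s t" "l' \<in> line s' t'" "v = l \<otimes>\<^bsub>VG\<^esub> l'"
proof -
  have st: "s \<in> carrier R" "t \<in> carrier R" "s' \<in> carrier R" "t' \<in> carrier R"
    using assms by (auto simp: point_def)
  obtain x y where xy: "v = (x, y)" by force
  have W: "x \<in> W" "y \<in> W" using assms(4) xy by auto
  note cl = W[THEN W_closed]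
  define d where "d = s \<otimes> t' \<ominus> s' \<otimes> t"
  have d: "d \<in> carrier R" "d \<noteq> \<zero>" using st assms(3) by (auto simp: d_def)
  obtain m where m: "m \<in> carrier R" "m \<otimes> d = \<one>" using inv_nonzero[OF d] by blast
  \<comment> \<open>Cramer's rule for x = s u + s' u' and y = t u + t' u', with determinant
    d.\<close>
  define u where "u = (\<lambda>i. m \<otimes> (t' \<otimes> x i \<ominus> s' \<otimes> y i))"
  define u' where "u' = (\<lambda>i. m \<otimes> (s \<otimes> y i \<ominus> t \<otimes> x i))"
  have uW: "u \<in> W" "u' \<in> W"
    unfolding u_def u'_def using m st W by (intro scale_W minus_W; simp)+
  have "x i = s \<otimes> u i \<oplus> s' \<otimes> u' i" "y i = t \<otimes> u i \<oplus> t' \<otimes> u' i" for i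
  proof -
    have "s \<otimes> u i \<oplus> s' \<otimes> u' i = m \<otimes> d \<otimes> x i"
      unfolding u_def u'_def d_def using st m(1) cl(1)[of i] cl(2)[of i] by algebra
    then show "x i = s \<otimes> u i \<oplus> s' \<otimes> u' i" using m cl by simp
    have "t \<otimes> u i \<oplus> t' \<otimes> u' i = m \<otimes> d \<otimes> y i"
      unfolding u_def u'_def d_def using st m(1) cl(1)[of i] cl(2)[of i] by algebra
    then show "y i = t \<otimes> u i \<oplus> t' \<otimes> u' i" using m cl by simp
  qed
  then have "v = tensor s t u \<otimes>\<^bsub>VG\<^esub> tensor s' t' u'"
    by (auto simp: xy VG_mult tensor_def)
  then show ?thesis using that uW unfolding line_def by blast
qed

text \<open>The points (s, t) and (t, \<nu> s) are orthogonal in F^2, so every pairing between the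
  two lines vanishes. The inclusion already provides q^r elements in the complement, as many as
  \<open>orth_bound\<close> admits for a line.\<close>

lemma line_orth:
  assumes "point s t"
  shows "line t (\<nu> \<otimes> s) \<subseteq> orth (line s t)"
proof
  have st: "s \<in> carrier R" "t \<in> carrier R" using assms by (auto simp: point_def)
  fix v assume v: "v \<in> line t (\<nu> \<otimes> s)"
  then obtain c where c: "c \<in> W" "v = tensor t (\<nu> \<otimes> s) c" by (auto simp: line_def)
  note cl = W_closed[OF c(1)] nu_closed
  have cW: "(\<lambda>i. t \<otimes> c i) \<in> W" "(\<lambda>i. \<nu> \<otimes> s \<otimes> c i) \<in> W" using c st nu_closed by auto
  have "t \<otimes> (\<nu> \<otimes> s \<otimes> c j) \<ominus> \<nu> \<otimes> s \<otimes> (t \<otimes> c j) = \<zero>" for j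
    using cl(1)[of j] st nu_closed by algebra
  then have "perp (tensor s t u) v" if "u \<in> W" for u
    unfolding c(2) tensor_def[of t]
    using perp_tensor_iff[OF st that cW] W_closed[OF that] by simp
  moreover have "v \<in> V" using v line_subset_V[OF point_perp[OF assms]] by blast
  ultimately show "v \<in> orth (line s t)" by (auto simp: orth_def line_def)
qed

text \<open>For the unit vectors e_0 and e_1 the pairing of e_0 \<otimes> (s, t) with e_1 \<otimes>
  (s, t) is (t t - \<nu> s s) (e_0 \<and> e_1), nonzero by anisotropy. This is what keeps the atoms
  from being abelian.\<close>

lemma line_not_isotropic:
  assumes "point s t"
  obtains v w where "v \<in> line s t" "w \<in> line s t" "\<not> perp v w"
proof -
  have st: "s \<in> carrier R" "t \<in> carrier R" using assms by (auto simp: point_def)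
  define e where "e k = (\<lambda>i. if i = k then \<one> else \<zero>)" for k :: nat
  have e: "e 0 \<in> W" "e 1 \<in> W" using r_ge by (auto simp: e_def vec_def)
  have e': "(\<lambda>i. s \<otimes> e 1 i) \<in> W" "(\<lambda>i. t \<otimes> e 1 i) \<in> W" using e st by auto
  have "\<not> perp (tensor s t (e 0)) (tensor s t (e 1))"
  proof
    assume "perp (tensor s t (e 0)) (tensor s t (e 1))"
    then have "e 0 0 \<otimes> (t \<otimes> (t \<otimes> e 1 1) \<ominus> \<nu> \<otimes> s \<otimes> (s \<otimes> e 1 1)) = e 0 1 \<otimes> (t \<otimes> (t \<otimes> e 1 0) \<ominus> \<nu> \<otimes> s \<otimes> (s \<otimes> e 1 0))"
      unfolding tensor_def[of s t "e 1"] using perp_tensor_iff[OF st e(1) e'] by blast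
    then have "t \<otimes> t \<ominus> \<nu> \<otimes> s \<otimes> s = \<zero>"
      using st nu_closed by (simp add: e_def minus_eq)
    then show False using point_norm[OF assms] by blast
  qed
  then show ?thesis using that e unfolding line_def by blast
qed

section \<open>The family of all lines\<close>

definition lines :: "((nat \<Rightarrow> 'a) \<times> (nat \<Rightarrow> 'a)) set set"
  where "lines = {line s t | s t. point s t}"

lemma lineI: "point s t \<Longrightarrow> line s t \<in> lines"
  by (auto simp: lines_def)

lemma linesE:
  assumes "L \<in> lines" obtains s t where "point s t" "L = line s t"
  using assms by (auto simp: lines_def)

lemma lines_not_parallel:
  assumes "point s t" "point s' t'" "line s t \<noteq> line s' t'"
  shows "s \<otimes> t' \<noteq> s' \<otimes> t"
  using assms line_parallel by blast

lemma one_less_q_r: "1 < q ^ r" "q ^ r < q ^ (2 * r)"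
  using q_ge r_ge power_strict_increasing[of 0 r q] power_strict_increasing[of r "2 * r" q] by auto

lemma lines_distinct:
  assumes "L \<in> lines"
  shows "L \<noteq> {(zero_vec, zero_vec)}" "L \<noteq> V"
proof -
  have "card L = q ^ r" using assms card_line by (auto simp: lines_def)
  then show "L \<noteq> {(zero_vec, zero_vec)}" "L \<noteq> V" using one_less_q_r card_V by auto
qed

lemma lines_incomparable:
  assumes "L \<in> lines" "L' \<in> lines" "L \<subseteq> L'"
  shows "L = L'"
proof -
  have "card L = card L'" "finite L'" using assms(1,2) card_line by (auto simp: lines_def line_def)
  then show ?thesis using assms(3) card_subset_eq by blast
qed

text \<open>Every point of the projective line has a unique normal form, either (0, 1) or (1, t)
  with t in F. Different normal forms give different lines because lines of independent points meet
  only in zero.\<close>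

lemma card_lines: "card lines = q + 1"
proof -
  have "lines = insert (line \<zero> \<one>) (line \<one> ` carrier R)"
  proof (intro equalityI subsetI)
    fix L assume "L \<in> lines"
    then obtain s t where st: "point s t" "L = line s t" by (rule linesE)
    then have cl: "s \<in> carrier R" "t \<in> carrier R" by (auto simp: point_def)
    show "L \<in> insert (line \<zero> \<one>) (line \<one> ` carrier R)"
    proof (cases "s = \<zero>")
      case True
      then have "L = line \<zero> \<one>"
        using st cl line_parallel[of s t \<zero> \<one>] by (auto simp: point_def)
      then show ?thesis by simp
    next
      case False
      obtain m where m: "m \<in> carrier R" "m \<otimes> s = \<one>" using inv_nonzero[OF cl(1) False] by blast
      have "s \<otimes> (m \<otimes> t) = (m \<otimes> s) \<otimes> t" using m(1) cl by (simp add: m_ac)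
      then have "L = line \<one> (m \<otimes> t)"
        using st cl m line_parallel[of s t \<one> "m \<otimes> t"] by (auto simp: point_def)
      then show ?thesis using m cl by blast
    qed
  next
    fix L assume "L \<in> insert (line \<zero> \<one>) (line \<one> ` carrier R)"
    then show "L \<in> lines" using lineI[of \<zero> \<one>] lineI[of \<one>] by (auto simp: point_def)
  qed
  moreover have "line \<zero> \<one> \<noteq> line \<one> t" if "t \<in> carrier R" for t
  proof
    assume eq: "line \<zero> \<one> = line \<one> t"
    have "line \<zero> \<one> \<inter> line \<one> t = {(zero_vec, zero_vec)}"
      by (rule line_inter) (use that in \<open>auto simp: point_def\<close>)
    then show False using eq lines_distinct(1)[OF lineI, of \<zero> \<one>] by (auto simp: point_def)
  qed
  moreover have "inj_on (line \<one>) (carrier R)"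
  proof (rule inj_onI, rule ccontr)
    fix t t' assume t: "t \<in> carrier R" "t' \<in> carrier R" "line \<one> t = line \<one> t'" "t \<noteq> t'"
    have "line \<one> t \<inter> line \<one> t' = {(zero_vec, zero_vec)}"
      by (rule line_inter) (use t in \<open>auto simp: point_def\<close>)
    then show False using t lines_distinct(1)[OF lineI, of \<one> t] by (auto simp: point_def)
  qed
  ultimately show ?thesis
    using finite_carrier by (auto simp: card_insert_if card_image)
qed

text \<open>The third point is a combination of the first two, and both coefficients are nonzero
  because it differs from each of them; absorbing the coefficients into the representatives leaves a
  plain sum. In \<open>P3\<close> this sum becomes the product of x_j and y_j'.\<close>

lemma three_lines:
  assumes pts: "point s t" "point s' t'" "point s'' t''"
    and ne: "line s t \<noteq> line s' t'" "line s t \<noteq> line s'' t''" "line s' t' \<noteq> line s'' t''"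
  obtains a b a' b' where "point a b" "point a' b'" "point (a \<oplus> a') (b \<oplus> b')"
    "line a b = line s t" "line a' b' = line s' t'" "line (a \<oplus> a') (b \<oplus> b') = line s'' t''"
proof -
  have st: "s \<in> carrier R" "t \<in> carrier R" "s' \<in> carrier R" "t' \<in> carrier R" "s'' \<in> carrier R" "t'' \<in> carrier R"
    using pts by (auto simp: point_def)
  define d where "d = s \<otimes> t' \<ominus> s' \<otimes> t"
  have d: "d \<in> carrier R" "d \<noteq> \<zero>"
    using st lines_not_parallel[OF pts(1,2) ne(1)] by (auto simp: d_def)
  obtain m where m: "m \<in> carrier R" "m \<otimes> d = \<one>" "m \<noteq> \<zero>" using inv_nonzero[OF d] by blast
  \<comment> \<open>Cramer's rule for \<alpha> (s, t) + \<beta> (s', t') = (s'', t''); the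
    numerators are the determinants of the third point with the second and with the first.\<close>
  define \<alpha> where "\<alpha> = m \<otimes> (s'' \<otimes> t' \<ominus> s' \<otimes> t'')"
  define \<beta> where "\<beta> = m \<otimes> (s \<otimes> t'' \<ominus> s'' \<otimes> t)"
  have \<alpha>: "\<alpha> \<in> carrier R" "\<alpha> \<noteq> \<zero>"
    using st m lines_not_parallel[OF pts(2,3) ne(3)] by (auto simp: \<alpha>_def integral_iff)
  have \<beta>: "\<beta> \<in> carrier R" "\<beta> \<noteq> \<zero>"
    using st m lines_not_parallel[OF pts(1,3) ne(2)] by (auto simp: \<beta>_def integral_iff)
  have "\<alpha> \<otimes> s \<oplus> \<beta> \<otimes> s' = m \<otimes> d \<otimes> s''"
    unfolding \<alpha>_def \<beta>_def d_def using st m(1) by algebra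
  then have sum1: "\<alpha> \<otimes> s \<oplus> \<beta> \<otimes> s' = s''" using m st by simp
  have "\<alpha> \<otimes> t \<oplus> \<beta> \<otimes> t' = m \<otimes> d \<otimes> t''"
    unfolding \<alpha>_def \<beta>_def d_def using st m(1) by algebra
  then have sum2: "\<alpha> \<otimes> t \<oplus> \<beta> \<otimes> t' = t''" using m st by simp
  have 1: "point (\<alpha> \<otimes> s) (\<alpha> \<otimes> t)" "point (\<beta> \<otimes> s') (\<beta> \<otimes> t')"
    using pts \<alpha> \<beta> by (auto simp: point_def integral_iff)
  have 2: "line (\<alpha> \<otimes> s) (\<alpha> \<otimes> t) = line s t" "line (\<beta> \<otimes> s') (\<beta> \<otimes> t') = line s' t'"
    using st \<alpha> \<beta> by (intro line_parallel 1 pts; simp add: m_ac)+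
  show ?thesis
    by (rule that[OF 1]) (use 2 pts(3) sum1 sum2 in auto)
qed

text \<open>Nondegeneracy falls out of the counting bound: the product of |V| with the size of its
  complement is at most q^(2 r) = |V|.\<close>

lemma orth_V: "orth V = {(zero_vec, zero_vec)}"
proof -
  have "card V * card (orth V) \<le> card V" using orth_bound(1)[of V] card_V by simp
  moreover have "0 < card V" using card_V q_ge by simp
  ultimately have "card (orth V) \<le> card {(zero_vec, zero_vec)}" by simp
  moreover have "{(zero_vec, zero_vec)} \<subseteq> orth V" using zero_in_orth by blast
  ultimately show ?thesis by (metis card_seteq finite_orth)
qed

end

section \<open>Central extensions and the Chermak-Delgado lattice\<close>

text \<open>Two incomparable members lie strictly between B and T, and any member above both would
  contradict the antichain condition unless it is T; dually only B lies below both. Thus joins and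
  meets exist without any use of the group structure.\<close>

lemma subset_antichain_quasi_antichain:
  fixes \<C> :: "'a set set"
  assumes L_def: "L = \<lparr>carrier = \<C>, eq = (=), le = (\<subseteq>)\<rparr>"
    and B: "B \<in> \<C>" and T: "T \<in> \<C>" and bounds: "\<And>H. H \<in> \<C> \<Longrightarrow> B \<subseteq> H \<and> H \<subseteq> T"
    and antichain: "\<And>H K. H \<in> \<C> - {B, T} \<Longrightarrow> K \<in> \<C> - {B, T} \<Longrightarrow> H \<subseteq> K \<Longrightarrow> H = K"
    and w: "card (\<C> - {B, T}) = w" "3 \<le> w"
  shows "atoms L = \<C> - {B, T}" and "quasi_antichain L w"
proof -
  have "partial_order L"
    unfolding L_def by standard auto
  then interpret partial_order L .
  have least: "least L M (Upper L {H, K})"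
    if "H \<in> \<C>" "K \<in> \<C>" "M \<in> \<C>" "H \<subseteq> M" "K \<subseteq> M"
      "\<And>M'. M' \<in> \<C> \<Longrightarrow> H \<subseteq> M' \<Longrightarrow> K \<subseteq> M' \<Longrightarrow> M \<subseteq> M'" for H K M
    by (rule least_UpperI) (use that in \<open>auto simp: L_def Upper_def\<close>)
  have greatest: "greatest L M (Lower L {H, K})"
    if "H \<in> \<C>" "K \<in> \<C>" "M \<in> \<C>" "M \<subseteq> H" "M \<subseteq> K"
      "\<And>M'. M' \<in> \<C> \<Longrightarrow> M' \<subseteq> H \<Longrightarrow> M' \<subseteq> K \<Longrightarrow> M' \<subseteq> M" for H K M
    by (rule greatest_LowerI) (use that in \<open>auto simp: L_def Lower_def\<close>)
  have lat: "bounded_lattice L"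
  proof unfold_locales
    fix H K assume "H \<in> carrier L" "K \<in> carrier L"
    then have XY: "H \<in> \<C>" "K \<in> \<C>" by (simp_all add: L_def)
    show "\<exists>s. least L s (Upper L {H, K})"
    proof (cases "H \<subseteq> K \<or> K \<subseteq> H")
      case True
      then show ?thesis using least[OF XY] XY by blast
    next
      case False
      then have "H \<in> \<C> - {B, T}" "K \<in> \<C> - {B, T}" using XY bounds by blast+
      then have "Z = T" if "Z \<in> \<C>" "H \<subseteq> Z" "K \<subseteq> Z" for Z
        using that False antichain bounds by (metis Diff_iff insert_iff singletonD subset_antisym)
      then show ?thesis using least[OF XY T] XY bounds by blast
    qed
    show "\<exists>s. greatest L s (Lower L {H, K})"
    proof (cases "H \<subseteq> K \<or> K \<subseteq> H")
      case True
      then show ?thesis using greatest[OF XY] XY by blast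
    next
      case False
      then have "H \<in> \<C> - {B, T}" "K \<in> \<C> - {B, T}" using XY bounds by blast+
      then have "Z = B" if "Z \<in> \<C>" "Z \<subseteq> H" "Z \<subseteq> K" for Z
        using that False antichain bounds by (metis Diff_iff insert_iff singletonD subset_antisym)
      then show ?thesis using greatest[OF XY B] XY bounds by blast
    qed
  next
    show "\<exists>b. least L b (carrier L)"
      using B bounds by (intro exI[of _ B]) (auto simp: least_def L_def)
    show "\<exists>t. greatest L t (carrier L)"
      using T bounds by (intro exI[of _ T]) (auto simp: greatest_def L_def)
  qed
  interpret bounded_lattice L by (rule lat)
  have bot: "\<bottom>\<^bsub>L\<^esub> = B" using bottom_eq[of B] B bounds by (simp add: L_def)
  have top: "\<top>\<^bsub>L\<^esub> = T" using top_eq[of T] T bounds by (simp add: L_def)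
  \<comment> \<open>A member strictly between the bounds is what prevents T from being an
    atom.\<close>
  have "\<C> - {B, T} \<noteq> {}" using w by (metis card.empty not_numeral_le_zero)
  then obtain H where H: "H \<in> \<C>" "H \<noteq> B" "H \<noteq> T" by blast
  show at: "atoms L = \<C> - {B, T}"
    unfolding atoms_def bot
  proof (intro equalityI subsetI)
    fix K assume "K \<in> {x \<in> carrier L. x \<noteq> B \<and> (\<forall>y\<in>carrier L. y \<sqsubseteq>\<^bsub>L\<^esub> x \<longrightarrow> y = B \<or> y = x)}"
    then show "K \<in> \<C> - {B, T}" using H bounds by (auto simp: L_def)
  next
    fix K assume K: "K \<in> \<C> - {B, T}"
    have "J = B \<or> J = K" if "J \<in> \<C>" "J \<subseteq> K" for J
    proof -
      have "J \<noteq> T" using that K bounds by blast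
      then show ?thesis using that K antichain[of J K] by blast
    qed
    then show "K \<in> {x \<in> carrier L. x \<noteq> B \<and> (\<forall>y\<in>carrier L. y \<sqsubseteq>\<^bsub>L\<^esub> x \<longrightarrow> y = B \<or> y = x)}"
      using K by (simp add: L_def)
  qed
  show "quasi_antichain L w"
    unfolding quasi_antichain_def at bot top using lat w B T by (auto simp: L_def)
qed

lemma elementary_abelian_iso:
  assumes iso: "K \<cong> H" and K: "group K" and H: "elementary_abelian p H"
  shows "elementary_abelian p K"
proof -
  interpret K: group K by fact
  interpret H: comm_group H using H by (simp add: elementary_abelian_def)
  obtain h where h: "h \<in> iso K H" using iso by (auto simp: is_iso_def)
  then interpret group_hom K H h by unfold_locales (simp add: iso_def)
  have inj: "inj_on h (carrier K)" and img: "h ` carrier K = carrier H"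
    using h by (auto simp: iso_def bij_betw_def)
  have "comm_group K"
  proof (rule K.group_comm_groupI)
    fix x y assume "x \<in> carrier K" "y \<in> carrier K"
    then show "x \<otimes>\<^bsub>K\<^esub> y = y \<otimes>\<^bsub>K\<^esub> x"
      by (intro inj_onD[OF inj]) (auto simp: H.m_comm)
  qed
  moreover have "finite (carrier K)"
    using H finite_imageD[OF _ inj] img by (simp add: elementary_abelian_def)
  moreover have "x [^]\<^bsub>K\<^esub> p = \<one>\<^bsub>K\<^esub>" if "x \<in> carrier K" for x
    by (rule inj_onD[OF inj]) (use that H in \<open>simp_all add: hom_nat_pow elementary_abelian_def\<close>)
  ultimately show ?thesis using H by (simp add: elementary_abelian_def)
qed

lemma elementary_abelian_subgroup:
  assumes "elementary_abelian p H" "subgroup U H"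
  shows "elementary_abelian p (H\<lparr>carrier := U\<rparr>)"
proof -
  interpret H: comm_group H using assms by (simp add: elementary_abelian_def)
  have UH: "U \<subseteq> carrier H" using assms(2) subgroup.subset by blast
  have "comm_group (H\<lparr>carrier := U\<rparr>)"
    using H.m_comm UH H.subgroup_imp_group[OF assms(2)]
    by (intro group.group_comm_groupI) auto
  moreover have "x [^]\<^bsub>H\<lparr>carrier := U\<rparr>\<^esub> p = x [^]\<^bsub>H\<^esub> p" for x
    by (simp add: nat_pow_def)
  ultimately show ?thesis
    using assms(1) UH finite_subset[OF UH] by (simp add: elementary_abelian_def subset_iff)
qed

lemma centralizer_subset: "centralizer G H \<subseteq> carrier G"
  by (auto simp: centralizer_def)

text \<open>The interface through which the group is seen: all later properties are derived from
  these conditions, so a concrete model and its copy on another type are treated alike. That the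
  kernel of \<open>\<pi>\<close> is the center is not assumed; it follows from
  \<open>commute_iff\<close> and the nondegeneracy of the form.\<close>

locale cd_extension = anisotropic_form R \<nu> r + G: group G
  for R :: "('a, 'b) ring_scheme" (structure) and \<nu> r and G :: "('g, 'c) monoid_scheme" +
  fixes \<pi> :: "'g \<Rightarrow> (nat \<Rightarrow> 'a) \<times> (nat \<Rightarrow> 'a)" and p a :: nat
  assumes finite_G: "finite (carrier G)"
    and order_G: "\<exists>k. Coset.order G = p ^ k"
    and pi_hom: "\<pi> \<in> hom G (vec_group R {..<r} \<times>\<times> vec_group R {..<r})"
    and pi_surj: "\<pi> ` carrier G = vec R {..<r} \<times> vec R {..<r}"
    and commute_iff: "g \<in> carrier G \<Longrightarrow> h \<in> carrier G \<Longrightarrow>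
      g \<otimes>\<^bsub>G\<^esub> h = h \<otimes>\<^bsub>G\<^esub> g \<longleftrightarrow> perp (\<pi> g) (\<pi> h)"
    and prime_p: "Factorial_Ring.prime p"
    and char_p: "x \<in> carrier R \<Longrightarrow> [p] \<cdot> x = \<zero>"
    and card_R: "card (carrier R) = p ^ a"
    and kernel_exponent: "g \<in> carrier G \<Longrightarrow> \<pi> g = (zero_vec, zero_vec) \<Longrightarrow> g [^]\<^bsub>G\<^esub> p = \<one>\<^bsub>G\<^esub>"
begin

sublocale VG: comm_group VG by (rule comm_group_VG)

sublocale pi: group_hom G VG \<pi>
  by unfold_locales (rule pi_hom)

definition pre :: "((nat \<Rightarrow> 'a) \<times> (nat \<Rightarrow> 'a)) set \<Rightarrow> 'g set"
  where "pre U = {g \<in> carrier G. \<pi> g \<in> U}"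

lemma pi_V: "g \<in> carrier G \<Longrightarrow> \<pi> g \<in> V"
  using pi_surj by blast

lemma pi_lift:
  assumes "v \<in> V" obtains g where "g \<in> carrier G" "\<pi> g = v"
  using assms pi_surj by (metis imageE)

lemma pi_pre: "U \<subseteq> V \<Longrightarrow> \<pi> ` pre U = U"
  using pi_surj by (fastforce simp: pre_def)

lemma pre_inj: "U \<subseteq> V \<Longrightarrow> U' \<subseteq> V \<Longrightarrow> pre U = pre U' \<Longrightarrow> U = U'"
  by (metis pi_pre)

lemma pre_subset_iff: "U \<subseteq> V \<Longrightarrow> pre U \<subseteq> pre U' \<longleftrightarrow> U \<subseteq> U'"
  using image_mono[of "pre U" "pre U'" \<pi>] by (auto simp: pi_pre) (auto simp: pre_def)

lemma pre_V: "pre V = carrier G"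
  using pi_V by (auto simp: pre_def)

text \<open>Commuting depends only on the images under \<open>\<pi>\<close>, so centralizers are
  full preimages, even for sets H that are not.\<close>

lemma centralizer_eq:
  assumes "H \<subseteq> carrier G"
  shows "centralizer G H = pre (orth (\<pi> ` H))"
proof -
  have "g \<otimes>\<^bsub>G\<^esub> h = h \<otimes>\<^bsub>G\<^esub> g \<longleftrightarrow> perp (\<pi> h) (\<pi> g)" if "g \<in> carrier G" "h \<in> H" for g h
    using commute_iff[of h g] that assms by (metis subsetD)
  then show ?thesis using pi_V by (auto simp: centralizer_def pre_def orth_def)
qed

lemma center_eq: "center G = pre {(zero_vec, zero_vec)}"
  unfolding center_def by (simp add: centralizer_eq pi_surj orth_V)

lemma center_eq_kernel: "center G = kernel G VG \<pi>"
  unfolding center_eq by (auto simp: pre_def kernel_def zero_vec_def)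

lemma pre_subgroup:
  assumes "subgroup U VG"
  shows "subgroup (pre U) G"
proof -
  interpret U: subgroup U VG by fact
  show ?thesis
  proof (rule G.subgroupI)
    show "pre U \<noteq> {}"
      using U.one_closed pi.hom_one G.one_closed unfolding pre_def by (metis (mono_tags, lifting) empty_Collect_eq)
    show "inv\<^bsub>G\<^esub> g \<in> pre U" if "g \<in> pre U" for g
      using that U.m_inv_closed[of "\<pi> g"] pi.hom_inv[of g] by (auto simp only: pre_def mem_Collect_eq G.inv_closed)
    show "g \<otimes>\<^bsub>G\<^esub> h \<in> pre U" if "g \<in> pre U" "h \<in> pre U" for g h
      using that U.m_closed[of "\<pi> g" "\<pi> h"] pi.hom_mult[of g h] by (auto simp only: pre_def mem_Collect_eq G.m_closed)
  qed (auto simp: pre_def)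
qed

lemma center_subgroup: "subgroup (center G) G"
  unfolding center_eq_kernel by (rule pi.subgroup_kernel)

lemma center_normal: "center G \<lhd> G"
  unfolding center_eq_kernel by (rule pi.normal_kernel)

lemma card_pre:
  assumes "U \<subseteq> V"
  shows "card (pre U) = card U * card (center G)"
proof -
  have fibre: "card (pre {v}) = card (center G)" if v: "v \<in> V" for v
  proof -
    obtain g where g: "g \<in> carrier G" "\<pi> g = v" using pi_lift[OF v] .
    have "bij_betw (\<lambda>x. g \<otimes>\<^bsub>G\<^esub> x) (center G) (pre {v})"
    proof (rule bij_betwI[where g = "\<lambda>x. inv\<^bsub>G\<^esub> g \<otimes>\<^bsub>G\<^esub> x"])
      show "(\<lambda>x. g \<otimes>\<^bsub>G\<^esub> x) \<in> center G \<rightarrow> pre {v}"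
      proof
        fix x assume "x \<in> center G"
        then have x: "x \<in> carrier G" "\<pi> x = \<one>\<^bsub>VG\<^esub>"
          by (auto simp only: center_eq_kernel kernel_def mem_Collect_eq)
        have "\<pi> (g \<otimes>\<^bsub>G\<^esub> x) = v"
          using VG.r_one[OF pi.hom_closed[OF g(1)]] pi.hom_mult[OF g(1) x(1)] unfolding x(2) g(2) by metis
        then show "g \<otimes>\<^bsub>G\<^esub> x \<in> pre {v}" using g x by (simp add: pre_def)
      qed
      show "(\<lambda>x. inv\<^bsub>G\<^esub> g \<otimes>\<^bsub>G\<^esub> x) \<in> pre {v} \<rightarrow> center G"
      proof
        fix x assume "x \<in> pre {v}"
        then have x: "x \<in> carrier G" "\<pi> x = v" by (auto simp: pre_def)
        have "\<pi> (inv\<^bsub>G\<^esub> g \<otimes>\<^bsub>G\<^esub> x) = \<one>\<^bsub>VG\<^esub>"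
          using VG.l_inv[OF pi.hom_closed[OF g(1)]] pi.hom_mult[OF G.inv_closed[OF g(1)] x(1)] pi.hom_inv[OF g(1)]
          unfolding x(2) g(2) by metis
        then show "inv\<^bsub>G\<^esub> g \<otimes>\<^bsub>G\<^esub> x \<in> center G"
          using g x by (simp only: center_eq_kernel kernel_def mem_Collect_eq G.m_closed G.inv_closed simp_thms)
      qed
    qed (use g in \<open>auto simp: center_eq pre_def G.m_assoc[symmetric]\<close>)
    then show ?thesis by (metis bij_betw_same_card)
  qed
  have "pre U = (\<Union>v\<in>U. pre {v})" by (auto simp: pre_def)
  moreover have "card (\<Union>v\<in>U. pre {v}) = (\<Sum>v\<in>U. card (pre {v}))"
    using finite_subset[OF assms finite_V] finite_G
    by (intro card_UN_disjoint) (auto simp: pre_def)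
  moreover have "\<dots> = (\<Sum>v\<in>U. card (center G))" using fibre assms by (intro sum.cong) auto
  ultimately show ?thesis by simp
qed

section \<open>Chermak-Delgado measures and the lattice\<close>

abbreviation "z \<equiv> card (center G)"

lemma z_pos: "0 < z"
  using subgroup.one_closed[OF center_subgroup] finite_G centralizer_subset
  unfolding center_def by (metis card_gt_0_iff empty_iff finite_subset)

lemma cd_measure_eq:
  assumes "H \<subseteq> carrier G"
  shows "cd_measure G H = card H * (card (orth (\<pi> ` H)) * z)"
  by (simp add: cd_measure_def centralizer_eq[OF assms] card_pre[OF orth_subset])

lemma card_le_image:
  assumes "H \<subseteq> carrier G"
  shows "card H \<le> card (\<pi> ` H) * z" "card H = card (\<pi> ` H) * z \<Longrightarrow> H = pre (\<pi> ` H)"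
proof -
  have V: "\<pi> ` H \<subseteq> V" using assms pi_V by blast
  have sub: "H \<subseteq> pre (\<pi> ` H)" using assms by (auto simp: pre_def)
  have fin: "finite (pre (\<pi> ` H))" using finite_G by (simp add: pre_def)
  show "card H \<le> card (\<pi> ` H) * z" using card_mono[OF fin sub] card_pre[OF V] by simp
  show "card H = card (\<pi> ` H) * z \<Longrightarrow> H = pre (\<pi> ` H)"
    using card_subset_eq[OF fin sub] card_pre[OF V] by simp
qed

text \<open>With U the image of H, the subgroup contributes at most |U| z and its centralizer
  exactly z times the size of the complement of U, so \<open>orth_bound\<close> applies. Equality in
  the product forces equality in both estimates, and the first equality makes H a full
  preimage.\<close>

lemma cd_measure_bound:
  assumes "H \<subseteq> carrier G" "H \<noteq> {}"
  shows "cd_measure G H \<le> z * z * q ^ (2 * r)"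
    and "cd_measure G H = z * z * q ^ (2 * r) \<Longrightarrow>
      H = pre (\<pi> ` H) \<and> card (\<pi> ` H) * card (orth (\<pi> ` H)) = q ^ (2 * r)"
proof -
  define U where "U = \<pi> ` H"
  have V: "U \<subseteq> V" using assms pi_V unfolding U_def by blast
  define O' where "O' = card (orth U)"
  have O': "0 < O'" using zero_in_orth[OF V] finite_orth[of U] by (auto simp: O'_def card_gt_0_iff)
  have m: "cd_measure G H = card H * (O' * z)"
    using cd_measure_eq[OF assms(1)] by (simp add: U_def O'_def)
  have 1: "card H * (O' * z) \<le> (card U * z) * (O' * z)"
    using card_le_image(1)[OF assms(1)] by (simp add: U_def)
  have 2: "(card U * z) * (O' * z) = z * z * (card U * O')" by (simp add: ac_simps)
  have 3: "z * z * (card U * O') \<le> z * z * q ^ (2 * r)"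
    using orth_bound(1)[OF V] by (simp add: O'_def)
  show "cd_measure G H \<le> z * z * q ^ (2 * r)" using m 1 2 3 by linarith
  assume "cd_measure G H = z * z * q ^ (2 * r)"
  then have "card H * (O' * z) = (card U * z) * (O' * z)" "z * z * (card U * O') = z * z * q ^ (2 * r)"
    using m 1 2 3 by linarith+
  then have "card H = card U * z" "card U * O' = q ^ (2 * r)" using O' z_pos by auto
  then show "H = pre (\<pi> ` H) \<and> card (\<pi> ` H) * card (orth (\<pi> ` H)) = q ^ (2 * r)"
    using card_le_image(2)[OF assms(1)] by (simp add: U_def O'_def)
qed

lemma subgroup_nonempty: "subgroup H G \<Longrightarrow> H \<noteq> {}"
  using subgroup.one_closed by blast

lemma cd_measure_G: "cd_measure G (carrier G) = z * z * q ^ (2 * r)"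
  using cd_measure_eq[of "carrier G"] card_pre[of V]
  by (simp add: pre_V pi_surj orth_V card_V ac_simps del: card_cartesian_product)

lemma cd_max_eq: "cd_max G = z * z * q ^ (2 * r)"
  unfolding cd_max_def
proof (rule Max_eqI)
  have "{H. subgroup H G} \<subseteq> Pow (carrier G)" using subgroup.subset by blast
  then have "finite {H. subgroup H G}" using finite_G by (meson finite_Pow_iff finite_subset)
  then show "finite {cd_measure G H | H. subgroup H G}" by simp
  show "y \<le> z * z * q ^ (2 * r)" if y: "y \<in> {cd_measure G H | H. subgroup H G}" for y
  proof -
    obtain H where H: "subgroup H G" "y = cd_measure G H" using y by blast
    show ?thesis
      using cd_measure_bound(1)[OF subgroup.subset[OF H(1)] subgroup_nonempty[OF H(1)]] H(2) by simp
  qed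
  show "z * z * q ^ (2 * r) \<in> {cd_measure G H | H. subgroup H G}"
    using G.subgroup_self by (intro CollectI exI[of _ "carrier G"]) (simp add: cd_measure_G)
qed

text \<open>A subgroup of maximal measure is the full preimage of a set attaining equality in
  \<open>orth_bound\<close>, which leaves 0, V and the lines. Conversely each of these preimages is
  a subgroup whose measure reaches the bound.\<close>

lemma carrier_cd_lattice:
  "carrier (cd_lattice G) = {center G, carrier G} \<union> pre ` lines" (is "?C = ?D")
proof (intro equalityI subsetI)
  fix H assume "H \<in> ?C"
  then have H: "subgroup H G" "cd_measure G H = z * z * q ^ (2 * r)"
    by (simp_all add: cd_lattice_def cd_max_eq)
  have HG: "H \<subseteq> carrier G" "H \<noteq> {}" using subgroup.subset[OF H(1)] subgroup_nonempty[OF H(1)] by auto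
  have V: "\<pi> ` H \<subseteq> V" using HG pi_V by blast
  have "H = pre (\<pi> ` H)" "\<pi> ` H = {(zero_vec, zero_vec)} \<or> \<pi> ` H = V \<or> \<pi> ` H \<in> lines"
    using cd_measure_bound(2)[OF HG H(2)] orth_bound(2)[OF V] by (auto simp: lines_def)
  then show "H \<in> ?D" using center_eq pre_V by auto
next
  fix H assume H: "H \<in> ?D"
  have "subgroup H G"
    using H center_subgroup G.subgroup_self pre_subgroup line_subgroup by (auto simp: lines_def)
  moreover have "cd_measure G H = z * z * q ^ (2 * r)"
  proof -
    consider "H = center G" | "H = carrier G" | s t where "point s t" "H = pre (line s t)"
      using H by (auto simp: lines_def)
    then show ?thesis
    proof cases
      case 1
      have "\<pi> ` H = {(zero_vec, zero_vec)}" unfolding 1 center_eq by (rule pi_pre) simp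
      moreover have "orth {(zero_vec, zero_vec)} = V"
      proof -
        have "V \<subseteq> orth (orth V)" by (rule subset_orth_orth) (rule subset_refl)
        then show ?thesis unfolding orth_V by (rule subset_antisym[OF orth_subset])
      qed
      moreover have "H \<subseteq> carrier G" unfolding 1 using subgroup.subset[OF center_subgroup] .
      ultimately show ?thesis using cd_measure_eq[of H] 1
        by (simp add: card_V ac_simps del: card_cartesian_product)
    next
      case 2
      then show ?thesis using cd_measure_G by simp
    next
      case 3
      have HG: "H \<subseteq> carrier G" "H \<noteq> {}"
        using subgroup.subset[OF \<open>subgroup H G\<close>] subgroup_nonempty[OF \<open>subgroup H G\<close>] by auto
      have img: "\<pi> ` H = line s t" unfolding 3 by (rule pi_pre[OF line_subset_V[OF 3(1)]])
      have cH: "card H = q ^ r * z"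
        unfolding 3 card_pre[OF line_subset_V[OF 3(1)]] using card_line[OF 3(1)] by simp
      have "q ^ r \<le> card (orth (line s t))"
        using card_mono[OF finite_orth line_orth[OF 3(1)]] card_line[OF point_perp[OF 3(1)]] by simp
      then have "q ^ r * z * (q ^ r * z) \<le> cd_measure G H"
        unfolding cd_measure_eq[OF HG(1)] img cH by (intro mult_le_mono) auto
      moreover have "q ^ r * z * (q ^ r * z) = z * z * q ^ (2 * r)"
        unfolding mult_2 power_add by (simp only: ac_simps)
      ultimately show ?thesis using cd_measure_bound(1)[OF HG] by simp
    qed
  qed
  ultimately show "H \<in> ?C" by (simp add: cd_lattice_def cd_max_eq)
qed

lemma pre_lines_distinct:
  assumes "L \<in> lines"
  shows "pre L \<noteq> center G" "pre L \<noteq> carrier G" "center G \<subseteq> pre L" "pre L \<subseteq> carrier G"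
proof -
  obtain s t where st: "point s t" "L = line s t" using assms by (rule linesE)
  have LV: "L \<subseteq> V" using st line_subset_V by blast
  show "pre L \<noteq> center G" using pre_inj[OF LV, of "{(zero_vec, zero_vec)}"] lines_distinct(1)[OF assms] by (auto simp: center_eq)
  show "pre L \<noteq> carrier G" using pre_inj[OF LV, of V] lines_distinct(2)[OF assms] by (auto simp: pre_V)
  have "(zero_vec, zero_vec) \<in> L" using st zero_in_line by blast
  then show "center G \<subseteq> pre L" by (auto simp: center_eq pre_def)
  show "pre L \<subseteq> carrier G" by (auto simp: pre_def)
qed

lemma lines_V: "L \<in> lines \<Longrightarrow> L \<subseteq> V"
  by (metis linesE line_subset_V)

lemma atoms_eq: "atoms (cd_lattice G) = pre ` lines"
  and cd_quasi_antichain: "quasi_antichain (cd_lattice G) (p ^ a + 1)"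
proof -
  have C: "cd_lattice G = \<lparr>carrier = {center G, carrier G} \<union> pre ` lines, eq = (=), le = (\<subseteq>)\<rparr>"
    using carrier_cd_lattice by (simp add: cd_lattice_def)
  have diff: "{center G, carrier G} \<union> pre ` lines - {center G, carrier G} = pre ` lines"
    using pre_lines_distinct by blast
  have "inj_on pre lines" using pre_inj lines_V by (meson inj_onI)
  then have card: "card ({center G, carrier G} \<union> pre ` lines - {center G, carrier G}) = p ^ a + 1"
    unfolding diff using card_lines card_R by (simp add: card_image)
  have "3 \<le> p ^ a + 1" using q_ge card_R by simp
  note qa = subset_antichain_quasi_antichain[OF C, of "center G" "carrier G",
      OF _ _ _ _ card this]
  have bounds: "center G \<subseteq> H \<and> H \<subseteq> carrier G" if "H \<in> {center G, carrier G} \<union> pre ` lines" for H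
    using that pre_lines_distinct(3,4) subgroup.subset[OF center_subgroup] by auto
  have anti: "H = K" if HK: "H \<in> {center G, carrier G} \<union> pre ` lines - {center G, carrier G}"
    "K \<in> {center G, carrier G} \<union> pre ` lines - {center G, carrier G}" "H \<subseteq> K" for H K
  proof -
    obtain L L' where L: "L \<in> lines" "L' \<in> lines" "H = pre L" "K = pre L'"
      using HK(1,2) unfolding diff by blast
    have "L \<subseteq> L'" using HK(3) pre_subset_iff[OF lines_V[OF L(1)]] unfolding L(3,4) by blast
    then show ?thesis using lines_incomparable[OF L(1,2)] L(3,4) by simp
  qed
  show "atoms (cd_lattice G) = pre ` lines"
    using qa(1)[OF _ _ bounds anti] diff by simp
  show "quasi_antichain (cd_lattice G) (p ^ a + 1)"
    using qa(2)[OF _ _ bounds anti] by simp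
qed

lemma abelian_atoms_empty: "abelian_atoms G = {}"
proof -
  have "\<not> comm_group (G\<lparr>carrier := pre (line s t)\<rparr>)" if st: "point s t" for s t
  proof
    assume "comm_group (G\<lparr>carrier := pre (line s t)\<rparr>)"
    then interpret H: comm_group "G\<lparr>carrier := pre (line s t)\<rparr>" .
    obtain v w where vw: "v \<in> line s t" "w \<in> line s t" "\<not> perp v w"
      using line_not_isotropic[OF st] .
    then have "v \<in> V" "w \<in> V" using line_subset_V[OF st] by blast+
    then obtain g h where gh: "g \<in> carrier G" "\<pi> g = v" "h \<in> carrier G" "\<pi> h = w"
      using pi_lift by metis
    then have "g \<otimes>\<^bsub>G\<^esub> h = h \<otimes>\<^bsub>G\<^esub> g"
      using H.m_comm[of g h] vw by (simp add: pre_def)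
    then show False using commute_iff gh vw(3) by blast
  qed
  then show ?thesis by (auto simp: abelian_atoms_def atoms_eq lines_def)
qed

section \<open>Quotients by the center and the derived subgroup\<close>

lemma elementary_abelian_VG: "elementary_abelian p VG"
proof -
  have "v [^]\<^bsub>VG\<^esub> p = \<one>\<^bsub>VG\<^esub>" if "v \<in> carrier VG" for v
  proof -
    have "fst v \<in> W" "snd v \<in> W" using that by (auto simp: carrier_VG)
    then have "fst v [^]\<^bsub>WG\<^esub> p = zero_vec" "snd v [^]\<^bsub>WG\<^esub> p = zero_vec"
      unfolding vec_group_pow zero_vec_def using char_p W_closed by auto
    then show ?thesis by (simp only: DirProd_pow VG_one)
  qed
  moreover have "finite (carrier VG)" by (simp only: carrier_VG finite_V)
  ultimately show ?thesis using prime_p comm_group_VG by (simp add: elementary_abelian_def)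
qed

lemma pre_group: "subgroup U VG \<Longrightarrow> group (G\<lparr>carrier := pre U\<rparr>)"
  by (rule G.subgroup_imp_group[OF pre_subgroup])

lemma center_subset_pre:
  assumes "subgroup U VG"
  shows "center G \<subseteq> pre U"
  using subgroup.one_closed[OF assms] by (auto simp: center_eq_kernel kernel_def pre_def)

lemma pre_hom:
  assumes "subgroup U VG"
  shows "group_hom (G\<lparr>carrier := pre U\<rparr>) (VG\<lparr>carrier := U\<rparr>) \<pi>"
proof -
  interpret H: group "G\<lparr>carrier := pre U\<rparr>" by (rule pre_group[OF assms])
  interpret K: group "VG\<lparr>carrier := U\<rparr>" by (rule VG.subgroup_imp_group[OF assms])
  show ?thesis
  proof unfold_locales
    show "\<pi> \<in> hom (G\<lparr>carrier := pre U\<rparr>) (VG\<lparr>carrier := U\<rparr>)"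
      using pi.hom_mult by (intro homI) (simp_all add: pre_def del: vec_group_simps mult_DirProd)
  qed
qed

lemma pre_kernel:
  assumes "subgroup U VG"
  shows "kernel (G\<lparr>carrier := pre U\<rparr>) (VG\<lparr>carrier := U\<rparr>) \<pi> = center G"
  using center_subset_pre[OF assms] by (auto simp: center_eq_kernel kernel_def pre_def)

text \<open>This is the homomorphism theorem for the restriction of \<open>\<pi>\<close>, whose
  kernel is still the center. It reduces the structure of M/Z(G) to that of an additive subgroup of
  V.\<close>

lemma quot_center_iso:
  assumes "subgroup U VG"
  shows "quot_center G (pre U) \<cong> VG\<lparr>carrier := U\<rparr>"
proof -
  interpret Q: group_hom "G\<lparr>carrier := pre U\<rparr>" "VG\<lparr>carrier := U\<rparr>" \<pi> by (rule pre_hom[OF assms])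
  have "U \<subseteq> V" using subgroup.subset[OF assms] by (simp only: carrier_VG)
  then have "\<pi> ` carrier (G\<lparr>carrier := pre U\<rparr>) = carrier (VG\<lparr>carrier := U\<rparr>)"
    by (simp add: pi_pre)
  from Q.FactGroup_iso[OF this] show ?thesis unfolding pre_kernel[OF assms] .
qed

lemma quot_center_group:
  assumes "subgroup U VG"
  shows "group (quot_center G (pre U))"
proof -
  interpret Q: group_hom "G\<lparr>carrier := pre U\<rparr>" "VG\<lparr>carrier := U\<rparr>" \<pi> by (rule pre_hom[OF assms])
  show ?thesis using normal.factorgroup_is_group[OF Q.normal_kernel] unfolding pre_kernel[OF assms] .
qed

lemma quot_center_elementary_abelian:
  assumes "subgroup U VG"
  shows "elementary_abelian p (quot_center G (pre U))"
  by (intro elementary_abelian_iso[OF quot_center_iso] quot_center_group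
      elementary_abelian_subgroup elementary_abelian_VG assms)

lemma quot_center_order:
  assumes "subgroup U VG"
  shows "Coset.order (quot_center G (pre U)) = card U"
  using iso_same_card[OF quot_center_iso[OF assms]] by (simp add: order_def)

lemma pre_carrier: "pre (carrier VG) = carrier G"
  using pre_V by (simp only: carrier_VG)

lemma G_quot: "quot_center G (pre (carrier VG)) = G Mod center G"
  unfolding pre_carrier by (simp add: FactGroup_def RCOSETS_def r_coset_def set_mult_def)

lemma order_G_Mod_center: "Coset.order (G Mod center G) = q ^ (2 * r)"
  using quot_center_order[OF VG.subgroup_self] unfolding G_quot by (simp only: carrier_VG card_V)

lemma elementary_abelian_G_Mod_center: "elementary_abelian p (G Mod center G)"
  using quot_center_elementary_abelian[OF VG.subgroup_self] unfolding G_quot .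

text \<open>Commutators die in the abelian group V, so the derived subgroup lies in the center,
  which is the kernel of \<open>\<pi>\<close>; there commutativity is clear and
  \<open>kernel_exponent\<close> gives the exponent.\<close>

lemma elementary_abelian_derived:
  "elementary_abelian p (G\<lparr>carrier := derived G (carrier G)\<rparr>)"
proof -
  have "derived_set G (carrier G) \<subseteq> center G"
  proof
    fix x assume "x \<in> derived_set G (carrier G)"
    then obtain g h where gh: "g \<in> carrier G" "h \<in> carrier G"
      and x: "x = g \<otimes>\<^bsub>G\<^esub> h \<otimes>\<^bsub>G\<^esub> inv\<^bsub>G\<^esub> g \<otimes>\<^bsub>G\<^esub> inv\<^bsub>G\<^esub> h" by blast
    have vw: "\<pi> g \<in> carrier VG" "\<pi> h \<in> carrier VG" using gh pi.hom_closed by blast+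
    have "\<pi> x = \<pi> g \<otimes>\<^bsub>VG\<^esub> \<pi> h \<otimes>\<^bsub>VG\<^esub> inv\<^bsub>VG\<^esub> \<pi> g \<otimes>\<^bsub>VG\<^esub> inv\<^bsub>VG\<^esub> \<pi> h"
      unfolding x using gh by (simp only: pi.hom_mult pi.hom_inv G.m_closed G.inv_closed)
    also have "\<dots> = \<pi> h \<otimes>\<^bsub>VG\<^esub> (\<pi> g \<otimes>\<^bsub>VG\<^esub> inv\<^bsub>VG\<^esub> \<pi> g) \<otimes>\<^bsub>VG\<^esub> inv\<^bsub>VG\<^esub> \<pi> h"
      using vw VG.m_comm[OF vw] by (simp only: VG.m_assoc VG.inv_closed VG.m_closed)
    also have "\<dots> = \<one>\<^bsub>VG\<^esub>" using vw by (simp only: VG.r_inv VG.r_one VG.inv_closed)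
    finally show "x \<in> center G" using gh x by (simp add: center_eq_kernel kernel_def del: one_DirProd)
  qed
  then have sub: "derived G (carrier G) \<subseteq> center G"
    unfolding derived_def by (rule G.generate_subgroup_incl[OF _ center_subgroup])
  have grp: "subgroup (derived G (carrier G)) G" by (rule G.derived_is_subgroup) simp
  have cG: "x \<in> carrier G" "\<pi> x = (zero_vec, zero_vec)" if "x \<in> center G" for x
    using that by (auto simp: center_eq pre_def)
  have "comm_group (G\<lparr>carrier := derived G (carrier G)\<rparr>)"
  proof (rule group.group_comm_groupI)
    show "group (G\<lparr>carrier := derived G (carrier G)\<rparr>)" by (rule G.subgroup_imp_group[OF grp])
    fix x y
    assume "x \<in> carrier (G\<lparr>carrier := derived G (carrier G)\<rparr>)" "y \<in> carrier (G\<lparr>carrier := derived G (carrier G)\<rparr>)"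
    then have "x \<in> center G" "y \<in> carrier G" using sub cG by auto
    then show "x \<otimes>\<^bsub>G\<lparr>carrier := derived G (carrier G)\<rparr>\<^esub> y = y \<otimes>\<^bsub>G\<lparr>carrier := derived G (carrier G)\<rparr>\<^esub> x"
      by (simp add: center_def centralizer_def)
  qed
  moreover have "finite (derived G (carrier G))"
    using finite_subset[OF subgroup.subset[OF grp] finite_G] .
  moreover have "x [^]\<^bsub>G\<lparr>carrier := derived G (carrier G)\<rparr>\<^esub> p = \<one>\<^bsub>G\<^esub>" if "x \<in> derived G (carrier G)" for x
    using kernel_exponent[OF cG] that sub by (simp add: nat_pow_def subset_iff)
  ultimately show ?thesis using prime_p by (simp add: elementary_abelian_def)
qed

lemma P1: "P1 p G"
  by (simp add: P1_def elementary_abelian_G_Mod_center elementary_abelian_derived)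

lemma tensor_iso:
  assumes "point s t"
  shows "WG \<cong> VG\<lparr>carrier := line s t\<rparr>"
proof -
  interpret T: group_hom WG VG "tensor s t" using assms tensor_hom by (simp add: point_def)
  have "tensor s t \<in> iso WG (VG\<lparr>carrier := line s t\<rparr>)"
  proof (rule isoI)
    show "tensor s t \<in> hom WG (VG\<lparr>carrier := line s t\<rparr>)"
      using T.hom_mult by (intro homI) (simp_all add: line_def del: mult_DirProd)
    show "bij_betw (tensor s t) (carrier WG) (carrier (VG\<lparr>carrier := line s t\<rparr>))"
      using tensor_inj[OF assms] by (simp add: bij_betw_def line_def)
  qed
  then show ?thesis by (auto simp: is_iso_def)
qed

lemma quot_center_carrier: "carrier (quot_center G (pre U)) = (\<lambda>g. center G #>\<^bsub>G\<^esub> g) ` pre U"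
  by (simp add: carrier_FactGroup r_coset_def)

text \<open>Cosets of the center are the fibres of \<open>\<pi>\<close>; equations in the quotient
  can therefore be checked on vectors.\<close>

lemma center_coset_eq_iff:
  assumes "g \<in> carrier G" "h \<in> carrier G"
  shows "center G #>\<^bsub>G\<^esub> g = center G #>\<^bsub>G\<^esub> h \<longleftrightarrow> \<pi> g = \<pi> h"
proof -
  have mem: "x \<in> center G #>\<^bsub>G\<^esub> g \<longleftrightarrow> x \<in> carrier G \<and> \<pi> x = \<pi> g" if g: "g \<in> carrier G" for x g
  proof
    assume "x \<in> center G #>\<^bsub>G\<^esub> g"
    then obtain c where c: "c \<in> carrier G" "\<pi> c = \<one>\<^bsub>VG\<^esub>" "x = c \<otimes>\<^bsub>G\<^esub> g"
      by (auto simp only: center_eq_kernel kernel_def r_coset_def)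
    have "\<pi> x = \<pi> g" unfolding c(3) pi.hom_mult[OF c(1) g] c(2) by (rule VG.l_one[OF pi.hom_closed[OF g]])
    then show "x \<in> carrier G \<and> \<pi> x = \<pi> g" using c g by simp
  next
    assume x: "x \<in> carrier G \<and> \<pi> x = \<pi> g"
    then have xc: "x \<in> carrier G" by blast
    have "\<pi> (x \<otimes>\<^bsub>G\<^esub> inv\<^bsub>G\<^esub> g) = \<pi> g \<otimes>\<^bsub>VG\<^esub> inv\<^bsub>VG\<^esub> \<pi> g"
      using x g by (simp only: pi.hom_mult pi.hom_inv G.inv_closed)
    also have "\<dots> = \<one>\<^bsub>VG\<^esub>" by (rule VG.r_inv[OF pi.hom_closed[OF g]])
    finally have "x \<otimes>\<^bsub>G\<^esub> inv\<^bsub>G\<^esub> g \<in> center G"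
      using xc g by (simp only: center_eq_kernel kernel_def mem_Collect_eq G.m_closed G.inv_closed simp_thms)
    moreover have "x = x \<otimes>\<^bsub>G\<^esub> inv\<^bsub>G\<^esub> g \<otimes>\<^bsub>G\<^esub> g" using xc g by (simp add: G.m_assoc)
    ultimately show "x \<in> center G #>\<^bsub>G\<^esub> g" unfolding r_coset_def by blast
  qed
  show ?thesis
  proof
    assume "center G #>\<^bsub>G\<^esub> g = center G #>\<^bsub>G\<^esub> h"
    then show "\<pi> g = \<pi> h" using mem[OF assms(1), of g] mem[OF assms(2), of g] assms by blast
  next
    assume eq: "\<pi> g = \<pi> h"
    show "center G #>\<^bsub>G\<^esub> g = center G #>\<^bsub>G\<^esub> h"
      by (rule Set.set_eqI) (simp only: mem[OF assms(1)] mem[OF assms(2)] eq)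
  qed
qed

lemma quot_center_normal:
  assumes "subgroup U VG"
  shows "carrier (quot_center G (pre U)) \<lhd> G Mod center G"
proof -
  interpret Q: comm_group "G Mod center G"
    using elementary_abelian_G_Mod_center by (simp add: elementary_abelian_def)
  interpret N: normal "center G" G by (rule center_normal)
  interpret nat_hom: group_hom G "G Mod center G" "\<lambda>g. center G #>\<^bsub>G\<^esub> g"
    by unfold_locales (rule N.r_coset_hom_Mod)
  show ?thesis
    unfolding quot_center_carrier
    by (intro Q.subgroup_imp_normal nat_hom.subgroup_img_is_subgroup pre_subgroup assms)
qed

lemma P2: "P2 G"
  unfolding P2_def atoms_eq
proof (intro ballI impI)
  fix M N assume "M \<in> pre ` lines" "N \<in> pre ` lines" and ne: "M \<noteq> N"
  then obtain s t s' t' where st: "point s t" "point s' t'"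
    and M: "M = pre (line s t)" and N: "N = pre (line s' t')"
    by (auto simp: lines_def)
  have sub: "subgroup (line s t) VG" "subgroup (line s' t') VG" using st line_subgroup by auto
  have "line s t \<noteq> line s' t'" using ne M N by auto
  then have np: "s \<otimes> t' \<noteq> s' \<otimes> t" by (rule lines_not_parallel[OF st])
  \<comment> \<open>Both quotients are compared with F^r, of which every line is a copy by tensoring
    with its point.\<close>
  have "quot_center G M \<cong> WG"
    unfolding M
    using iso_trans[OF quot_center_iso[OF sub(1)] group.iso_sym[OF comm_group.axioms(2)[OF comm_group_WG] tensor_iso[OF st(1)]]]
    by blast
  moreover have "WG \<cong> quot_center G N"
    unfolding N
    using iso_trans[OF tensor_iso[OF st(2)] group.iso_sym[OF quot_center_group[OF sub(2)] quot_center_iso[OF sub(2)]]] .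
  ultimately have "quot_center G M \<cong> quot_center G N" by (rule iso_trans)
  moreover have "internal_direct_product (G Mod center G) (carrier (quot_center G M)) (carrier (quot_center G N))"
    unfolding internal_direct_product_def M N
  proof (intro conjI quot_center_normal sub)
    have in_pre: "g \<in> carrier G" if "g \<in> pre U" for g U using that by (simp add: pre_def)
    have one: "center G #>\<^bsub>G\<^esub> \<one>\<^bsub>G\<^esub> = center G"
      using G.coset_mult_one subgroup.subset[OF center_subgroup] by blast
    have one_in: "\<one>\<^bsub>G\<^esub> \<in> pre (line s t)" "\<one>\<^bsub>G\<^esub> \<in> pre (line s' t')"
      using subgroup.one_closed[OF pre_subgroup] sub by auto
    show "carrier (quot_center G (pre (line s t))) \<inter> carrier (quot_center G (pre (line s' t'))) = {\<one>\<^bsub>G Mod center G\<^esub>}"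
    proof (intro equalityI subsetI)
      fix C assume "C \<in> carrier (quot_center G (pre (line s t))) \<inter> carrier (quot_center G (pre (line s' t')))"
      then obtain g h where gh: "g \<in> pre (line s t)" "h \<in> pre (line s' t')"
        "C = center G #>\<^bsub>G\<^esub> g" "C = center G #>\<^bsub>G\<^esub> h" unfolding quot_center_carrier by blast
      then have eq: "\<pi> g = \<pi> h" using center_coset_eq_iff in_pre by metis
      then have "\<pi> g \<in> line s t \<inter> line s' t'" using gh by (simp add: pre_def)
      then have "\<pi> g = \<pi> \<one>\<^bsub>G\<^esub>" using line_inter[OF st np] pi.hom_one VG_one by auto
      then have "C = center G" using center_coset_eq_iff[OF in_pre[OF gh(1)] G.one_closed] gh(3) one by simp
      then show "C \<in> {\<one>\<^bsub>G Mod center G\<^esub>}" by simp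
    next
      fix C assume "C \<in> {\<one>\<^bsub>G Mod center G\<^esub>}"
      then have "C = center G #>\<^bsub>G\<^esub> \<one>\<^bsub>G\<^esub>" using one by simp
      then show "C \<in> carrier (quot_center G (pre (line s t))) \<inter> carrier (quot_center G (pre (line s' t')))"
        unfolding quot_center_carrier using one_in by blast
    qed
    interpret NZ: normal "center G" G by (rule center_normal)
    have prod: "(center G #>\<^bsub>G\<^esub> g) \<otimes>\<^bsub>G Mod center G\<^esub> (center G #>\<^bsub>G\<^esub> h) = center G #>\<^bsub>G\<^esub> (g \<otimes>\<^bsub>G\<^esub> h)"
      if "g \<in> carrier G" "h \<in> carrier G" for g h
      using NZ.rcos_sum[OF that] by (simp add: FactGroup_def)
    let ?c = "\<lambda>g. center G #>\<^bsub>G\<^esub> g"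
    have "?c ` pre (line s t) <#>\<^bsub>G Mod center G\<^esub> ?c ` pre (line s' t') = ?c ` carrier G"
    proof (intro equalityI subsetI)
      fix C assume "C \<in> ?c ` pre (line s t) <#>\<^bsub>G Mod center G\<^esub> ?c ` pre (line s' t')"
      then obtain g h where gh: "g \<in> carrier G" "h \<in> carrier G" "C = ?c g \<otimes>\<^bsub>G Mod center G\<^esub> ?c h"
        unfolding set_mult_def using in_pre by blast
      show "C \<in> ?c ` carrier G" unfolding gh(3) prod[OF gh(1,2)] using gh(1,2) by blast
    next
      fix C assume "C \<in> ?c ` carrier G"
      then obtain x where x: "x \<in> carrier G" "C = ?c x" by blast
      obtain l l' where l: "l \<in> line s t" "l' \<in> line s' t'" "\<pi> x = l \<otimes>\<^bsub>VG\<^esub> l'"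
        using line_sum[OF st np pi_V[OF x(1)]] by blast
      obtain g where g: "g \<in> carrier G" "\<pi> g = l" using pi_lift l line_subset_V[OF st(1)] by blast
      obtain h where h: "h \<in> carrier G" "\<pi> h = l'" using pi_lift l line_subset_V[OF st(2)] by blast
      have "\<pi> (g \<otimes>\<^bsub>G\<^esub> h) = \<pi> x" using pi.hom_mult[OF g(1) h(1)] g h l by metis
      then have "C = ?c g \<otimes>\<^bsub>G Mod center G\<^esub> ?c h"
        using prod[OF g(1) h(1)] center_coset_eq_iff[OF G.m_closed[OF g(1) h(1)] x(1)] x(2) by metis
      moreover have "g \<in> pre (line s t)" "h \<in> pre (line s' t')" using g h l by (auto simp: pre_def)
      ultimately show "C \<in> ?c ` pre (line s t) <#>\<^bsub>G Mod center G\<^esub> ?c ` pre (line s' t')"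
        unfolding set_mult_def by blast
    qed
    then show "carrier (quot_center G (pre (line s t))) <#>\<^bsub>G Mod center G\<^esub> carrier (quot_center G (pre (line s' t'))) =
        carrier (G Mod center G)"
      unfolding quot_center_carrier unfolding carrier_FactGroup .
  qed
  ultimately show "quot_center G M \<cong> quot_center G N \<and>
    internal_direct_product (G Mod center G) (carrier (quot_center G M)) (carrier (quot_center G N))" ..
qed

text \<open>Multiplying by the kernel of \<open>\<pi>\<close> saturates a subgroup to a union of
  fibres. This turns subgroups given as generators times Z(G) into preimages.\<close>

lemma set_mult_center:
  assumes "subgroup H G"
  shows "H <#>\<^bsub>G\<^esub> center G = pre (\<pi> ` H)"
proof (intro equalityI subsetI)
  interpret H: subgroup H G by fact
  fix x assume "x \<in> H <#>\<^bsub>G\<^esub> center G"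
  then obtain h c where h: "h \<in> H" and c: "c \<in> carrier G" "\<pi> c = \<one>\<^bsub>VG\<^esub>" and x: "x = h \<otimes>\<^bsub>G\<^esub> c"
    by (auto simp only: set_mult_def center_eq_kernel kernel_def)
  have hc: "h \<in> carrier G" using h H.subset by blast
  have "\<pi> x = \<pi> h" unfolding x pi.hom_mult[OF hc c(1)] c(2) by (rule VG.r_one[OF pi.hom_closed[OF hc]])
  then show "x \<in> pre (\<pi> ` H)" using h hc c x by (auto simp: pre_def)
next
  interpret H: subgroup H G by fact
  fix x assume "x \<in> pre (\<pi> ` H)"
  then obtain h where x: "x \<in> carrier G" and h: "h \<in> H" "\<pi> x = \<pi> h" by (auto simp: pre_def)
  have hc: "h \<in> carrier G" using h H.subset by blast
  have "\<pi> (inv\<^bsub>G\<^esub> h \<otimes>\<^bsub>G\<^esub> x) = inv\<^bsub>VG\<^esub> \<pi> h \<otimes>\<^bsub>VG\<^esub> \<pi> h"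
    using x hc h(2) by (simp only: pi.hom_mult pi.hom_inv G.inv_closed)
  also have "\<dots> = \<one>\<^bsub>VG\<^esub>" by (rule VG.l_inv[OF pi.hom_closed[OF hc]])
  finally have "inv\<^bsub>G\<^esub> h \<otimes>\<^bsub>G\<^esub> x \<in> center G"
    using x hc by (simp only: center_eq_kernel kernel_def mem_Collect_eq G.m_closed G.inv_closed simp_thms)
  moreover have "x = h \<otimes>\<^bsub>G\<^esub> (inv\<^bsub>G\<^esub> h \<otimes>\<^bsub>G\<^esub> x)" using x hc by (simp add: G.m_assoc[symmetric])
  ultimately show "x \<in> H <#>\<^bsub>G\<^esub> center G" using h(1) by (auto simp: set_mult_def)
qed

lemma generates_mod_center_iff:
  assumes "U \<subseteq> V"
  shows "generates_mod_center G n x (pre U) \<longleftrightarrow>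
    x ` {1..n} \<subseteq> carrier G \<and> generate VG ((\<lambda>i. \<pi> (x i)) ` {1..n}) = U"
proof (cases "x ` {1..n} \<subseteq> carrier G")
  case True
  have sub: "subgroup (generate G (x ` {1..n})) G" by (rule G.generate_is_subgroup[OF True])
  have img: "\<pi> ` generate G (x ` {1..n}) = generate VG ((\<lambda>i. \<pi> (x i)) ` {1..n})"
    using pi.generate_img[OF True] by (simp only: image_image)
  have "generate VG ((\<lambda>i. \<pi> (x i)) ` {1..n}) \<subseteq> V"
    unfolding img[symmetric] using subgroup.subset[OF sub] pi_V by blast
  then show ?thesis
    unfolding generates_mod_center_def set_mult_center[OF sub] img using True assms pre_inj by blast
qed (auto simp: generates_mod_center_def)

text \<open>Tensoring with a fixed point is an injective homomorphism, so generation of a line is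
  decided in F^r, independently of the point. Hence one generating system of F^r serves for all
  lines.\<close>

lemma generate_tensor:
  assumes "point s t" and u: "u ` {1..n} \<subseteq> W"
  shows "generate VG ((\<lambda>i. tensor s t (u i)) ` {1..n}) = line s t \<longleftrightarrow> generate WG (u ` {1..n}) = W"
proof -
  interpret T: group_hom WG VG "tensor s t" using assms tensor_hom by (simp add: point_def)
  have uW: "u ` {1..n} \<subseteq> carrier WG" using u by simp
  have img: "generate VG ((\<lambda>i. tensor s t (u i)) ` {1..n}) = tensor s t ` generate WG (u ` {1..n})"
    using T.generate_img[OF uW] by (simp only: image_image)
  have "generate WG (u ` {1..n}) \<subseteq> W"
    using subgroup.subset[OF T.G.generate_is_subgroup[OF uW]] by simp
  then show ?thesis
    unfolding img line_def using inj_on_image_eq_iff[OF tensor_inj[OF assms(1)]] by blast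
qed

lemma line_generators:
  assumes st: "point s t" and gen: "generates_mod_center G n x (pre (line s t))"
  obtains u where "u ` {1..n} \<subseteq> W" "generate WG (u ` {1..n}) = W"
    "\<And>i. i \<in> {1..n} \<Longrightarrow> \<pi> (x i) = tensor s t (u i)"
proof -
  have x: "generate VG ((\<lambda>i. \<pi> (x i)) ` {1..n}) = line s t"
    using gen generates_mod_center_iff[OF line_subset_V[OF st]] by blast
  have "\<forall>i\<in>{1..n}. \<exists>w. w \<in> W \<and> \<pi> (x i) = tensor s t w"
  proof
    fix i assume "i \<in> {1..n}"
    then have "\<pi> (x i) \<in> line s t" unfolding x[symmetric] by (intro generate.incl) blast
    then show "\<exists>w. w \<in> W \<and> \<pi> (x i) = tensor s t w" unfolding line_def by blast
  qed
  then obtain u where u: "\<And>i. i \<in> {1..n} \<Longrightarrow> u i \<in> W \<and> \<pi> (x i) = tensor s t (u i)" by metis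
  have uW: "u ` {1..n} \<subseteq> W" using u by blast
  have "(\<lambda>i. \<pi> (x i)) ` {1..n} = (\<lambda>i. tensor s t (u i)) ` {1..n}" using u by (intro image_cong) auto
  then have "generate WG (u ` {1..n}) = W" using x generate_tensor[OF st uW] by simp
  then show ?thesis using that uW u by blast
qed

lemma generates_lineI:
  assumes "point s t" "y ` {1..n} \<subseteq> carrier G" "u ` {1..n} \<subseteq> W" "generate WG (u ` {1..n}) = W"
    and y: "\<And>i. i \<in> {1..n} \<Longrightarrow> \<pi> (y i) = tensor s t (u i)"
  shows "generates_mod_center G n y (pre (line s t))"
proof -
  have "(\<lambda>i. \<pi> (y i)) ` {1..n} = (\<lambda>i. tensor s t (u i)) ` {1..n}" using y by (intro image_cong) auto
  then show ?thesis
    using assms generate_tensor[OF assms(1,3)] generates_mod_center_iff[OF line_subset_V[OF assms(1)]] by simp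
qed

lemma WG_exponent: "w \<in> carrier WG \<Longrightarrow> w [^]\<^bsub>WG\<^esub> p = \<one>\<^bsub>WG\<^esub>"
  unfolding vec_group_pow using char_p W_closed by auto

text \<open>Scale the points of M_1, M_2, M_k so that the third is the sum of the others. If x_j
  lies over u_j \<otimes> (s, t), choose y_j' over u_j \<otimes> (s', t'); then x_j y_j' lies over
  u_j \<otimes> (s + s', t + t'). The given y_i lie over w_i \<otimes> (s', t'), and the required
  matrix is the change of basis from w to u in F^r, a group of order q^r = p^n.\<close>

lemma P3:
  assumes n: "n = a * r"
  shows "P3 p n G"
  unfolding P3_def
proof (intro ballI impI)
  interpret WG: comm_group WG by (rule comm_group_WG)
  have qr: "q ^ r = p ^ n" by (simp add: card_R n power_mult)
  have cW: "card (carrier WG) = p ^ n" using card_W qr by simp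
  fix M1 M2
  assume M: "M1 \<in> atoms (cd_lattice G)" "M2 \<in> atoms (cd_lattice G)" and ne: "M1 \<noteq> M2"
  have quot: "elementary_abelian p (quot_center G M)" "Coset.order (quot_center G M) = p ^ n"
    if "M \<in> atoms (cd_lattice G)" for M
  proof -
    have "M \<in> pre ` lines" using that by (simp only: atoms_eq)
    then obtain s t where st: "point s t" "M = pre (line s t)" by (auto simp: lines_def)
    show "elementary_abelian p (quot_center G M)"
      unfolding st(2) by (rule quot_center_elementary_abelian[OF line_subgroup[OF st(1)]])
    show "Coset.order (quot_center G M) = p ^ n"
      unfolding st(2) quot_center_order[OF line_subgroup[OF st(1)]] card_line[OF st(1)] by (rule qr)
  qed
  have main: "\<exists>y'. generates_mod_center G n y' M2 \<and>
      generates_mod_center G n (\<lambda>j. x j \<otimes>\<^bsub>G\<^esub> y' j) Mk \<and>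
      (\<exists>c. invertible_matrix (residue_ring (int p)) n c \<and>
        (\<forall>j\<in>{1..n}. center G #>\<^bsub>G\<^esub> y' j =
          center G #>\<^bsub>G\<^esub> ordered_prod G n (\<lambda>i. y i [^]\<^bsub>G\<^esub> c i j)))"
    if gen: "generates_mod_center G n x M1" "generates_mod_center G n y M2"
      and Mk: "Mk \<in> atoms (cd_lattice G) - {M1, M2}" for x y Mk
  proof -
    have "M1 \<in> pre ` lines" "M2 \<in> pre ` lines" "Mk \<in> pre ` lines"
      using M Mk by (auto simp only: atoms_eq)
    then obtain s1 t1 s2 t2 s3 t3 where pts: "point s1 t1" "point s2 t2" "point s3 t3"
      and eqs: "M1 = pre (line s1 t1)" "M2 = pre (line s2 t2)" "Mk = pre (line s3 t3)"
      by (auto simp: lines_def)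
    have ne3: "line s1 t1 \<noteq> line s2 t2" "line s1 t1 \<noteq> line s3 t3" "line s2 t2 \<noteq> line s3 t3"
      using ne Mk eqs by auto
    \<comment> \<open>Only the representatives of the points change; the three lines stay the
      same.\<close>
    obtain s t s' t' where pt: "point s t" "point s' t'" "point (s \<oplus> s') (t \<oplus> t')"
      and l: "line s t = line s1 t1" "line s' t' = line s2 t2" "line (s \<oplus> s') (t \<oplus> t') = line s3 t3"
      using three_lines[OF pts ne3] .
    have M1: "M1 = pre (line s t)" and M2: "M2 = pre (line s' t')" and M3: "Mk = pre (line (s \<oplus> s') (t \<oplus> t'))"
      using eqs l by auto
    have st: "s \<in> carrier R" "t \<in> carrier R" "s' \<in> carrier R" "t' \<in> carrier R"
      using pt by (auto simp: point_def)
    have xG: "x ` {1..n} \<subseteq> carrier G" and yG: "y ` {1..n} \<subseteq> carrier G"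
      using gen by (auto simp: generates_mod_center_def)
    obtain u where u: "u ` {1..n} \<subseteq> W" "generate WG (u ` {1..n}) = W"
      "\<And>i. i \<in> {1..n} \<Longrightarrow> \<pi> (x i) = tensor s t (u i)"
      using line_generators[OF pt(1) gen(1)[unfolded M1]] by blast
    obtain w where w: "w ` {1..n} \<subseteq> W" "generate WG (w ` {1..n}) = W"
      "\<And>i. i \<in> {1..n} \<Longrightarrow> \<pi> (y i) = tensor s' t' (w i)"
      using line_generators[OF pt(2) gen(2)[unfolded M2]] by blast
    \<comment> \<open>The elements y_j' are lifts that carry the vectors of x_j over to the second
      line.\<close>
    have "\<forall>j\<in>{1..n}. \<exists>g. g \<in> carrier G \<and> \<pi> g = tensor s' t' (u j)"
    proof
      fix j assume "j \<in> {1..n}"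
      then have "tensor s' t' (u j) \<in> V" using u(1) st by (intro tensor_V) auto
      then show "\<exists>g. g \<in> carrier G \<and> \<pi> g = tensor s' t' (u j)" by (rule pi_lift) blast
    qed
    then obtain y' where y': "\<And>j. j \<in> {1..n} \<Longrightarrow> y' j \<in> carrier G \<and> \<pi> (y' j) = tensor s' t' (u j)"
      by metis
    have y'G: "y' ` {1..n} \<subseteq> carrier G" using y' by blast
    have 1: "generates_mod_center G n y' M2"
      unfolding M2 by (rule generates_lineI[OF pt(2) y'G u(1,2)]) (use y' in blast)
    have 2: "generates_mod_center G n (\<lambda>j. x j \<otimes>\<^bsub>G\<^esub> y' j) Mk"
      unfolding M3
    proof (rule generates_lineI[OF pt(3) _ u(1,2)])
      show "(\<lambda>j. x j \<otimes>\<^bsub>G\<^esub> y' j) ` {1..n} \<subseteq> carrier G" using xG y'G by auto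
      fix i assume i: "i \<in> {1..n}"
      have cl: "x i \<in> carrier G" "y' i \<in> carrier G" "u i \<in> W" using xG y' u(1) i by auto
      have "\<pi> (x i \<otimes>\<^bsub>G\<^esub> y' i) = tensor s t (u i) \<otimes>\<^bsub>VG\<^esub> tensor s' t' (u i)"
        using pi.hom_mult[OF cl(1,2)] u(3)[OF i] y'[OF i] by metis
      also have "\<dots> = tensor (s \<oplus> s') (t \<oplus> t') (u i)"
        using st W_closed[OF cl(3)] by (simp only: VG_mult tensor_def fst_conv snd_conv l_distr)
      finally show "\<pi> (x i \<otimes>\<^bsub>G\<^esub> y' i) = tensor (s \<oplus> s') (t \<oplus> t') (u i)" .
    qed
    have uw: "u ` {1..n} \<subseteq> carrier WG" "generate WG (u ` {1..n}) = carrier WG"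
      "w ` {1..n} \<subseteq> carrier WG" "generate WG (w ` {1..n}) = carrier WG"
      using u w by simp_all
    obtain c where c: "invertible_matrix (residue_ring (int p)) n c"
      "\<forall>j\<in>{1..n}. u j = WG.lincomb n w (\<lambda>i. c i j)"
      using WG.base_change_matrix[OF prime_p WG_exponent cW uw(3,4,1,2)] by blast
    have "center G #>\<^bsub>G\<^esub> y' j = center G #>\<^bsub>G\<^esub> ordered_prod G n (\<lambda>i. y i [^]\<^bsub>G\<^esub> c i j)"
      if j: "j \<in> {1..n}" for j
    proof -
      interpret T: group_hom WG VG "tensor s' t'" using st(3,4) by (rule tensor_hom)
      have powG: "(\<lambda>i. y i [^]\<^bsub>G\<^esub> c i j) ` {1..n} \<subseteq> carrier G" using yG by auto
      have powW: "(\<lambda>i. w i [^]\<^bsub>WG\<^esub> c i j) ` {1..n} \<subseteq> carrier WG"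
        using uw(3) by (intro image_subsetI WG.int_pow_closed) auto
      have opcong: "ordered_prod VG n f = ordered_prod VG n g" if "\<And>i. i \<in> {1..n} \<Longrightarrow> f i = g i" for f g
        unfolding ordered_prod_def by (rule foldr_cong) (use that in auto)
      \<comment> \<open>The congruence modulo Z(G) is checked after applying \<open>\<pi>\<close>.
        There the product is the image under the tensor map of a product in F^r, where the order of
        the factors is immaterial.\<close>
      have "\<pi> (ordered_prod G n (\<lambda>i. y i [^]\<^bsub>G\<^esub> c i j)) = ordered_prod VG n (\<lambda>i. \<pi> (y i [^]\<^bsub>G\<^esub> c i j))"
        by (rule pi.hom_ordered_prod[OF powG])
      also have "\<dots> = ordered_prod VG n (\<lambda>i. tensor s' t' (w i [^]\<^bsub>WG\<^esub> c i j))"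
      proof (rule opcong)
        fix i assume i: "i \<in> {1..n}"
        have "y i \<in> carrier G" "w i \<in> carrier WG" using yG uw(3) i by blast+
        then show "\<pi> (y i [^]\<^bsub>G\<^esub> c i j) = tensor s' t' (w i [^]\<^bsub>WG\<^esub> c i j)"
          by (simp only: pi.hom_int_pow T.hom_int_pow w(3)[OF i])
      qed
      also have "\<dots> = tensor s' t' (ordered_prod WG n (\<lambda>i. w i [^]\<^bsub>WG\<^esub> c i j))"
        by (rule T.hom_ordered_prod[OF powW, symmetric])
      also have "\<dots> = tensor s' t' (u j)"
        using WG.ordered_prod_eq_lincomb[OF uw(3)] c(2) j by simp
      also have "\<dots> = \<pi> (y' j)" using y'[OF j] by simp
      finally have eq: "\<pi> (y' j) = \<pi> (ordered_prod G n (\<lambda>i. y i [^]\<^bsub>G\<^esub> c i j))" by (rule sym)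
      then show ?thesis
        using center_coset_eq_iff y'[OF j] G.ordered_prod_closed[OF powG] by blast
    qed
    then show ?thesis using 1 2 c(1) by blast
  qed
  show "elementary_abelian p (quot_center G M1) \<and> Coset.order (quot_center G M1) = p ^ n \<and>
      elementary_abelian p (quot_center G M2) \<and> Coset.order (quot_center G M2) = p ^ n \<and>
      (\<forall>x y. generates_mod_center G n x M1 \<and> generates_mod_center G n y M2 \<longrightarrow>
        (\<forall>Mk\<in>atoms (cd_lattice G) - {M1, M2}.
          \<exists>y'. generates_mod_center G n y' M2 \<and>
            generates_mod_center G n (\<lambda>j. x j \<otimes>\<^bsub>G\<^esub> y' j) Mk \<and>
            (\<exists>c. invertible_matrix (residue_ring (int p)) n c \<and>
              (\<forall>j\<in>{1..n}.
                center G #>\<^bsub>G\<^esub> y' j =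
                center G #>\<^bsub>G\<^esub> ordered_prod G n (\<lambda>i. y i [^]\<^bsub>G\<^esub> c i j)))))"
    using quot[OF M(1)] quot[OF M(2)] main by blast
qed

theorem quasi_antichain_properties:
  assumes "n = a * r"
  shows "finite_p_group p G \<and> P1 p G \<and> P2 G \<and> P3 p n G \<and>
    Coset.order (G Mod center G) = p ^ (2 * n) \<and>
    quasi_antichain (cd_lattice G) (p ^ a + 1) \<and> card (abelian_atoms G) = 0"
proof -
  have "q ^ (2 * r) = p ^ (2 * n)" unfolding card_R assms power_mult[symmetric] by (simp add: ac_simps)
  then show ?thesis
    using order_G finite_G G.is_group P1 P2 P3[OF assms] cd_quasi_antichain order_G_Mod_center
    by (simp add: finite_p_group_def abelian_atoms_empty)
qed

end

section \<open>A model\<close>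

definition cocycle_group :: "('a, 'c) monoid_scheme \<Rightarrow> ('b, 'd) monoid_scheme \<Rightarrow> ('a \<Rightarrow> 'a \<Rightarrow> 'b) \<Rightarrow> ('a \<times> 'b) monoid"
  where "cocycle_group A B \<beta> = \<lparr>carrier = carrier A \<times> carrier B,
    monoid.mult = (\<lambda>x y. (fst x \<otimes>\<^bsub>A\<^esub> fst y, snd x \<otimes>\<^bsub>B\<^esub> snd y \<otimes>\<^bsub>B\<^esub> \<beta> (fst x) (fst y))),
    one = (\<one>\<^bsub>A\<^esub>, \<one>\<^bsub>B\<^esub>)\<rparr>"

text \<open>A bimultiplicative map satisfies the cocycle identity automatically, and in the
  extension two elements commute exactly when \<beta> is symmetric on their first
  components.\<close>

locale bimultiplicative = A: comm_group A + B: comm_group B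
  for A :: "('a, 'c) monoid_scheme" and B :: "('b, 'd) monoid_scheme" +
  fixes \<beta> :: "'a \<Rightarrow> 'a \<Rightarrow> 'b"
  assumes beta_closed: "x \<in> carrier A \<Longrightarrow> y \<in> carrier A \<Longrightarrow> \<beta> x y \<in> carrier B"
    and beta_mult_left: "x \<in> carrier A \<Longrightarrow> x' \<in> carrier A \<Longrightarrow> y \<in> carrier A \<Longrightarrow>
      \<beta> (x \<otimes>\<^bsub>A\<^esub> x') y = \<beta> x y \<otimes>\<^bsub>B\<^esub> \<beta> x' y"
    and beta_mult_right: "x \<in> carrier A \<Longrightarrow> y \<in> carrier A \<Longrightarrow> y' \<in> carrier A \<Longrightarrow>
      \<beta> x (y \<otimes>\<^bsub>A\<^esub> y') = \<beta> x y \<otimes>\<^bsub>B\<^esub> \<beta> x y'"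
begin

lemma beta_one_left: "y \<in> carrier A \<Longrightarrow> \<beta> \<one>\<^bsub>A\<^esub> y = \<one>\<^bsub>B\<^esub>"
  using beta_mult_left[of "\<one>\<^bsub>A\<^esub>" "\<one>\<^bsub>A\<^esub>" y] beta_closed[of "\<one>\<^bsub>A\<^esub>" y] by simp

abbreviation "E \<equiv> cocycle_group A B \<beta>"

lemma cocycle_simps:
  "carrier E = carrier A \<times> carrier B" "\<one>\<^bsub>E\<^esub> = (\<one>\<^bsub>A\<^esub>, \<one>\<^bsub>B\<^esub>)"
  "x \<otimes>\<^bsub>E\<^esub> y = (fst x \<otimes>\<^bsub>A\<^esub> fst y, snd x \<otimes>\<^bsub>B\<^esub> snd y \<otimes>\<^bsub>B\<^esub> \<beta> (fst x) (fst y))"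
  by (simp_all add: cocycle_group_def)

lemma group_cocycle: "group E"
proof (rule groupI)
  fix x y z assume "x \<in> carrier E" "y \<in> carrier E" "z \<in> carrier E"
  then have cl: "fst x \<in> carrier A" "fst y \<in> carrier A" "fst z \<in> carrier A"
    "snd x \<in> carrier B" "snd y \<in> carrier B" "snd z \<in> carrier B" by (auto simp: cocycle_simps)
  show "x \<otimes>\<^bsub>E\<^esub> y \<otimes>\<^bsub>E\<^esub> z = x \<otimes>\<^bsub>E\<^esub> (y \<otimes>\<^bsub>E\<^esub> z)"
    using cl by (simp add: cocycle_simps beta_closed beta_mult_left beta_mult_right A.m_assoc B.m_ac)
next
  fix x assume "x \<in> carrier E"
  then have cl: "fst x \<in> carrier A" "snd x \<in> carrier B" by (auto simp: cocycle_simps)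
  \<comment> \<open>The second factor cancels the cocycle value that arises in the product of
    \<open>y\<close> with \<open>x\<close>.\<close>
  define y where "y = (inv\<^bsub>A\<^esub> fst x, inv\<^bsub>B\<^esub> snd x \<otimes>\<^bsub>B\<^esub> inv\<^bsub>B\<^esub> \<beta> (inv\<^bsub>A\<^esub> fst x) (fst x))"
  have b: "\<beta> (inv\<^bsub>A\<^esub> fst x) (fst x) \<in> carrier B" using cl beta_closed by simp
  have "inv\<^bsub>B\<^esub> snd x \<otimes>\<^bsub>B\<^esub> inv\<^bsub>B\<^esub> c \<otimes>\<^bsub>B\<^esub> snd x \<otimes>\<^bsub>B\<^esub> c = \<one>\<^bsub>B\<^esub>" if c: "c \<in> carrier B" for c
  proof -
    have "inv\<^bsub>B\<^esub> snd x \<otimes>\<^bsub>B\<^esub> inv\<^bsub>B\<^esub> c \<otimes>\<^bsub>B\<^esub> snd x \<otimes>\<^bsub>B\<^esub> c = (inv\<^bsub>B\<^esub> snd x \<otimes>\<^bsub>B\<^esub> snd x) \<otimes>\<^bsub>B\<^esub> (inv\<^bsub>B\<^esub> c \<otimes>\<^bsub>B\<^esub> c)"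
      using c cl by (simp only: B.m_ac B.m_closed B.inv_closed)
    then show ?thesis using c cl by simp
  qed
  then have "y \<otimes>\<^bsub>E\<^esub> x = \<one>\<^bsub>E\<^esub>" using cl b by (simp add: y_def cocycle_simps)
  moreover have "y \<in> carrier E" using cl b by (simp add: y_def cocycle_simps)
  ultimately show "\<exists>y\<in>carrier E. y \<otimes>\<^bsub>E\<^esub> x = \<one>\<^bsub>E\<^esub>" by blast
qed (auto simp: cocycle_simps beta_closed beta_one_left)

lemma cocycle_commute_iff:
  assumes "x \<in> carrier E" "y \<in> carrier E"
  shows "x \<otimes>\<^bsub>E\<^esub> y = y \<otimes>\<^bsub>E\<^esub> x \<longleftrightarrow> \<beta> (fst x) (fst y) = \<beta> (fst y) (fst x)"
proof -
  have cl: "fst x \<in> carrier A" "fst y \<in> carrier A" "snd x \<in> carrier B" "snd y \<in> carrier B"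
    using assms by (auto simp: cocycle_simps)
  have b: "\<beta> (fst x) (fst y) \<in> carrier B" "\<beta> (fst y) (fst x) \<in> carrier B"
    using cl beta_closed by auto
  show ?thesis
    unfolding cocycle_simps A.m_comm[OF cl(1,2)] B.m_comm[OF cl(3,4)] prod.inject
    using cl b by (metis B.l_cancel B.m_closed)
qed

lemma fst_cocycle_hom: "fst \<in> hom E A"
  by (rule homI) (auto simp: cocycle_simps)

lemma cocycle_kernel_pow:
  assumes "m \<in> carrier B"
  shows "(\<one>\<^bsub>A\<^esub>, m) [^]\<^bsub>E\<^esub> (k::nat) = (\<one>\<^bsub>A\<^esub>, m [^]\<^bsub>B\<^esub> k)"
proof -
  interpret E: group E by (rule group_cocycle)
  show ?thesis
    by (induction k) (use assms in \<open>auto simp: cocycle_simps beta_one_left\<close>)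
qed

end

section \<open>The extension belonging to the form\<close>

context anisotropic_form
begin

text \<open>The matrix of y \<otimes> y' - \<nu> (x \<otimes> x') is bilinear but not alternating;
  the commutator is its antisymmetrization, the wedge form of the overview. Keeping all r x r
  matrices as values makes the center larger than the derived subgroup.\<close>

definition cocycle :: "(nat \<Rightarrow> 'a) \<times> (nat \<Rightarrow> 'a) \<Rightarrow> (nat \<Rightarrow> 'a) \<times> (nat \<Rightarrow> 'a) \<Rightarrow> nat \<times> nat \<Rightarrow> 'a"
  where "cocycle v w = (\<lambda>(i, j). snd v i \<otimes> snd w j \<ominus> \<nu> \<otimes> (fst v i \<otimes> fst w j))"

abbreviation "MG \<equiv> vec_group R ({..<r} \<times> {..<r})"

lemma bimultiplicative_cocycle: "bimultiplicative VG MG cocycle"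
proof -
  have VW: "fst v \<in> W" "snd v \<in> W" if "v \<in> carrier VG" for v
    using that unfolding carrier_VG by auto
  have c: "fst v i \<in> carrier R" "snd v i \<in> carrier R" if "v \<in> carrier VG" for v i
    using VW[OF that] W_closed by blast+
  have distr: "(a \<oplus> b) \<otimes> c \<ominus> \<nu> \<otimes> ((d \<oplus> e) \<otimes> f) = (a \<otimes> c \<ominus> \<nu> \<otimes> (d \<otimes> f)) \<oplus> (b \<otimes> c \<ominus> \<nu> \<otimes> (e \<otimes> f))"
    "c \<otimes> (a \<oplus> b) \<ominus> \<nu> \<otimes> (f \<otimes> (d \<oplus> e)) = (c \<otimes> a \<ominus> \<nu> \<otimes> (f \<otimes> d)) \<oplus> (c \<otimes> b \<ominus> \<nu> \<otimes> (f \<otimes> e))"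
    if "a \<in> carrier R" "b \<in> carrier R" "c \<in> carrier R" "d \<in> carrier R" "e \<in> carrier R" "f \<in> carrier R"
    for a b c d e f
    using that nu_closed by algebra+
  show ?thesis
  proof (intro bimultiplicative.intro bimultiplicative_axioms.intro comm_group_VG comm_group_vec_group)
    fix v w assume vw: "v \<in> carrier VG" "w \<in> carrier VG"
    have z: "fst v i = \<zero>" "snd v i = \<zero>" "fst w i = \<zero>" "snd w i = \<zero>" if "\<not> i < r" for i
      using VW[OF vw(1)] VW[OF vw(2)] that by (auto simp: vec_def)
    have "cocycle v w (i, j) \<in> carrier R" for i j
      using c[OF vw(1)] c[OF vw(2)] nu_closed by (simp add: cocycle_def)
    moreover have "cocycle v w (i, j) = \<zero>" if "(i, j) \<notin> {..<r} \<times> {..<r}" for i j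
    proof -
      have "\<not> i < r \<or> \<not> j < r" using that by auto
      then show ?thesis using z c[OF vw(1)] c[OF vw(2)] nu_closed by (auto simp: cocycle_def minus_eq)
    qed
    ultimately show "cocycle v w \<in> carrier MG" by (auto simp: vec_def)
  next
    fix v v' w assume "v \<in> carrier VG" "v' \<in> carrier VG" "w \<in> carrier VG"
    then show "cocycle (v \<otimes>\<^bsub>VG\<^esub> v') w = cocycle v w \<otimes>\<^bsub>MG\<^esub> cocycle v' w"
      unfolding VG_mult cocycle_def vec_group_simps fst_conv snd_conv
      by (simp only: distr(1) c case_prod_unfold)
  next
    fix v w w' assume "v \<in> carrier VG" "w \<in> carrier VG" "w' \<in> carrier VG"
    then show "cocycle v (w \<otimes>\<^bsub>VG\<^esub> w') = cocycle v w \<otimes>\<^bsub>MG\<^esub> cocycle v w'"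
      unfolding VG_mult cocycle_def vec_group_simps fst_conv snd_conv
      by (simp only: distr(2) c case_prod_unfold)
  qed
qed

lemma cocycle_sym_iff: "cocycle v w = cocycle w v \<longleftrightarrow> perp v w"
  if "v \<in> V" "w \<in> V"
proof -
  have W: "fst v \<in> W" "snd v \<in> W" "fst w \<in> W" "snd w \<in> W" using that by auto
  note c = W[THEN W_closed]
  have "cocycle v w = cocycle w v \<longleftrightarrow> (\<forall>i j. cocycle v w (i, j) = cocycle w v (i, j))"
    by (auto simp: fun_eq_iff)
  also have "\<dots> \<longleftrightarrow> perp v w"
    unfolding perp_def cocycle_def prod.case
    by (simp only: m_comm[OF c(3) c(1)] m_comm[OF c(4) c(2)])
  finally show ?thesis .
qed

lemma cd_extension_model:
  assumes p: "Factorial_Ring.prime p" and char: "\<And>x. x \<in> carrier R \<Longrightarrow> [p] \<cdot> x = \<zero>"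
    and card: "card (carrier R) = p ^ a"
  shows "cd_extension R \<nu> r (cocycle_group VG MG cocycle) fst p a"
proof -
  interpret E: bimultiplicative VG MG cocycle by (rule bimultiplicative_cocycle)
  interpret EG: group "cocycle_group VG MG cocycle" by (rule E.group_cocycle)
  have carrier: "carrier (cocycle_group VG MG cocycle) = V \<times> vec R ({..<r} \<times> {..<r})"
    by (simp only: E.cocycle_simps carrier_VG vec_group_simps)
  have fin: "finite (vec R ({..<r} \<times> {..<r}))" by (simp add: finite_vec finite_carrier)
  show ?thesis
  proof (unfold_locales)
    show "finite (carrier (cocycle_group VG MG cocycle))"
      unfolding carrier using fin finite_V by (rule finite_cartesian_product[rotated])
    have "card (carrier (cocycle_group VG MG cocycle)) = q ^ (2 * r) * q ^ (r * r)"
      unfolding carrier card_cartesian_product[of V] card_V by (simp add: card_vec card_cartesian_product)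
    then have "Coset.order (cocycle_group VG MG cocycle) = p ^ (a * (2 * r) + a * (r * r))"
      by (simp only: order_def card power_add power_mult)
    then show "\<exists>k. Coset.order (cocycle_group VG MG cocycle) = p ^ k" by blast
    show "fst \<in> hom (cocycle_group VG MG cocycle) VG" by (rule E.fst_cocycle_hom)
    have "(\<lambda>_. \<zero>) \<in> vec R ({..<r} \<times> {..<r})" by (simp add: vec_def)
    then show "fst ` carrier (cocycle_group VG MG cocycle) = V" unfolding carrier by auto
    show "g \<otimes>\<^bsub>cocycle_group VG MG cocycle\<^esub> h = h \<otimes>\<^bsub>cocycle_group VG MG cocycle\<^esub> g \<longleftrightarrow> perp (fst g) (fst h)"
      if gh: "g \<in> carrier (cocycle_group VG MG cocycle)" "h \<in> carrier (cocycle_group VG MG cocycle)" for g h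
      unfolding E.cocycle_commute_iff[OF gh] by (rule cocycle_sym_iff) (use gh in \<open>simp_all only: carrier mem_Times_iff\<close>)
    show "g [^]\<^bsub>cocycle_group VG MG cocycle\<^esub> p = \<one>\<^bsub>cocycle_group VG MG cocycle\<^esub>"
      if g: "g \<in> carrier (cocycle_group VG MG cocycle)" "fst g = (zero_vec, zero_vec)" for g
    proof -
      have m: "snd g \<in> carrier MG" using g(1) unfolding carrier by (simp add: mem_Times_iff)
      have g_eq: "g = (\<one>\<^bsub>VG\<^esub>, snd g)" by (simp only: VG_one g(2)[symmetric] prod.collapse)
      have pow: "snd g [^]\<^bsub>MG\<^esub> p = \<one>\<^bsub>MG\<^esub>"
        unfolding vec_group_pow using char m by (auto simp: vec_def)
      show ?thesis
        using E.cocycle_kernel_pow[OF m, of p] unfolding pow g_eq[symmetric] E.cocycle_simps(2) .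
    qed
  qed (use p char card in auto)
qed

end

text \<open>The interface is transported along the injection instead of its consequences. So the
  invariance of measures, lattices and generator conditions under isomorphism need not be
  proved.\<close>

lemma (in cd_extension) cd_extension_image_group:
  assumes f: "inj_on f (carrier G)"
  shows "cd_extension R \<nu> r (image_group f G) (\<lambda>x. \<pi> (inv_into (carrier G) f x)) p a"
proof -
  let ?G = "image_group f G" and ?h = "inv_into (carrier G) f"
  interpret I: group ?G by (rule G.inj_imp_image_group_is_group[OF f])
  have iso: "f \<in> iso G ?G" by (rule inj_imp_image_group_iso[OF f])
  have h: "?h \<in> iso ?G G" by (rule G.iso_set_sym[OF iso])
  interpret h: group_hom ?G G ?h by unfold_locales (use h in \<open>simp add: iso_def\<close>)
  have inj: "inj_on ?h (carrier ?G)" and img: "?h ` carrier ?G = carrier G"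
    using h by (auto simp: iso_def bij_betw_def)
  show ?thesis
  proof unfold_locales
    show "finite (carrier ?G)" by (simp add: image_group_carrier finite_G)
    show "\<exists>k. Coset.order ?G = p ^ k" using order_G by (simp add: order_def image_group_carrier card_image[OF f])
    show "(\<lambda>x. \<pi> (?h x)) \<in> hom ?G VG"
      using hom_compose[OF h.homh pi_hom] by (simp add: comp_def)
    show "(\<lambda>x. \<pi> (?h x)) ` carrier ?G = V" using img pi_surj by (metis image_image)
    show "x \<otimes>\<^bsub>?G\<^esub> y = y \<otimes>\<^bsub>?G\<^esub> x \<longleftrightarrow> perp (\<pi> (?h x)) (\<pi> (?h y))"
      if xy: "x \<in> carrier ?G" "y \<in> carrier ?G" for x y
    proof -
      have "x \<otimes>\<^bsub>?G\<^esub> y = y \<otimes>\<^bsub>?G\<^esub> x \<longleftrightarrow> ?h (x \<otimes>\<^bsub>?G\<^esub> y) = ?h (y \<otimes>\<^bsub>?G\<^esub> x)"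
        using inj_on_eq_iff[OF inj I.m_closed[OF xy] I.m_closed[OF xy(2,1)]] by simp
      also have "\<dots> \<longleftrightarrow> perp (\<pi> (?h x)) (\<pi> (?h y))"
        unfolding h.hom_mult[OF xy] h.hom_mult[OF xy(2,1)]
        by (rule commute_iff[OF h.hom_closed[OF xy(1)] h.hom_closed[OF xy(2)]])
      finally show ?thesis .
    qed
    show "x [^]\<^bsub>?G\<^esub> p = \<one>\<^bsub>?G\<^esub>" if x: "x \<in> carrier ?G" "\<pi> (?h x) = (zero_vec, zero_vec)" for x
    proof (rule inj_onD[OF inj])
      show "?h (x [^]\<^bsub>?G\<^esub> p) = ?h \<one>\<^bsub>?G\<^esub>"
        using h.hom_nat_pow[OF x(1)] kernel_exponent[OF h.hom_closed[OF x(1)] x(2)] h.hom_one by metis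
    qed (use x I.nat_pow_closed in auto)
  qed (use prime_p char_p card_R in auto)
qed

section \<open>Finite fields\<close>

context cring
begin

text \<open>Induction with Pascal's rule: multiplying the summand \<open>f k\<close> by x gives
  \<open>h k\<close> and by y gives \<open>g k\<close>, and \<open>h k\<close> and
  \<open>g (Suc k)\<close> are the two parts of a summand for the next exponent.\<close>

lemma binomial:
  assumes "x \<in> carrier R" "y \<in> carrier R"
  shows "(x \<oplus> y) [^] n = (\<Oplus>k\<in>{..n}. [(n choose k)] \<cdot> (x [^] k \<otimes> y [^] (n - k)))"
proof (induction n)
  case (Suc n)
  define f where "f k = [(n choose k)] \<cdot> (x [^] k \<otimes> y [^] (n - k))" for k
  define g where "g k = [(n choose k)] \<cdot> (x [^] k \<otimes> y [^] (Suc n - k))" for k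
  define h where "h k = [(n choose k)] \<cdot> (x [^] Suc k \<otimes> y [^] (n - k))" for k
  have cl: "f k \<in> carrier R" "g k \<in> carrier R" "h k \<in> carrier R" for k
    using assms by (auto simp: f_def g_def h_def)
  have xf: "x \<otimes> (\<Oplus>k\<in>{..n}. f k) = (\<Oplus>k\<in>{..n}. h k)"
  proof -
    have "x \<otimes> f k = h k" for k
      using assms by (simp add: f_def h_def add_pow_rdistr m_ac)
    then show ?thesis using assms cl by (simp add: finsum_rdistr)
  qed
  have yf: "y \<otimes> (\<Oplus>k\<in>{..n}. f k) = (\<Oplus>k\<in>{..n}. g k)"
  proof -
    have "y \<otimes> (\<Oplus>k\<in>{..n}. f k) = (\<Oplus>k\<in>{..n}. y \<otimes> f k)"
      using assms cl by (simp add: finsum_rdistr)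
    also have "\<dots> = (\<Oplus>k\<in>{..n}. g k)"
    proof (rule finsum_cong')
      fix k assume "k \<in> {..n}"
      then show "y \<otimes> f k = g k"
        using assms by (simp add: f_def g_def add_pow_rdistr Suc_diff_le m_ac)
    qed (use cl in auto)
    finally show ?thesis .
  qed
  \<comment> \<open>The sum may be extended by the index n + 1, where the binomial coefficient is
    zero, before its lowest term is split off.\<close>
  have g_shift: "(\<Oplus>k\<in>{..n}. g k) = g 0 \<oplus> (\<Oplus>k\<in>{..n}. g (Suc k))"
  proof -
    have "(\<Oplus>k\<in>{..Suc n}. g k) = (\<Oplus>k\<in>{..n}. g (Suc k)) \<oplus> g 0"
      using cl by (intro finsum_Suc2) auto
    moreover have "(\<Oplus>k\<in>{..Suc n}. g k) = g (Suc n) \<oplus> (\<Oplus>k\<in>{..n}. g k)"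
      using cl by (intro finsum_Suc) auto
    moreover have "g (Suc n) = \<zero>" unfolding g_def by (subst binomial_eq_0) simp_all
    ultimately show ?thesis using cl by (simp add: a_comm)
  qed
  have term_Suc: "[(Suc n choose Suc k)] \<cdot> (x [^] Suc k \<otimes> y [^] (Suc n - Suc k)) = h k \<oplus> g (Suc k)" for k
    using assms by (simp add: h_def g_def add.nat_pow_mult[symmetric] del: nat_pow_Suc)
  have "(\<Oplus>k\<in>{..Suc n}. [(Suc n choose k)] \<cdot> (x [^] k \<otimes> y [^] (Suc n - k))) =
      (\<Oplus>k\<in>{..n}. [(Suc n choose Suc k)] \<cdot> (x [^] Suc k \<otimes> y [^] (Suc n - Suc k))) \<oplus>
      [(Suc n choose 0)] \<cdot> (x [^] (0::nat) \<otimes> y [^] (Suc n - 0))"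
    by (rule finsum_Suc2) (use assms in auto)
  also have "\<dots> = (\<Oplus>k\<in>{..n}. h k \<oplus> g (Suc k)) \<oplus> g 0"
    unfolding term_Suc by (simp add: g_def)
  also have "\<dots> = (\<Oplus>k\<in>{..n}. h k) \<oplus> (\<Oplus>k\<in>{..n}. g (Suc k)) \<oplus> g 0"
    using cl by (simp add: finsum_addf)
  also have "\<dots> = (\<Oplus>k\<in>{..n}. h k) \<oplus> (\<Oplus>k\<in>{..n}. g k)"
    unfolding g_shift using cl by (simp add: a_ac)
  also have "\<dots> = (x \<oplus> y) \<otimes> (\<Oplus>k\<in>{..n}. f k)"
    unfolding xf[symmetric] yf[symmetric] using assms cl by (simp add: l_distr)
  also have "\<dots> = (x \<oplus> y) [^] Suc n"
    using Suc assms by (simp add: f_def m_comm)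
  finally show ?case by simp
qed (use assms in simp)

lemma char_add_pow:
  assumes "[(p::nat)] \<cdot> \<one> = \<zero>" "x \<in> carrier R"
  shows "[p] \<cdot> x = \<zero>"
  using add_pow_ldistr[of \<one> x p] assms by simp

text \<open>For the exponent p all binomial coefficients except the outer ones are divisible by p
  and vanish in the ring; powers of p follow by iteration.\<close>

lemma frobenius_add:
  assumes p: "Factorial_Ring.prime (p::nat)" and char: "[p] \<cdot> \<one> = \<zero>"
    and x: "x \<in> carrier R" "y \<in> carrier R"
  shows "(x \<oplus> y) [^] (p ^ a) = x [^] (p ^ a) \<oplus> y [^] (p ^ a)"
proof (induction a)
  case (Suc a)
  have frob: "(x \<oplus> y) [^] p = x [^] p \<oplus> y [^] p" if x: "x \<in> carrier R" "y \<in> carrier R" for x y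
  proof -
    obtain m where m: "p = Suc m" using prime_gt_0_nat[OF p] gr0_implies_Suc by blast
    let ?f = "\<lambda>k. [(p choose k)] \<cdot> (x [^] k \<otimes> y [^] (p - k))"
    have f: "?f \<in> {..Suc m} \<rightarrow> carrier R" using x by auto
    have mid: "?f k = \<zero>" if "0 < k" "k < p" for k
    proof -
      have "p dvd (p choose k)" using dvd_choose_prime[of k p] that p by auto
      then obtain l where l: "p choose k = p * l" by blast
      have "[(p * l)] \<cdot> z = \<zero>" if "z \<in> carrier R" for z
      proof -
        have "[(p * l)] \<cdot> z = [l] \<cdot> ([p] \<cdot> z)" using add.nat_pow_pow[OF that, of l p] by (simp add: mult.commute)
        then show ?thesis using char_add_pow[OF char that] by simp
      qed
      then show ?thesis unfolding l using x by simp
    qed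
    have "(x \<oplus> y) [^] p = (\<Oplus>k\<in>{..Suc m}. ?f k)" using binomial[OF x, of p] m by simp
    also have "\<dots> = ?f (Suc m) \<oplus> (\<Oplus>k\<in>{..m}. ?f k)" by (rule finsum_Suc[OF f])
    also have "(\<Oplus>k\<in>{..m}. ?f k) = (\<Oplus>k\<in>{..m}. if 0 = k then y [^] p else \<zero>)"
      by (rule finsum_cong') (use x mid m in auto)
    also have "\<dots> = y [^] p"
      by (rule add.finprod_singleton) (use x in auto)
    also have "?f (Suc m) = x [^] p" using x m by simp
    finally show ?thesis .
  qed
  have pw: "z [^] (p ^ Suc a) = (z [^] (p ^ a)) [^] p" if "z \<in> carrier R" for z
    using nat_pow_pow[OF that, of "p ^ a" p] by (simp add: mult.commute)
  show ?case using Suc x by (simp add: pw frob del: power_Suc)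
qed (use x in simp)

end

lemma (in ring_hom_ring) hom_char:
  assumes "[(p::nat)] \<cdot>\<^bsub>R\<^esub> \<one>\<^bsub>R\<^esub> = \<zero>\<^bsub>R\<^esub>"
  shows "[p] \<cdot>\<^bsub>S\<^esub> \<one>\<^bsub>S\<^esub> = \<zero>\<^bsub>S\<^esub>"
proof -
  have "h ([m] \<cdot>\<^bsub>R\<^esub> \<one>\<^bsub>R\<^esub>) = [m] \<cdot>\<^bsub>S\<^esub> \<one>\<^bsub>S\<^esub>" for m :: nat
    by (induction m) simp_all
  from this[of p] show ?thesis by (simp add: assms)
qed

lemma size_eq_card_set_mset:
  assumes "\<And>x. count M x \<le> 1"
  shows "size M = card (set_mset M)"
proof -
  have "size M = (\<Sum>x\<in>set_mset M. count M x)" by (rule size_multiset_overloaded_eq)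
  also have "\<dots> = (\<Sum>x\<in>set_mset M. 1)"
  proof (rule sum.cong)
    fix x assume "x \<in># M"
    then have "0 < count M x" by simp
    then show "count M x = 1" using assms[of x] by linarith
  qed simp
  finally show ?thesis by simp
qed

section \<open>Fixed points of a power of the Frobenius map\<close>

context algebraically_closed
begin

text \<open>The fixed points are the roots of X^q - X, which splits over L. Their number is
  therefore its degree q, provided that no root is multiple.\<close>

lemma card_frobenius_fixed:
  assumes p: "Factorial_Ring.prime (p::nat)" and char: "[p] \<cdot> \<one> = \<zero>" and a: "0 < a"
  shows "card {x \<in> carrier L. x [^] (p ^ a) = x} = p ^ a"
proof -
  interpret UP: domain "poly_ring L" by (rule univ_poly_is_domain[OF carrier_is_subring])
  interpret const: ring_hom_ring L "poly_ring L" poly_of_const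
    using canonical_embedding_ring_hom[OF carrier_is_subring] by simp
  have UP_char: "[p] \<cdot>\<^bsub>poly_ring L\<^esub> \<one>\<^bsub>poly_ring L\<^esub> = \<zero>\<^bsub>poly_ring L\<^esub>" by (rule const.hom_char[OF char])
  define q where "q = p ^ a"
  have q: "1 < q" using one_less_power[OF prime_gt_1_nat[OF p] a] by (simp add: q_def)
  define V where "V = X"
  have V: "V \<in> carrier (poly_ring L)" unfolding V_def by (rule var_closed(1)[OF carrier_is_subring])
  have degV: "degree V = 1" by (simp add: V_def var_def)
  define P where "P = V [^]\<^bsub>poly_ring L\<^esub> q \<ominus>\<^bsub>poly_ring L\<^esub> V"
  have P: "P \<in> carrier (poly_ring L)" using V by (simp add: P_def)
  have Vq: "V [^]\<^bsub>poly_ring L\<^esub> q \<in> carrier (poly_ring L)" using V by simp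
  have degVq: "degree (V [^]\<^bsub>poly_ring L\<^esub> q) = q" using polynomial_pow_degree[OF V, of q] degV by simp
  have degP: "degree P = q"
  proof (rule antisym)
    \<comment> \<open>The degree of a sum is only bounded above, so the lower bound comes from
      solving for the leading power: q is at most the larger of deg P and 1, and q > 1.\<close>
    have "V [^]\<^bsub>poly_ring L\<^esub> q = P \<oplus>\<^bsub>poly_ring L\<^esub> V" unfolding P_def using V Vq by algebra
    then have "q \<le> max (degree P) 1"
      using poly_add_degree[of P V] degVq degV by (simp add: univ_poly_add)
    then show "q \<le> degree P" using q by linarith
    have "degree P \<le> max q (degree (\<ominus>\<^bsub>poly_ring L\<^esub> V))"
      using poly_add_degree[of "V [^]\<^bsub>poly_ring L\<^esub> q" "\<ominus>\<^bsub>poly_ring L\<^esub> V"] degVq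
      by (simp add: P_def a_minus_def univ_poly_add)
    then show "degree P \<le> q"
      using q univ_poly_a_inv_degree[OF carrier_is_subring V] degV by simp
  qed
  have P0: "P \<noteq> []" using degP q by auto
  have root_iff: "is_root P c \<longleftrightarrow> c \<in> carrier L \<and> c [^] q = c" for c
  proof (cases "c \<in> carrier L")
    case True
    interpret ev: ring_hom_ring "poly_ring L" L "\<lambda>p. eval p c"
      using eval_is_hom[OF carrier_is_subring True] UP.ring_axioms ring_axioms
      by (intro ring_hom_ring.intro ring_hom_ring_axioms.intro)
    have "eval V c = c" unfolding V_def by (rule eval_var[OF True])
    then have "eval P c = c [^] q \<ominus> c"
      unfolding P_def a_minus_def using V Vq True by (simp add: ev.hom_nat_pow)
    then show ?thesis using True P0 by (simp add: is_root_def)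
  qed (simp add: is_root_def)
  have "count (roots P) c \<le> 1" for c
  proof (rule ccontr)
    \<comment> \<open>By the Frobenius identity, \<open>P = X\<^sup>q - X\<close> is also \<open>T\<^sup>q - T\<close> for \<open>T = X - c\<close>, so a square of \<open>T\<close>
      dividing \<open>P\<close> would divide \<open>T\<close>.\<close>
    assume "\<not> count (roots P) c \<le> 1"
    then have mult: "2 \<le> alg_mult P c" using alg_mult_eq_count_roots[OF P] by simp
    then have "is_root P c" using alg_mult_gt_zero_iff_is_root[OF P, of c] by simp
    then have c: "c \<in> carrier L" "c [^] q = c" using root_iff by auto
    define T where "T = [\<one>, \<ominus> c]"
    define C where "C = poly_of_const c"
    have T: "T \<in> carrier (poly_ring L)"
      using c by (simp add: T_def univ_poly_def polynomial_def)
    have C: "C \<in> carrier (poly_ring L)" unfolding C_def using c(1) by simp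
    have "C [^]\<^bsub>poly_ring L\<^esub> q = C"
      unfolding C_def using const.hom_nat_pow[OF c(1), of q] c(2) by simp
    moreover have V_eq: "V = T \<oplus>\<^bsub>poly_ring L\<^esub> C"
      using c by (auto simp: V_def T_def C_def var_def poly_of_const_def univ_poly_add l_neg)
    moreover have "(T \<oplus>\<^bsub>poly_ring L\<^esub> C) [^]\<^bsub>poly_ring L\<^esub> q = T [^]\<^bsub>poly_ring L\<^esub> q \<oplus>\<^bsub>poly_ring L\<^esub> C [^]\<^bsub>poly_ring L\<^esub> q"
      unfolding q_def by (rule UP.frobenius_add[OF p UP_char T C])
    ultimately have PT: "P = (T [^]\<^bsub>poly_ring L\<^esub> q \<oplus>\<^bsub>poly_ring L\<^esub> C) \<ominus>\<^bsub>poly_ring L\<^esub> (T \<oplus>\<^bsub>poly_ring L\<^esub> C)"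
      by (simp add: P_def)
    have "T [^]\<^bsub>poly_ring L\<^esub> (2::nat) pdivides P"
      unfolding T_def by (rule le_alg_mult_imp_pdivides[OF c(1) P mult])
    then obtain S where S: "S \<in> carrier (poly_ring L)" "P = T [^]\<^bsub>poly_ring L\<^esub> (2::nat) \<otimes>\<^bsub>poly_ring L\<^esub> S"
      unfolding pdivides_def by (rule dividesE)
    define T2 where "T2 = T [^]\<^bsub>poly_ring L\<^esub> (2::nat)"
    define T' where "T' = T [^]\<^bsub>poly_ring L\<^esub> (q - 2)"
    have T2: "T2 \<in> carrier (poly_ring L)" "T' \<in> carrier (poly_ring L)" using T by (simp_all add: T2_def T'_def)
    have q2: "2 + (q - 2) = q" using q by simp
    have Tq: "T [^]\<^bsub>poly_ring L\<^esub> q = T2 \<otimes>\<^bsub>poly_ring L\<^esub> T'"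
      unfolding T2_def T'_def by (simp only: UP.nat_pow_mult[OF T] q2)
    have "T = (T2 \<otimes>\<^bsub>poly_ring L\<^esub> T' \<oplus>\<^bsub>poly_ring L\<^esub> C) \<ominus>\<^bsub>poly_ring L\<^esub> C \<ominus>\<^bsub>poly_ring L\<^esub>
        ((T2 \<otimes>\<^bsub>poly_ring L\<^esub> T' \<oplus>\<^bsub>poly_ring L\<^esub> C) \<ominus>\<^bsub>poly_ring L\<^esub> (T \<oplus>\<^bsub>poly_ring L\<^esub> C))"
      using T T2 C by algebra
    also have "\<dots> = (T2 \<otimes>\<^bsub>poly_ring L\<^esub> T' \<oplus>\<^bsub>poly_ring L\<^esub> C) \<ominus>\<^bsub>poly_ring L\<^esub> C \<ominus>\<^bsub>poly_ring L\<^esub> (T2 \<otimes>\<^bsub>poly_ring L\<^esub> S)"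
      using PT S(2) unfolding Tq T2_def[symmetric] by simp
    also have "\<dots> = T2 \<otimes>\<^bsub>poly_ring L\<^esub> (T' \<ominus>\<^bsub>poly_ring L\<^esub> S)"
      using T2 C S(1) by algebra
    finally have "T2 pdivides T"
      unfolding pdivides_def using T2 S(1) by (intro dividesI[of "T' \<ominus>\<^bsub>poly_ring L\<^esub> S"]) auto
    then have "degree T2 \<le> degree T"
      by (rule pdivides_imp_degree_le[OF carrier_is_subring T2(1) T, rotated]) (simp add: T_def)
    moreover have "degree T2 = 2 * degree T" unfolding T2_def by (rule polynomial_pow_degree[OF T])
    ultimately show False by (simp add: T_def)
  qed
  then have "size (roots P) = card (set_mset (roots P))" by (rule size_eq_card_set_mset)
  moreover have "set_mset (roots P) = {x \<in> carrier L. x [^] q = x}"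
    using roots_mem_iff_is_root[OF P] root_iff by auto
  moreover have "size (roots P) = q" using roots_over_carrier[OF P] degP by (simp add: splitted_def)
  ultimately show ?thesis by (simp add: q_def)
qed

text \<open>The Frobenius identity gives closure under sums; products and inverses are preserved
  because power maps are multiplicative.\<close>

lemma subfield_frobenius_fixed:
  assumes p: "Factorial_Ring.prime (p::nat)" and char: "[p] \<cdot> \<one> = \<zero>"
  shows "subfield {x \<in> carrier L. x [^] (p ^ a) = x} L"
proof (rule subfieldI')
  define q where "q = p ^ a"
  have q: "0 < q" using prime_gt_0_nat[OF p] by (simp add: q_def)
  show "subring {x \<in> carrier L. x [^] (p ^ a) = x} L"
    unfolding q_def[symmetric]
  proof (rule subringI)
    fix x y assume x: "x \<in> {x \<in> carrier L. x [^] q = x}" and y: "y \<in> {x \<in> carrier L. x [^] q = x}"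
    show "x \<otimes> y \<in> {x \<in> carrier L. x [^] q = x}" using x y by (simp add: nat_pow_distrib)
    show "x \<oplus> y \<in> {x \<in> carrier L. x [^] q = x}"
      using x y frobenius_add[OF p char, of x y a] by (simp add: q_def)
  next
    fix x assume x: "x \<in> {x \<in> carrier L. x [^] q = x}"
    \<comment> \<open>The power of -x is found from the vanishing sum x + (-x), without
      distinguishing the parity of q.\<close>
    have "(x \<oplus> \<ominus> x) [^] q = x [^] q \<oplus> (\<ominus> x) [^] q"
      unfolding q_def by (rule frobenius_add[OF p char]) (use x in auto)
    then have "x \<oplus> (\<ominus> x) [^] q = \<zero>" using x q by (simp add: r_neg nat_pow_zero)
    then have "(\<ominus> x) [^] q = \<ominus> x" using x minus_equality[of "(\<ominus> x) [^] q" x] by (simp add: a_comm)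
    then show "\<ominus> x \<in> {x \<in> carrier L. x [^] q = x}" using x by simp
  qed auto
next
  fix x assume "x \<in> {x \<in> carrier L. x [^] (p ^ a) = x} - {\<zero>}"
  then have x: "x \<in> carrier L" "x [^] (p ^ a) = x" "x \<noteq> \<zero>" by auto
  then have u: "x \<in> Units L" using field_Units by blast
  have "x [^] (p ^ a) \<otimes> inv x [^] (p ^ a) = (x \<otimes> inv x) [^] (p ^ a)"
    using x(1) u by (simp only: nat_pow_distrib Units_inv_closed)
  then have "x \<otimes> inv x [^] (p ^ a) = \<one>" unfolding x(2) using u by simp
  then have "inv x = inv x [^] (p ^ a)" using x u by (intro comm_inv_char) auto
  then show "inv x \<in> {x \<in> carrier L. x [^] (p ^ a) = x}" using u by auto
qed

end

text \<open>The field consists of the fixed points of x \<mapsto> x^(p^a) in an algebraic closure of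
  the prime field; the type of its elements is that of the closure construction over integer
  residues.\<close>

theorem exists_finite_field:
  assumes p: "Factorial_Ring.prime (p::nat)" and a: "0 < a"
  obtains F :: "((int list \<times> nat) multiset \<Rightarrow> int) ring"
  where "field F" "card (carrier F) = p ^ a" "\<And>x. x \<in> carrier F \<Longrightarrow> [p] \<cdot>\<^bsub>F\<^esub> x = \<zero>\<^bsub>F\<^esub>"
proof -
  interpret Rp: residues_prime p "residue_ring (int p)"
    by (rule residues_prime.intro[OF p])
  define L where "L = field.alg_closure (residue_ring (int p))"
  interpret L: algebraic_closure L "ring.indexed_const (residue_ring (int p)) ` carrier (residue_ring (int p))"
    unfolding L_def by (rule field.alg_closureE(1)[OF Rp.is_field])
  interpret h: ring_hom_ring "residue_ring (int p)" L "ring.indexed_const (residue_ring (int p))"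
    using field.alg_closureE(2)[OF Rp.is_field] L.ring_axioms field.is_ring[OF Rp.is_field] unfolding L_def[symmetric]
    by (intro ring_hom_ring.intro ring_hom_ring_axioms.intro)
  have "[m] \<cdot>\<^bsub>residue_ring (int p)\<^esub> \<one>\<^bsub>residue_ring (int p)\<^esub> = int m mod int p" for m :: nat
    by (induction m) (simp_all add: Rp.res_zero_eq Rp.res_one_eq Rp.res_add_eq mod_simps add.commute)
  from this[of p] have char: "[p] \<cdot>\<^bsub>L\<^esub> \<one>\<^bsub>L\<^esub> = \<zero>\<^bsub>L\<^esub>"
    by (intro h.hom_char) (simp add: Rp.res_zero_eq)
  define S where "S = {x \<in> carrier L. x [^]\<^bsub>L\<^esub> (p ^ a) = x}"
  show thesis
  proof (rule that[of "L\<lparr>carrier := S\<rparr>"])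
    show "field (L\<lparr>carrier := S\<rparr>)"
      unfolding S_def by (rule L.subfield_iff(2)[OF L.subfield_frobenius_fixed[OF p char]])
    show "card (carrier (L\<lparr>carrier := S\<rparr>)) = p ^ a"
      unfolding S_def using L.card_frobenius_fixed[OF p char a] by simp
    fix x assume "x \<in> carrier (L\<lparr>carrier := S\<rparr>)"
    then have "x \<in> carrier L" by (simp add: S_def)
    then show "[p] \<cdot>\<^bsub>L\<lparr>carrier := S\<rparr>\<^esub> x = \<zero>\<^bsub>L\<lparr>carrier := S\<rparr>\<^esub>"
      using L.char_add_pow[OF char] by (simp add: add_pow_def nat_pow_def)
  qed
qed

text \<open>In odd characteristic 1 and -1 are distinct: otherwise 2 = 0, and p = 2 k + 1 would give
  1 = 0. They have the same square, so squaring is not injective and, the field being finite, not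
  surjective.\<close>

lemma (in field) exists_nonsquare:
  assumes fin: "finite (carrier R)" and p: "odd p" and char: "[(p::nat)] \<cdot> \<one> = \<zero>"
  obtains \<nu> where "\<nu> \<in> carrier R" "\<And>x. x \<in> carrier R \<Longrightarrow> x \<otimes> x \<noteq> \<nu>"
proof -
  obtain k where k: "p = 2 * k + 1" using p by (rule oddE)
  have ne: "\<ominus> \<one> \<noteq> \<one>"
  proof
    assume "\<ominus> \<one> = \<one>"
    then have two: "[(2::nat)] \<cdot> \<one> = \<zero>" using l_neg[of \<one>] by (simp add: numeral_2_eq_2)
    have "[p] \<cdot> \<one> = [(2 * k)] \<cdot> \<one> \<oplus> \<one>" by (simp add: k)
    also have "[(2 * k)] \<cdot> \<one> = [k] \<cdot> ([(2::nat)] \<cdot> \<one>)" using add.nat_pow_pow[of \<one> k 2] by (simp add: mult.commute)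
    finally show False using two char by simp
  qed
  have "\<not> inj_on (\<lambda>x. x \<otimes> x) (carrier R)"
  proof
    assume "inj_on (\<lambda>x. x \<otimes> x) (carrier R)"
    moreover have "\<ominus> \<one> \<otimes> \<ominus> \<one> = \<one> \<otimes> \<one>" by algebra
    ultimately show False using ne inj_onD[of "\<lambda>x. x \<otimes> x" "carrier R" "\<ominus> \<one>" \<one>] by simp
  qed
  then have "(\<lambda>x. x \<otimes> x) ` carrier R \<noteq> carrier R"
    using fin eq_card_imp_inj_on by metis
  then obtain \<nu> where "\<nu> \<in> carrier R" "\<nu> \<notin> (\<lambda>x. x \<otimes> x) ` carrier R" by blast
  then show ?thesis using that by blast
qed

theorem theorem9:
  fixes p a r n :: nat
  assumes "Factorial_Ring.prime p" and "odd p"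
    and "a > 0" and "odd a"
    and "r > 0" and "r \<ge> 3"
    and "n = a * r"
  shows "\<exists>G :: nat monoid.
    finite_p_group p G \<and> P1 p G \<and> P2 G \<and> P3 p n G \<and>
    Coset.order (G Mod center G) = p ^ (2 * n) \<and>
    quasi_antichain (cd_lattice G) (p ^ a + 1) \<and>
    card (abelian_atoms G) = 0"
proof -
  obtain F :: "((int list \<times> nat) multiset \<Rightarrow> int) ring" where F: "field F"
    and card: "card (carrier F) = p ^ a"
    and char: "\<And>x. x \<in> carrier F \<Longrightarrow> [p] \<cdot>\<^bsub>F\<^esub> x = \<zero>\<^bsub>F\<^esub>"
    using exists_finite_field[OF assms(1,3)] by blast
  interpret F: field F by (rule F)
  have fin: "finite (carrier F)"
    using card prime_gt_0_nat[OF assms(1)] by (intro card_ge_0_finite) simp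
  obtain \<nu> where \<nu>: "\<nu> \<in> carrier F" "\<And>x. x \<in> carrier F \<Longrightarrow> x \<otimes>\<^bsub>F\<^esub> x \<noteq> \<nu>"
    using F.exists_nonsquare[OF fin assms(2) char[OF F.one_closed]] by blast
  interpret anisotropic_form F \<nu> r
    by unfold_locales (fact fin \<nu> assms(6))+
  let ?E = "cocycle_group VG MG cocycle"
  interpret E: cd_extension F \<nu> r ?E fst p a
    by (rule cd_extension_model[OF assms(1) char card])
  \<comment> \<open>The model lives on pairs of functions into the closure of the prime field; as
    its carrier is finite, an injection moves it to the natural numbers.\<close>
  obtain f :: "_ \<Rightarrow> nat" where f: "inj_on f (carrier ?E)"
    using finite_imp_inj_to_nat_seg[OF E.finite_G] by blast
  interpret N: cd_extension F \<nu> r "image_group f ?E" "\<lambda>x. fst (inv_into (carrier ?E) f x)" p a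
    by (rule E.cd_extension_image_group[OF f])
  show ?thesis using N.quasi_antichain_properties[OF assms(7)] by blast
qed

end
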